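(* Let $k\ge4$ be an even integer. (a) The point $\frac12+i\frac{\sqrt3}{2}$ is a zero of ${\rm E}_k'$ if and only if $k\equiv 2 \bmod 6$. (b) The number of zeros of ${\rm E}_k'$ on the open half-line $\{\frac12+it : t>\frac{\sqrt3}{2}\}$ is $[\frac{k-4}{6}]$.
   Context: $\mathfrak{H}$ is the upper half-plane. For even $k\ge4$, ${\rm E}_k(z)=1-\frac{2k}{{\rm B}_k}\sum_{n\ge1}\sigma_{k-1}(n)q^n$, $q=e^{2\pi i z}$, is the normalized Eisenstein series of weight $k$ for ${\bf SL}_2({\bf Z})$ (${\rm B}_k$ Bernoulli number, $\sigma_{k-1}(n)=\sum_{d\mid n}d^{k-1}$), and ${\rm E}_k'$ is its derivative in $z$. $[x]$ denotes the largest integer $\le x$. *)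

theory Defs
  imports "HOL-Complex_Analysis.Complex_Analysis" "HOL-Number_Theory.Cong"
begin

text \<open>
  Bernoulli numbers, by the generating function $t / (e^t - 1) = \sum_n B_n t^n / n!$.
  Numerator and denominator both vanish at $0$ to exactly first order, so the division of
  formal power series is exact. The convention is $B_1 = -1/2$; only even indices are used below.
\<close>

definition bernoulli_number :: "nat \<Rightarrow> real" where
  "bernoulli_number n = fact n * fps_nth (fps_X / (fps_exp 1 - 1)) n"

definition sigma :: "nat \<Rightarrow> nat \<Rightarrow> nat" where
  "sigma s n = (\<Sum>d | d dvd n. d ^ s)"

text \<open>
  The series starts at $n = 1$, hence the shift by one. The value is only meaningful for
  $\mathrm{Im}\, z > 0$, where the series converges absolutely.
\<close>

definition Eisenstein_E :: "nat \<Rightarrow> complex \<Rightarrow> complex" where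
  "Eisenstein_E k z =
     1 - of_real (2 * real k / bernoulli_number k) *
         (\<Sum>n. of_nat (sigma (k - 1) (Suc n)) * exp (2 * of_real pi * \<i> * z) ^ Suc n)"

end

(*
  Put q = exp(2 pi i z) and N = k + 1. On the upper half-plane E_k' is a nonzero multiple of
  F(q) = sum n sigma_{k-1}(n) q^n = sum_m m L(q^m), where L = Li_{-k} is a rational function whose
  numerator, an Eulerian polynomial, has only simple nonpositive real roots. On the half-line Re z = 1/2
  one has q = -exp(-2 pi t) with t = cot(phi) / 2, and Lipschitz' formula gives
  L(q) ~ 2 k! (sin(phi) / pi)^N cos(N phi), while F - L is exponentially smaller.

  Upper bound: on a circle |q| = R the modulus of L is smallest at q = -R, because all roots are negative;
  so |F - L| < |L| at the single point -R suffices for Rouche's theorem, and F has as many zeros in the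
  disc as L. The palindromic symmetry of the Eulerian polynomial leaves L at most k/2 - 1 zeros in (-1, 0),
  and the sign changes at N phi = m pi account for those outside the disc.

  Lower bound: F has sign (-1)^m at N phi = m pi if m^2 > k / 6, and at 2 pi t = k / m, where the m-th term
  of its q-series dominates, if m^2 <= k / 6.

  If k = 2 mod 6, rotating the lattice by rho = exp(pi i / 3) shows F = 0 at rho; the upper bound is then
  applied to a slightly larger disc, in which this zero is discounted.
*)

theory Submission
  imports Defs
begin

section \<open>Bernoulli numbers\<close>

text \<open>In the lattice Z z + Z the term m L(q^m) is the row at height m t. With t = cot(phi) / 2
  the points of the row m = 1 nearest to 0 have modulus 1 / (2 sin(phi)), while the row m = 2 has
  height cos(phi) / sin(phi). The k-th power of the quotient 2 cos(phi) is what makes F - L small,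
  so phi has to stay well below pi / 3. The half-line ends at phi = pi / 6. There |cos(N phi)| =
  sqrt 3 / 2 if k = 0 or 4 mod 6, and the comparison works at the endpoint itself. If k = 2 mod 6
  the cosine vanishes there, so the estimates cannot tell whether F does: hence the exact lattice
  symmetry, and the larger disc, given by phi = (a + 1) pi / N with a = k div 6, at most 2 pi / 9
  (for k = 8). High on the half-line the points of a row have nearly equal moduli: the relative
  error of the cosine is of order 1 / (k sin(phi)^2), about k / (pi m)^2 at N phi = m pi, which is
  useless for small m. There the terms n^k |q|^n of the q-series peak with width m / sqrt k around n
  = m. Both methods work near 6 m^2 = k, where the proof switches.\<close>

lemma fps_bernoulli_eq:
  defines "f \<equiv> fps_X / (fps_exp 1 - 1 :: real fps)"
  shows "f * (fps_exp 1 - 1) = fps_X" and "fps_nth f 0 = 1"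
    and "fps_X * fps_deriv f = f - f * f - fps_X * f"
proof -
  let ?u = "fps_exp 1 - 1 :: real fps"
  have u1: "fps_nth ?u 0 = 0" "fps_nth ?u 1 = 1" by simp_all
  have unz: "?u \<noteq> 0" using u1(2) by (metis fps_zero_nth zero_neq_one)
  have sub: "subdegree ?u = 1"
    by (rule subdegreeI) (auto simp: u1)
  have "?u dvd fps_X"
    using unz sub by (subst fps_dvd_iff) auto
  then show 1: "f * ?u = fps_X"
    unfolding f_def by simp
  have "fps_nth (f * ?u) 1 = 1" by (simp add: 1)
  then show "fps_nth f 0 = 1" by (simp add: fps_mult_nth)
  \<comment> \<open>Eliminating the exponential between f (e^X - 1) = X and its derivative leaves a
    Riccati equation. Its quadratic term yields the recurrence from which the signs can be read
    off.\<close>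
  have "fps_deriv (f * ?u) = 1" by (simp add: 1)
  then have d: "fps_deriv f * ?u + f * (?u + 1) = 1" by (simp add: algebra_simps)
  have "fps_X * fps_deriv f = f * (fps_deriv f * ?u)"
    by (simp add: 1[symmetric] algebra_simps)
  also have "fps_deriv f * ?u = 1 - f * (?u + 1)" using d by (simp add: algebra_simps)
  also have "f * (1 - f * (?u + 1)) = f - f * f - (f * ?u) * f" by (simp add: algebra_simps)
  finally show "fps_X * fps_deriv f = f - f * f - fps_X * f" by (simp only: 1)
qed

lemma bernoulli_coeff_recurrence:
  defines "f \<equiv> fps_X / (fps_exp 1 - 1 :: real fps)"
  assumes "n \<ge> 2"
  shows "(real n + 1) * fps_nth f n = - (\<Sum>i=1..<n. fps_nth f i * fps_nth f (n - i)) - fps_nth f (n - 1)"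
proof -
  have "fps_nth (fps_X * fps_deriv f) n = fps_nth (f - f * f - fps_X * f) n"
    unfolding f_def by (simp only: fps_bernoulli_eq(3))
  moreover have "fps_nth (fps_X * fps_deriv f) n = real n * fps_nth f n"
    using assms(2) by (cases n) (auto simp: algebra_simps)
  moreover have "fps_nth (fps_X * f) n = fps_nth f (n - 1)" using assms(2) by auto
  moreover have "fps_nth (f * f) n = 2 * fps_nth f n + (\<Sum>i=1..<n. fps_nth f i * fps_nth f (n - i))"
  proof -
    have "{0..n} = insert 0 (insert n {1..<n})" using assms(2) by auto
    then show ?thesis using assms(2) fps_bernoulli_eq(2)
      by (simp add: fps_mult_nth f_def)
  qed
  ultimately show ?thesis by (simp add: algebra_simps)
qed

lemma bernoulli_coeff_1: "fps_nth (fps_X / (fps_exp 1 - 1 :: real fps)) 1 = - 1 / 2"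
proof -
  let ?f = "fps_X / (fps_exp 1 - 1 :: real fps)"
  have "fps_nth (fps_X * fps_deriv ?f) 1 = fps_nth (?f - ?f * ?f - fps_X * ?f) 1"
    by (simp only: fps_bernoulli_eq(3))
  then show ?thesis using fps_bernoulli_eq(2) by (simp add: fps_mult_nth)
qed

text \<open>For odd n one of i, n - i is odd, so by induction only i = 1 and i = n - 1 survive in
  the convolution. As the coefficient of index 1 is -1/2, these two cancel the last term of the
  recurrence.\<close>

lemma bernoulli_coeff_odd:
  assumes "odd n" "n \<ge> 3"
  shows "fps_nth (fps_X / (fps_exp 1 - 1 :: real fps)) n = 0"
  using assms
proof (induction n rule: less_induct)
  case (less n)
  define f where "f = fps_X / (fps_exp 1 - 1 :: real fps)"
  have z: "fps_nth f i * fps_nth f (n - i) = 0" if "i \<in> {1..<n} - {1, n - 1}" for i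
  proof (cases "odd i")
    case True
    then have "i \<noteq> 2" by auto
    then have "i \<ge> 3" using that by auto
    then have "fps_nth f i = 0" using less.IH[of i] that True unfolding f_def by auto
    then show ?thesis by simp
  next
    case False
    then have "odd (n - i)" using that less.prems by auto
    moreover from this have "n - i \<noteq> 2" by (metis even_numeral)
    then have "n - i \<ge> 3" using that by auto
    ultimately have "fps_nth f (n - i) = 0" using less.IH[of "n - i"] that unfolding f_def by auto
    then show ?thesis by simp
  qed
  have "(\<Sum>i=1..<n. fps_nth f i * fps_nth f (n - i)) = (\<Sum>i\<in>{1, n - 1}. fps_nth f i * fps_nth f (n - i))"
    using less.prems z by (intro sum.mono_neutral_right) auto
  also have "\<dots> = 2 * fps_nth f 1 * fps_nth f (n - 1)" using less.prems by auto
  finally show ?case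
    using bernoulli_coeff_recurrence[of n] less.prems bernoulli_coeff_1 by (simp add: f_def)
qed

text \<open>For m >= 2 only products of two even-indexed coefficients remain in the quadratic
  recurrence. By induction all of them have the sign (-1)^m, and the minus sign in front reverses
  it. For m = 1 the linear term decides.\<close>

lemma bernoulli_coeff_sign:
  assumes "m \<ge> 1"
  shows "(-1) ^ (m + 1) * fps_nth (fps_X / (fps_exp 1 - 1 :: real fps)) (2 * m) > 0"
  using assms
proof (induction m rule: less_induct)
  case (less m)
  define f where "f = fps_X / (fps_exp 1 - 1 :: real fps)"
  note rec = bernoulli_coeff_recurrence[of "2 * m", folded f_def]
  have f1: "fps_nth f 1 = - 1 / 2" unfolding f_def by (rule bernoulli_coeff_1)
  show ?case
  proof (cases "m = 1")
    case True
    have "{1..<2::nat} = {1}" by auto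
    then show ?thesis using rec f1 True by (simp add: f_def[symmetric])
  next
    case False
    with less.prems have m: "m \<ge> 2" by simp
    have odd0: "fps_nth f n = 0" if "odd n" "n \<ge> 3" for n
      unfolding f_def using that by (rule bernoulli_coeff_odd)
    have z: "fps_nth f i * fps_nth f (2 * m - i) = 0" if "i \<in> {1..<2*m}" "odd i" for i
    proof (cases "i = 1")
      case True then show ?thesis using odd0[of "2 * m - 1"] m by auto
    next
      case False
      moreover have "i \<noteq> 2" using that by auto
      ultimately have "i \<ge> 3" using that by auto
      then show ?thesis using odd0[of i] that by auto
    qed
    have "(\<Sum>i=1..<2*m. fps_nth f i * fps_nth f (2*m - i))
        = (\<Sum>i\<in>(\<lambda>j. 2 * j) ` {1..<m}. fps_nth f i * fps_nth f (2*m - i))"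
    proof (rule sum.mono_neutral_right)
      show "\<forall>i\<in>{1..<2*m} - (\<lambda>j. 2 * j) ` {1..<m}. fps_nth f i * fps_nth f (2*m - i) = 0"
      proof
        fix i assume i: "i \<in> {1..<2*m} - (\<lambda>j. 2 * j) ` {1..<m}"
        have "odd i"
        proof
          assume "even i" then obtain j where "i = 2 * j" by blast
          with i show False by auto
        qed
        then show "fps_nth f i * fps_nth f (2*m - i) = 0" using z i by blast
      qed
    qed auto
    also have "\<dots> = (\<Sum>j=1..<m. fps_nth f (2*j) * fps_nth f (2*(m-j)))"
      by (subst sum.reindex) (auto simp: inj_on_def diff_mult_distrib2)
    finally have rec': "(2 * real m + 1) * fps_nth f (2*m) = - (\<Sum>j=1..<m. fps_nth f (2*j) * fps_nth f (2*(m-j)))"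
      using rec m odd0[of "2 * m - 1"] by (simp)
    have pos: "(-1)^m * (fps_nth f (2*j) * fps_nth f (2*(m-j))) > 0" if "j \<in> {1..<m}" for j
    proof -
      have "(-1)^(j+1) * fps_nth f (2*j) > 0" "(-1)^(m-j+1) * fps_nth f (2*(m-j)) > 0"
        using less.IH[of j] less.IH[of "m - j"] that by (auto simp: f_def)
      then have "(-1)^(j+1) * fps_nth f (2*j) * ((-1)^(m-j+1) * fps_nth f (2*(m-j))) > 0" by (rule mult_pos_pos)
      moreover have "(-1::real)^(j+1) * (-1)^(m-j+1) = (-1)^m"
        using that by (simp flip: power_add)
      ultimately show ?thesis by (simp add: mult_ac) (metis (no_types, lifting) mult.assoc mult.left_commute)
    qed
    have "0 < (\<Sum>j=1..<m. (-1)^m * (fps_nth f (2*j) * fps_nth f (2*(m-j))))"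
      using m pos by (intro sum_pos) auto
    also have "\<dots> = (-1)^m * (- ((2 * real m + 1) * fps_nth f (2*m)))"
      using rec' by (simp add: sum_distrib_left)
    also have "\<dots> = (2 * real m + 1) * ((-1)^(m+1) * fps_nth f (2*m))" by simp
    finally show ?thesis by (auto simp: f_def[symmetric] zero_less_mult_iff mult_less_0_iff)
  qed
qed

text \<open>\<open>Eisenstein_E\<close> divides by this number. Were it 0, the convention x / 0 = 0
  would make \<open>Eisenstein_E k\<close> constant and every point a zero of the
  derivative.\<close>

lemma bernoulli_number_nonzero:
  assumes "even k" "k \<ge> 2"
  shows "bernoulli_number k \<noteq> 0"
proof -
  obtain m where "k = 2 * m" "m \<ge> 1" using assms by (auto elim!: evenE)
  then show ?thesis using bernoulli_coeff_sign[of m] unfolding bernoulli_number_def by auto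
qed

section \<open>The series of the derivative\<close>

text \<open>The operator x d/dx multiplies the n-th coefficient by n. Stating this through x * D
  avoids a division at x = 0.\<close>

lemma mult_index_powser:
  fixes c :: "nat \<Rightarrow> 'a::{real_normed_field,banach}"
  assumes sm: "\<And>x. norm x < 1 \<Longrightarrow> summable (\<lambda>n. c n * x ^ n)" and x: "norm x < 1"
  shows "summable (\<lambda>n. of_nat n * c n * x ^ n)"
    and "\<exists>D. ((\<lambda>x. \<Sum>n. c n * x ^ n) has_field_derivative D) (at x) \<and> x * D = (\<Sum>n. of_nat n * c n * x ^ n)"
proof -
  have d: "summable (\<lambda>n. diffs c n * x ^ n)"
    by (rule termdiff_converges[OF x sm])
  have eq: "x * (diffs c n * x ^ n) = of_nat (Suc n) * c (Suc n) * x ^ Suc n" for n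
    by (simp add: diffs_def algebra_simps)
  have s: "summable (\<lambda>n. of_nat (Suc n) * c (Suc n) * x ^ Suc n)"
    using summable_mult[OF d, of x] by (simp only: eq)
  then show 1: "summable (\<lambda>n. of_nat n * c n * x ^ n)"
    by (subst (asm) summable_Suc_iff)
  have "x * (\<Sum>n. diffs c n * x ^ n) = (\<Sum>n. of_nat (Suc n) * c (Suc n) * x ^ Suc n)"
    by (subst suminf_mult[OF d, symmetric]) (simp only: eq)
  also have "\<dots> = (\<Sum>n. of_nat n * c n * x ^ n)"
    by (subst suminf_split_head[OF 1]) simp
  finally show "\<exists>D. ((\<lambda>x. \<Sum>n. c n * x ^ n) has_field_derivative D) (at x) \<and> x * D = (\<Sum>n. of_nat n * c n * x ^ n)"
    using termdiffs_strong'[of 1 c x] sm x by blast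
qed

text \<open>\<open>polylog k\<close> is $\mathrm{Li}_{-k}$, except that $0^0 = 1$ adds the constant term $1$ for
  \<open>k = 0\<close>.\<close>

definition polylog :: "nat \<Rightarrow> 'a::{real_normed_field,banach} \<Rightarrow> 'a" where
  "polylog k x = (\<Sum>n. of_nat (n ^ k) * x ^ n)"

lemma summable_polylog:
  fixes x :: "'a::{real_normed_field,banach}"
  assumes "norm x < 1"
  shows "summable (\<lambda>n. of_nat (n ^ k) * x ^ n)"
  using assms
proof (induction k arbitrary: x)
  case 0
  then show ?case by (simp add: summable_geometric)
next
  case (Suc k)
  show ?case
    using mult_index_powser(1)[of "\<lambda>n. of_nat (n ^ k)" x] Suc by simp
qed

lemma polylog_deriv:
  fixes x :: "'a::{real_normed_field,banach}"
  assumes "norm x < 1"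
  obtains D where "(polylog k has_field_derivative D) (at x)" "x * D = polylog (Suc k) x"
  using mult_index_powser(2)[of "\<lambda>n. of_nat (n ^ k)" x] summable_polylog assms
  by (auto simp: polylog_def[abs_def])

lemma polylog_of_real:
  assumes "\<bar>x\<bar> < 1"
  shows "polylog k (of_real x :: complex) = of_real (polylog k x)"
  unfolding polylog_def using suminf_of_real[OF summable_polylog[of x k], where ?'a = complex] assms
  by simp

lemma polylog_0: "norm x < 1 \<Longrightarrow> polylog 0 (x::complex) = 1 / (1 - x)"
  by (simp add: polylog_def suminf_geometric)

lemma polylog_bound:
  fixes x :: complex
  assumes "norm x < 1"
  shows "norm (polylog k x) \<le> polylog k (norm x)"
proof -
  have s: "summable (\<lambda>n. norm (of_nat (n ^ k) * x ^ n))"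
    using summable_polylog[of "norm x" k] assms by (simp add: norm_mult norm_power)
  show ?thesis unfolding polylog_def
    using summable_norm[OF s] by (simp add: norm_mult norm_power)
qed

text \<open>Up to a constant factor this is the $q$-expansion of the derivative of $E_k$.\<close>

definition twisted_series :: "nat \<Rightarrow> 'a::{real_normed_field,banach} \<Rightarrow> 'a" where
  "twisted_series k x = (\<Sum>n. of_nat (n * sigma (k - 1) n) * x ^ n)"

text \<open>Everything divides 0, and a sum over an infinite set is 0 by convention. So a series may
  start at n = 0 and still agree with the shifted one in \<open>Eisenstein_E\<close>.\<close>

lemma sigma_0 [simp]: "sigma s 0 = 0"
  by (simp add: sigma_def infinite_UNIV_nat)

lemma power_le_sigma: "n > 0 \<Longrightarrow> n ^ s \<le> sigma s n"
  unfolding sigma_def by (rule member_le_sum) auto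

lemma inverse_squares_partial: "(\<Sum>d=1..n. 1 / real d ^ 2) \<le> 2 - 1 / real n"
proof (induction n)
  case (Suc n)
  have "1 / real (Suc n) ^ 2 \<le> 1 / real n - 1 / real (Suc n)" if "n > 0"
  proof -
    have "1 / real (Suc n) ^ 2 \<le> 1 / (real n * real (Suc n))"
      using that by (intro divide_left_mono) (auto simp: power2_eq_square)
    also have "\<dots> = 1 / real n - 1 / real (Suc n)" using that by (simp add: field_simps)
    finally show ?thesis .
  qed
  then show ?case using Suc by (cases "n = 0") auto
qed simp

text \<open>Passing to complementary divisors writes sigma_s(n) / n^s as the sum of d^(-s) over d |
  n, which is at most a partial sum of the inverse squares. The factor 2 causes the 1/2 in
  \<open>twisted_dominant_term\<close>.\<close>

lemma sigma_le:
  assumes "s \<ge> 2" "n > 0"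
  shows "sigma s n \<le> 2 * n ^ s"
proof -
  have fin: "finite {d. d dvd n}" using assms by simp
  have "real (sigma s n) = (\<Sum>d | d dvd n. real (n div d) ^ s)"
    unfolding sigma_def of_nat_sum
    by (rule sum.reindex_bij_witness[of _ "\<lambda>d. n div d" "\<lambda>d. n div d"])
       (use assms in \<open>auto simp: dvd_div_eq_mult\<close>)
  also have "\<dots> \<le> (\<Sum>d | d dvd n. real n ^ s * (1 / real d ^ 2))"
  proof (rule sum_mono)
    fix d assume "d \<in> {d. d dvd n}"
    then have d: "d dvd n" "d \<ge> 1" using assms by (auto intro: Suc_leI dvd_pos_nat)
    then have "real (n div d) ^ s = real n ^ s * (1 / real d ^ s)"
      by (simp add: real_of_nat_div power_divide)
    also have "\<dots> \<le> real n ^ s * (1 / real d ^ 2)"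
      using d assms by (intro mult_left_mono divide_left_mono power_increasing) auto
    finally show "real (n div d) ^ s \<le> real n ^ s * (1 / real d ^ 2)" .
  qed
  also have "\<dots> = real n ^ s * (\<Sum>d | d dvd n. 1 / real d ^ 2)" by (simp add: sum_distrib_left)
  also have "\<dots> \<le> real n ^ s * (\<Sum>d=1..n. 1 / real d ^ 2)"
    using assms by (intro mult_left_mono sum_mono2) (auto dest: dvd_imp_le intro: Suc_leI dvd_pos_nat)
  also have "\<dots> \<le> real n ^ s * 2"
    using inverse_squares_partial[of n] by (intro mult_left_mono) (auto intro: order_trans)
  finally have "real (sigma s n) \<le> real (2 * n ^ s)" by simp
  then show ?thesis by (simp only: of_nat_le_iff)
qed

lemma summable_twisted:
  fixes x :: "'a::{real_normed_field,banach}"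
  assumes "k \<ge> 3" "norm x < 1"
  shows "summable (\<lambda>n. of_nat (n * sigma (k - 1) n) * x ^ n)" "summable (\<lambda>n. of_nat (sigma (k - 1) n) * x ^ n)"
proof -
  have b: "sigma (k - 1) n \<le> 2 * n ^ k" "n * sigma (k - 1) n \<le> 2 * n ^ k" for n
  proof -
    show "n * sigma (k - 1) n \<le> 2 * n ^ k"
    proof (cases "n = 0")
      case False
      then have "n * sigma (k - 1) n \<le> n * (2 * n ^ (k - 1))"
        using assms by (intro mult_left_mono sigma_le) auto
      also have "\<dots> = 2 * n ^ k" using assms by (cases k) auto
      finally show ?thesis .
    qed auto
    then show "sigma (k - 1) n \<le> 2 * n ^ k" by (cases "n = 0") (auto elim: order_trans[rotated])
  qed
  have s: "summable (\<lambda>n. 2 * (of_nat (n ^ k) * norm x ^ n))"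
    using summable_polylog[of "norm x" k] assms by (intro summable_mult) auto
  have c: "norm (of_nat a * x ^ n) \<le> 2 * (of_nat (n ^ k) * norm x ^ n)" if "a \<le> 2 * n ^ k" for a n
  proof -
    have "norm (of_nat a * x ^ n) = real a * norm x ^ n" by (simp add: norm_mult norm_power)
    also have "\<dots> \<le> real (2 * n ^ k) * norm x ^ n" by (intro mult_right_mono) (use that in \<open>auto simp del: of_nat_mult of_nat_power\<close>)
    finally show ?thesis by simp
  qed
  show "summable (\<lambda>n. of_nat (n * sigma (k - 1) n) * x ^ n)"
    by (rule summable_comparison_test'[OF s]) (rule c[OF b(2)])
  show "summable (\<lambda>n. of_nat (sigma (k - 1) n) * x ^ n)"
    by (rule summable_comparison_test'[OF s]) (rule c[OF b(1)])
qed

lemma twisted_of_real: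
  assumes "k \<ge> 3" "\<bar>x\<bar> < 1"
  shows "twisted_series k (of_real x :: complex) = of_real (twisted_series k x)"
  unfolding twisted_series_def using suminf_of_real[OF summable_twisted(1)[of k x], where ?'a = complex] assms
  by simp

lemma norm_exp_less_1: "Im z > 0 \<Longrightarrow> norm (exp (2 * of_real pi * \<i> * z)) < 1"
  by (simp add: norm_exp_eq_Re)

lemma deriv_Eisenstein_E:
  assumes "k \<ge> 3" "Im z > 0"
  shows "deriv (Eisenstein_E k) z =
    - of_real (2 * real k / bernoulli_number k) * (2 * of_real pi * \<i>) * twisted_series k (exp (2 * of_real pi * \<i> * z))"
proof -
  define C :: complex where "C = of_real (2 * real k / bernoulli_number k)"
  let ?e = "\<lambda>z. exp (2 * of_real pi * \<i> * z) :: complex"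
  let ?S = "\<lambda>x::complex. \<Sum>n. of_nat (sigma (k - 1) n) * x ^ n"
  note sm = summable_twisted(2)[OF assms(1)]
  have E: "Eisenstein_E k w = 1 - C * ?S (?e w)" if "Im w > 0" for w
    unfolding Eisenstein_E_def C_def
    by (subst suminf_split_head[OF sm[OF norm_exp_less_1[OF that]]]) simp
  obtain D where D: "(?S has_field_derivative D) (at (?e z))" "?e z * D = twisted_series k (?e z)"
    using mult_index_powser(2)[OF sm norm_exp_less_1[OF assms(2)]] unfolding twisted_series_def by auto
  have e: "(?e has_field_derivative ?e z * (2 * of_real pi * \<i>)) (at z)"
    by (auto intro!: derivative_eq_intros)
  have d: "((\<lambda>w. 1 - C * ?S (?e w)) has_field_derivative (0 - C * (D * (?e z * (2 * of_real pi * \<i>))))) (at z)"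
    by (intro DERIV_diff DERIV_const DERIV_cmult DERIV_chain2[OF D(1) e])
  have "eventually (\<lambda>w. w \<in> {w. Im w > 0}) (nhds z)"
    using assms by (intro eventually_nhds_in_open open_halfspace_Im_gt) auto
  then have ev: "eventually (\<lambda>w. Eisenstein_E k w = 1 - C * ?S (?e w)) (nhds z)"
    by eventually_elim (use E in auto)
  have "(Eisenstein_E k has_field_derivative (0 - C * (D * (?e z * (2 * of_real pi * \<i>))))) (at z)"
    using d by (subst DERIV_cong_ev[OF refl ev refl])
  then have "deriv (Eisenstein_E k) z = 0 - C * (D * (?e z * (2 * of_real pi * \<i>)))" by (rule DERIV_imp_deriv)
  also have "\<dots> = - C * (2 * of_real pi * \<i>) * (?e z * D)" by (simp add: mult_ac)
  finally show ?thesis unfolding D(2) C_def .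
qed

section \<open>Lipschitz' formula\<close>

text \<open>n sigma_{k-1}(n) is the sum of (n/d) d^k over d | n. With n = m d, summing over d first
  collects m times the polylogarithm at x^m; absolute summability over the pairs permits the
  exchange.\<close>

lemma twisted_series_Lambert:
  fixes x :: complex
  assumes k: "k \<ge> 3" and x: "norm x < 1"
  shows "(\<lambda>m. of_nat m * polylog k (x ^ m)) sums twisted_series k x"
proof -
  define f where "f = (\<lambda>(n, d). of_nat ((n div d) * d ^ k) * x ^ n)"
  define D where "D = (\<lambda>n::nat. {d. d dvd n})"
  have fin: "finite (D n)" if "n \<in> {1..}" for n using that by (auto simp: D_def)
  have nz: "(n div d) * d ^ k = n * d ^ (k - 1)" if "d dvd n" for n d :: nat
    using that k by (cases k) (auto simp flip: mult.assoc)
  have sig: "(\<Sum>d\<in>D n. (n div d) * d ^ k) = n * sigma (k - 1) n" for n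
    unfolding sigma_def sum_distrib_left D_def by (intro sum.cong) (auto simp: nz)
  have inner: "(\<Sum>d\<in>D n. f (n, d)) = of_nat (n * sigma (k - 1) n) * x ^ n" for n
    unfolding sig[symmetric] of_nat_sum sum_distrib_right by (simp add: f_def)
  have inner': "(\<Sum>d\<in>D n. norm (f (n, d))) = norm (of_nat (n * sigma (k - 1) n) * x ^ n)" for n
  proof -
    have "norm (of_nat (n * sigma (k - 1) n) * x ^ n) = real (n * sigma (k - 1) n) * norm x ^ n"
      by (simp only: norm_mult norm_of_nat norm_power)
    then show ?thesis
      unfolding sig[symmetric] of_nat_sum sum_distrib_right
      by (simp add: f_def norm_mult norm_power del: of_nat_mult of_nat_power)
  qed
  have sn: "summable (\<lambda>n. norm (of_nat (n * sigma (k - 1) n) * x ^ n))"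
    using summable_twisted(1)[of k "norm x"] x k by (simp add: norm_mult norm_power)
  have tw: "((\<lambda>n. of_nat (n * sigma (k - 1) n) * x ^ n) has_sum twisted_series k x) UNIV"
    unfolding twisted_series_def
    by (rule norm_summable_imp_has_sum[OF sn summable_sums[OF summable_norm_cancel[OF sn]]])
  have tw1: "((\<lambda>n. of_nat (n * sigma (k - 1) n) * x ^ n) has_sum twisted_series k x) {1..}"
    using tw by (rule has_sum_cong_neutral[THEN iffD1, rotated -1]) auto
  have "(\<lambda>n. norm (of_nat (n * sigma (k - 1) n) * x ^ n)) summable_on {1..}"
    by (rule summable_on_subset_banach[OF summable_nonneg_imp_summable_on[OF sn]]) simp_all
  then have h: "(\<lambda>n. norm (infsum (\<lambda>d. norm (f (n, d))) (D n))) summable_on {1..}"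
  proof (rule summable_on_cong[THEN iffD1, rotated])
    fix n :: nat assume n: "n \<in> {1..}"
    show "norm (of_nat (n * sigma (k - 1) n) * x ^ n) = norm (infsum (\<lambda>d. norm (f (n, d))) (D n))"
      by (simp only: infsum_finite[OF fin[OF n]] inner' real_norm_def abs_norm_cancel)
  qed
  have "(\<lambda>p. norm (f p)) summable_on Sigma {1..} D"
    unfolding Infinite_Sum.abs_summable_on_Sigma_iff 
  proof (rule conjI[OF _ h], rule ballI)
    fix n :: nat assume "n \<in> {1..}"
    then show "(\<lambda>d. norm (f (n, d))) summable_on D n" by (rule summable_on_finite[OF fin])
  qed
  then have "f summable_on Sigma {1..} D" by (rule abs_summable_summable)
  then have f: "(f has_sum infsum f (Sigma {1..} D)) (Sigma {1..} D)" by (rule has_sum_infsum)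
  have "((\<lambda>n. of_nat (n * sigma (k - 1) n) * x ^ n) has_sum infsum f (Sigma {1..} D)) {1..}"
  proof (rule has_sum_SigmaD[OF f])
    fix n :: nat assume "n \<in> {1..}"
    then show "((\<lambda>d. f (n, d)) has_sum of_nat (n * sigma (k - 1) n) * x ^ n) (D n)"
      using has_sum_finite[OF fin, of n "\<lambda>d. f (n, d)"] by (simp only: inner)
  qed
  with tw1 have S: "infsum f (Sigma {1..} D) = twisted_series k x" by (metis has_sum_unique)
  define g where "g = (\<lambda>(m, d). of_nat (m * d ^ k) * x ^ (m * d))"
  have "(g has_sum twisted_series k x) ({1..} \<times> {1..}) \<longleftrightarrow> (f has_sum twisted_series k x) (Sigma {1..} D)"
  proof (rule has_sum_reindex_bij_witness[of _ "\<lambda>(n, d). (n div d, d)" "\<lambda>(m, d). (m * d, d)"])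
    fix p :: "nat \<times> nat" assume p: "p \<in> {1..} \<times> {1..}"
    then obtain m d where "p = (m, d)" "m \<ge> 1" "d \<ge> 1" by auto
    then show "(case case p of (m, d) \<Rightarrow> (m * d, d) of (n, d) \<Rightarrow> (n div d, d)) = p"
      and "(case p of (m, d) \<Rightarrow> (m * d, d)) \<in> Sigma {1..} D"
      and "f (case p of (m, d) \<Rightarrow> (m * d, d)) = g p"
      by (simp_all add: D_def f_def g_def)
  next
    fix p :: "nat \<times> nat" assume p: "p \<in> Sigma {1..} D"
    then obtain n d where nd: "p = (n, d)" "n \<ge> 1" "d dvd n" by (auto simp: D_def)
    then have "d \<ge> 1" by (auto intro: Suc_leI dvd_pos_nat)
    have "n div d \<ge> 1" using nd by (auto elim!: dvdE)
    then show "(case case p of (n, d) \<Rightarrow> (n div d, d) of (m, d) \<Rightarrow> (m * d, d)) = p"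
      and "(case p of (n, d) \<Rightarrow> (n div d, d)) \<in> {1..} \<times> {1..}"
      using nd by auto
  qed simp
  then have g: "(g has_sum twisted_series k x) ({1..} \<times> {1..})" using f S by simp
  \<comment> \<open>The pairs with m = 0 or d = 0 contribute nothing, the latter because k > 0; so
    both indices may run over all naturals.\<close>
  have g0: "g p = 0" if "p \<in> UNIV \<times> UNIV - {1..} \<times> {1..}" for p
  proof -
    obtain m d where p: "p = (m, d)" by (cases p)
    then have "m = 0 \<or> d = 0" using that by auto
    then show ?thesis using k by (auto simp: g_def p)
  qed
  have "(g has_sum twisted_series k x) ({1..} \<times> {1..}) \<longleftrightarrow> (g has_sum twisted_series k x) (UNIV \<times> UNIV)"
    using g0 by (intro has_sum_cong_neutral) auto
  with g have "(g has_sum twisted_series k x) (UNIV \<times> UNIV)" by simp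
  then have "((\<lambda>m. of_nat m * polylog k (x ^ m)) has_sum twisted_series k x) UNIV"
  proof (rule has_sum_SigmaD)
    fix m :: nat
    show "((\<lambda>d. g (m, d)) has_sum of_nat m * polylog k (x ^ m)) UNIV"
    proof (cases "m = 0")
      case False
      then have xm: "norm (x ^ m) < 1" using x by (simp add: norm_power power_less_one_iff)
      have sk: "summable (\<lambda>n. norm (of_nat (n ^ k) * (x ^ m) ^ n))"
        using summable_polylog[of "norm (x ^ m)" k] xm by (simp add: norm_mult norm_power)
      have "((\<lambda>n. of_nat (n ^ k) * (x ^ m) ^ n) has_sum polylog k (x ^ m)) UNIV"
        unfolding polylog_def
        by (rule norm_summable_imp_has_sum[OF sk summable_sums[OF summable_norm_cancel[OF sk]]])
      from has_sum_cmult_right[OF this, of "of_nat m"] show ?thesis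
        by (simp add: g_def power_mult mult.assoc)
    qed (simp add: g_def)
  qed
  then show ?thesis by (rule has_sum_imp_sums)
qed

text \<open>The logarithmic derivative of Gamma(z) Gamma(1 - z) = pi / sin(pi z) makes the left side
  pi cot(pi z); the right side is its expansion in q. The constant is + pi i, not - pi i, because
  \<open>polylog 0\<close> contains the term n = 0.\<close>

lemma Digamma_reflection:
  fixes z :: complex
  assumes "Im z > 0"
  shows "Digamma (1 - z) - Digamma z = of_real pi * \<i> - 2 * of_real pi * \<i> * polylog 0 (exp (2 * of_real pi * \<i> * z))"
proof -
  have nonint: "z \<notin> \<int>" "1 - z \<notin> \<int>"
  proof -
    show "z \<notin> \<int>" using assms by (auto elim!: Ints_cases)
    show "1 - z \<notin> \<int>"
    proof
      assume "1 - z \<in> \<int>" then obtain n where n: "1 - z = of_int n" by (rule Ints_cases)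
      have "Im (1 - z) = 0" unfolding n by simp
      then show False using assms by simp
    qed
  qed
  then have npos: "z \<notin> \<int>\<^sub>\<le>\<^sub>0" "1 - z \<notin> \<int>\<^sub>\<le>\<^sub>0" using nonpos_Ints_Int by blast+
  let ?s = "sin (of_real pi * z) :: complex" and ?c = "cos (of_real pi * z) :: complex"
  have refl: "Gamma w * Gamma (1 - w) = of_real pi / sin (of_real pi * w)" for w :: complex
    by (rule Gamma_reflection_complex)
  have s0: "?s \<noteq> 0"
    using refl[of z] Gamma_eq_zero_iff[of z] Gamma_eq_zero_iff[of "1 - z"] npos by auto
  have "((\<lambda>w. Gamma w * Gamma (1 - w)) has_field_derivative
      Gamma z * Digamma z * Gamma (1 - z) + Gamma z * (Gamma (1 - z) * Digamma (1 - z) * (-1))) (at z)"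
    using npos by (auto intro!: derivative_eq_intros DERIV_chain2[OF has_field_derivative_Gamma] simp: algebra_simps)
  moreover have "((\<lambda>w. of_real pi / sin (of_real pi * w)) has_field_derivative
      - (of_real pi * (?c * of_real pi)) / (?s * ?s)) (at z)"
    using s0 by (auto intro!: derivative_eq_intros)
  ultimately have "Gamma z * Digamma z * Gamma (1 - z) + Gamma z * (Gamma (1 - z) * Digamma (1 - z) * (-1))
     = - (of_real pi * (?c * of_real pi)) / (?s * ?s)"
    unfolding refl by (rule DERIV_unique)
  then have "(Gamma z * Gamma (1 - z)) * (Digamma (1 - z) - Digamma z) = of_real pi * (?c * of_real pi) / (?s * ?s)"
    by (simp add: algebra_simps)
  then have 1: "Digamma (1 - z) - Digamma z = of_real pi * ?c / ?s"
  proof -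
    assume "(Gamma z * Gamma (1 - z)) * (Digamma (1 - z) - Digamma z) = of_real pi * (?c * of_real pi) / (?s * ?s)"
    then have "(of_real pi / ?s) * (Digamma (1 - z) - Digamma z) = (of_real pi / ?s) * (of_real pi * ?c / ?s)"
      unfolding refl by simp
    then show ?thesis using s0 by (subst (asm) mult_left_cancel) auto
  qed
  define w where "w = exp (\<i> * (of_real pi * z))"
  have w0: "w \<noteq> 0" by (simp add: w_def)
  have q: "exp (2 * of_real pi * \<i> * z) = w ^ 2"
    by (simp add: w_def exp_double[symmetric] mult_ac)
  have q1: "norm (w ^ 2) < 1" using norm_exp_less_1[OF assms] by (simp add: q)
  then have "w ^ 2 \<noteq> 1" by auto
  have sw: "?s = (w - 1 / w) / (2 * \<i>)" and cw: "?c = (w + 1 / w) / 2"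
    by (simp_all add: w_def sin_exp_eq cos_exp_eq exp_minus field_simps)
  have "of_real pi * ?c / ?s = of_real pi * \<i> * (w ^ 2 + 1) / (w ^ 2 - 1)"
    unfolding sw cw using w0 \<open>w ^ 2 \<noteq> 1\<close> by (simp add: field_simps power2_eq_square)
  also have "\<dots> = of_real pi * \<i> - 2 * of_real pi * \<i> * (1 / (1 - w ^ 2))"
    using \<open>w ^ 2 \<noteq> 1\<close> by (simp add: divide_simps) (simp add: algebra_simps)
  finally show ?thesis using 1 q1 by (simp add: q polylog_0)
qed

text \<open>Each z-derivative produces a factor 2 pi i and raises the exponent of the polylogarithm
  by one; the constant disappears after the first.\<close>

lemma Polygamma_reflection:
  assumes "Im z > 0"
  shows "(-1) ^ k * Polygamma k (1 - z) - Polygamma k z =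
    (if k = 0 then of_real pi * \<i> else 0) - (2 * of_real pi * \<i>) ^ Suc k * polylog k (exp (2 * of_real pi * \<i> * z))"
  using assms
proof (induction k arbitrary: z)
  case 0
  then show ?case using Digamma_reflection[of z] by simp
next
  case (Suc k)
  let ?e = "\<lambda>z. exp (2 * of_real pi * \<i> * z) :: complex"
  have nonint: "z \<notin> \<int>\<^sub>\<le>\<^sub>0" "1 - z \<notin> \<int>\<^sub>\<le>\<^sub>0"
  proof -
    show "z \<notin> \<int>\<^sub>\<le>\<^sub>0" using Suc.prems by (auto elim!: nonpos_Ints_cases)
    show "1 - z \<notin> \<int>\<^sub>\<le>\<^sub>0"
    proof
      assume "1 - z \<in> \<int>\<^sub>\<le>\<^sub>0" then obtain n where n: "1 - z = of_int n" by (auto elim!: nonpos_Ints_cases)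
      have "Im (1 - z) = 0" unfolding n by simp
      then show False using Suc.prems by simp
    qed
  qed
  obtain D where D: "(polylog k has_field_derivative D) (at (?e z))" "?e z * D = polylog (Suc k) (?e z)"
    using polylog_deriv[OF norm_exp_less_1[OF Suc.prems]] by metis
  have e: "(?e has_field_derivative ?e z * (2 * of_real pi * \<i>)) (at z)"
    by (auto intro!: derivative_eq_intros)
  let ?R = "\<lambda>z. (if k = 0 then of_real pi * \<i> else 0) - (2 * of_real pi * \<i>) ^ Suc k * polylog k (?e z)"
  have R: "(?R has_field_derivative
      0 - (2 * of_real pi * \<i>) ^ Suc k * (D * (?e z * (2 * of_real pi * \<i>)))) (at z)"
    by (intro DERIV_diff DERIV_const DERIV_cmult DERIV_chain2[OF D(1) e])
  have L: "((\<lambda>z. (-1) ^ k * Polygamma k (1 - z) - Polygamma k z) has_field_derivative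
      (-1) ^ k * (Polygamma (Suc k) (1 - z) * (-1)) - Polygamma (Suc k) z) (at z)"
    using nonint by (auto intro!: derivative_eq_intros DERIV_chain2[OF has_field_derivative_Polygamma] simp: algebra_simps)
  have "eventually (\<lambda>w. w \<in> {w. Im w > 0}) (nhds z)"
    using Suc.prems by (intro eventually_nhds_in_open open_halfspace_Im_gt) auto
  then have ev: "eventually (\<lambda>z. (-1) ^ k * Polygamma k (1 - z) - Polygamma k z = ?R z) (nhds z)"
    by eventually_elim (use Suc.IH in auto)
  have "((\<lambda>z. (-1) ^ k * Polygamma k (1 - z) - Polygamma k z) has_field_derivative
      0 - (2 * of_real pi * \<i>) ^ Suc k * (D * (?e z * (2 * of_real pi * \<i>)))) (at z)"
    using R by (subst DERIV_cong_ev[OF refl ev refl])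
  from DERIV_unique[OF L this] have "(-1) ^ Suc k * Polygamma (Suc k) (1 - z) - Polygamma (Suc k) z
      = - ((2 * of_real pi * \<i>) ^ Suc k * (2 * of_real pi * \<i>) * (?e z * D))"
    by (simp add: algebra_simps)
  then show ?case unfolding D(2) by simp
qed

text \<open>Lipschitz' formula, with the sum over the integers split into its two halves.\<close>

lemma Lipschitz_formula:
  assumes "Im z > 0" "even k" "k > 0"
  shows "(\<lambda>j. 1 / (of_nat j + 1 - z) ^ Suc k - 1 / (z + of_nat j) ^ Suc k) sums
     ((2 * of_real pi * \<i>) ^ Suc k * polylog k (exp (2 * of_real pi * \<i> * z)) / fact k)"
proof -
  have nz: "z \<noteq> 0" "1 - z \<noteq> 0" using assms(1) by (auto simp: complex_eq_iff)
  have "(\<lambda>j. inverse ((1 - z + of_nat j) ^ Suc k) - inverse ((z + of_nat j) ^ Suc k)) sums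
    ((-1) ^ Suc k * Polygamma k (1 - z) / fact k - (-1) ^ Suc k * Polygamma k z / fact k)"
    by (intro sums_diff Polygamma_LIMSEQ nz assms)
  moreover have "(-1) ^ Suc k * Polygamma k (1 - z) / fact k - (-1) ^ Suc k * Polygamma k z / fact k
     = - ((-1) ^ k * Polygamma k (1 - z) - Polygamma k z) / fact k"
    using assms(2) by (simp add: field_simps)
  moreover have comm: "1 - z + of_nat j = of_nat j + 1 - z" for j by simp
  ultimately show ?thesis unfolding Polygamma_reflection[OF assms(1)]
    using assms(3) by (simp add: inverse_eq_divide comm)
qed

section \<open>Lattice estimates\<close>

text \<open>Bernoulli's inequality for the exponent k / 2 turns the quadratic growth of |u|^2 along
  a lattice row into a factor linear in k v. That gives both convergence of the row and an error of
  order 1 / k.\<close>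

lemma norm_power_Suc_even_ge:
  fixes u :: complex
  assumes "even k" "r > 0" "v \<ge> 0" "cmod u ^ 2 \<ge> r ^ 2 * (1 + v)"
  shows "cmod u ^ Suc k \<ge> r ^ Suc k * (1 + real k / 2 * v)"
proof -
  obtain m where m: "k = 2 * m" using assms(1) by blast
  have "r ^ 2 * 1 \<le> r ^ 2 * (1 + v)" using assms by (intro mult_left_mono) auto
  then have "r ^ 2 \<le> cmod u ^ 2" using assms(4) by linarith
  then have r: "r \<le> cmod u" by (rule power2_le_imp_le) simp
  have "(r ^ 2) ^ m * (1 + real m * v) \<le> (r ^ 2) ^ m * (1 + v) ^ m"
    using Bernoulli_inequality[of v m] assms by (intro mult_left_mono) auto
  also have "\<dots> = (r ^ 2 * (1 + v)) ^ m" by (simp add: power_mult_distrib)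
  also have "\<dots> \<le> (cmod u ^ 2) ^ m" using assms by (intro power_mono) auto
  finally have "r * ((r ^ 2) ^ m * (1 + real m * v)) \<le> cmod u * (cmod u ^ 2) ^ m"
    using r assms by (intro mult_mono) auto
  then show ?thesis by (simp add: m mult_ac flip: power_mult)
qed

text \<open>On Re z = 1/2 the row z + Z is symmetric about the imaginary axis. After a factor i is
  taken out, the two halves of Lipschitz' formula are complex conjugate and combine into real
  parts.\<close>

lemma polylog_negative_sums:
  assumes "t > 0" "even k" "k > 0"
  shows "(\<lambda>j. Re (1 / Complex t (- (real j + 1 / 2)) ^ Suc k)) sums
     ((2 * pi) ^ Suc k * polylog k (- exp (- 2 * pi * t)) / (2 * fact k))"
proof -
  define z where "z = Complex (1 / 2) t"
  define u where "u j = Complex t (- (real j + 1 / 2))" for j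
  define iN where "iN = \<i> ^ Suc k"
  define L where "L = polylog k (- exp (- 2 * pi * t))"
  \<comment> \<open>The exponent N = k + 1 is odd, so i^(2N) = -1. This inverts i^N without a case
    distinction on k mod 4.\<close>
  have iN2: "iN * iN = -1"
  proof -
    obtain m where "k = 2 * m" using assms(2) by blast
    then have "iN = \<i> * (-1) ^ m" by (simp add: iN_def power_mult)
    then have "iN * iN = (\<i> * \<i>) * ((-1) ^ m * (-1) ^ m)" by (simp only: mult_ac)
    then show ?thesis by (simp flip: power_mult_distrib)
  qed
  then have iN0: "iN \<noteq> 0" by auto
  have inv: "1 / iN = - iN" using iN2 iN0 by (simp add: field_simps)
  have q: "exp (2 * of_real pi * \<i> * z) = of_real (- exp (- 2 * pi * t))"
  proof -
    have "2 * of_real pi * \<i> * z = \<i> * of_real pi + of_real (- 2 * pi * t)"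
      by (simp add: z_def complex_eq_iff)
    then have "exp (2 * of_real pi * \<i> * z) = exp (\<i> * of_real pi) * of_real (exp (- 2 * pi * t))"
      by (simp only: exp_add exp_of_real)
    then show ?thesis by simp
  qed
  have Lc: "polylog k (exp (2 * of_real pi * \<i> * z)) = of_real L"
    unfolding q L_def using assms by (intro polylog_of_real) simp
  have "Im z > 0" using assms by (simp add: z_def)
  note Lipschitz_formula[OF this assms(2,3), unfolded Lc]
  moreover have "1 / (of_nat j + 1 - z) ^ Suc k - 1 / (z + of_nat j) ^ Suc k
      = iN * of_real (2 * Re (1 / u j ^ Suc k))" for j
  proof -
    have 1: "z + of_nat j = \<i> * u j" by (simp add: z_def u_def complex_eq_iff)
    have 2: "of_nat j + 1 - z = - (\<i> * cnj (u j))" by (simp add: z_def u_def complex_eq_iff)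
    have 3: "(- (\<i> * cnj (u j))) ^ Suc k = - (iN * cnj (u j) ^ Suc k)"
      using assms(2) by (subst power_minus_odd) (simp_all only: power_mult_distrib iN_def even_Suc not_not)
    have "1 / - (a * c) - 1 / (a * d) = - (1 / a) * (1 / c + 1 / d)" for a c d :: complex
      by (simp add: distrib_left)
    then have "1 / (of_nat j + 1 - z) ^ Suc k - 1 / (z + of_nat j) ^ Suc k
       = - (1 / iN) * (1 / cnj (u j) ^ Suc k + 1 / u j ^ Suc k)"
      unfolding 1 2 3 power_mult_distrib iN_def[symmetric] .
    also have "1 / cnj (u j) ^ Suc k = cnj (1 / u j ^ Suc k)" by simp
    also have "cnj (1 / u j ^ Suc k) + 1 / u j ^ Suc k = of_real (2 * Re (1 / u j ^ Suc k))"
      by (simp only: complex_add_cnj add.commute)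
    finally show ?thesis unfolding inv by simp
  qed
  ultimately have "(\<lambda>j. iN * of_real (2 * Re (1 / u j ^ Suc k))) sums ((2 * of_real pi * \<i>) ^ Suc k * of_real L / fact k)"
    by (simp only:)
  from sums_mult[OF this, of "- iN"]
  have "(\<lambda>j. of_real (2 * Re (1 / u j ^ Suc k))) sums (- iN * ((2 * of_real pi * \<i>) ^ Suc k * of_real L / fact k))"
    by (simp add: mult.assoc[symmetric] iN2)
  also have "- iN * ((2 * of_real pi * \<i>) ^ Suc k * of_real L / fact k) = - (iN * iN) * (of_real (2 * pi) ^ Suc k * of_real L / fact k)"
    by (simp add: iN_def power_mult_distrib)
  also have "\<dots> = of_real ((2 * pi) ^ Suc k * L / fact k)" by (simp add: iN2)
  finally have "(\<lambda>j. 2 * Re (1 / u j ^ Suc k)) sums ((2 * pi) ^ Suc k * L / fact k)"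
    by (simp only: sums_of_real_iff)
  from sums_divide[OF this, of 2] show ?thesis by (simp add: u_def L_def)
qed

text \<open>With t = cot(phi) / 2 one has u_0 = e^(-i phi) / (2 sin(phi)), so the nearest pair of
  lattice points gives the cosine exactly. The remaining terms are bounded by multiples of 1 / (j (j
  + 1)), whose sum telescopes.\<close>

lemma polylog_negative_estimate:
  assumes k: "even k" "k > 0" and phi: "0 < phi" "phi < pi / 2"
  defines "C \<equiv> 2 * fact k * (sin phi / pi) ^ Suc k"
  shows "\<bar>polylog k (- exp (- pi * cot phi)) - C * cos (real (Suc k) * phi)\<bar> \<le> C / (2 * real k * sin phi ^ 2)"
proof -
  define t where "t = cot phi / 2"
  define s where "s = sin phi"
  have s: "s > 0" "cos phi > 0" unfolding s_def using phi by (auto intro: sin_gt_zero cos_gt_zero)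
  have t: "t > 0" using s by (simp add: t_def cot_def s_def)
  define u where "u j = Complex t (- (real j + 1 / 2))" for j
  define a where "a j = Re (1 / u j ^ Suc k)" for j
  define S where "S = (2 * pi) ^ Suc k * polylog k (- exp (- 2 * pi * t)) / (2 * fact k)"
  have a: "a sums S" unfolding a_def u_def S_def by (rule polylog_negative_sums[OF t k])
  have u0: "u 0 = cis (- phi) / of_real (2 * s)"
    using s by (simp add: u_def t_def complex_eq_iff cot_def s_def Re_divide_of_real Im_divide_of_real)
  have "1 / u 0 ^ Suc k = of_real ((2 * s) ^ Suc k) * (1 / cis (- phi) ^ Suc k)"
    by (simp add: u0 power_divide)
  also have "1 / cis (- phi) ^ Suc k = cis (real (Suc k) * phi)"
    by (simp only: Complex.DeMoivre) (simp add: cis_divide[symmetric] flip: cis_inverse, simp add: cis_inverse inverse_eq_divide[symmetric])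
  finally have "1 / u 0 ^ Suc k = of_real ((2 * s) ^ Suc k) * cis (real (Suc k) * phi)" .
  then have a0: "a 0 = (2 * s) ^ Suc k * cos (real (Suc k) * phi)"
    unfolding a_def by (simp del: power_Suc of_real_power)
  have aj: "\<bar>a (Suc j)\<bar> \<le> (2 * s) ^ Suc k / (2 * real k * s ^ 2) * (1 / real (Suc j) - 1 / real (Suc (Suc j)))" for j
  proof -
    \<comment> \<open>The difference of the squared moduli of \<open>u (Suc j)\<close> and
      \<open>u 0\<close> is (j + 3/2)^2 - 1/4 = (j + 1) (j + 2); v is this divided by |u_0|^2 = 1 /
      (4 s^2).\<close>
    define v where "v = 4 * real (Suc j) * real (Suc (Suc j)) * s ^ 2"
    have v: "v > 0" using s by (simp add: v_def)
    have "cmod (u (Suc j)) ^ 2 = t ^ 2 + (real (Suc j) + 1 / 2) ^ 2"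
      by (simp add: u_def cmod_def power2_eq_square algebra_simps)
    also have "t ^ 2 = (1 / (2 * s)) ^ 2 - 1 / 4"
    proof -
      have "cos phi ^ 2 = 1 - s ^ 2" by (simp add: s_def cos_squared_eq)
      then show ?thesis using s by (simp add: t_def cot_def s_def[symmetric] field_simps power2_eq_square)
    qed
    also have "(1 / (2 * s)) ^ 2 - 1 / 4 + (real (Suc j) + 1 / 2) ^ 2 = (1 / (2 * s)) ^ 2 * (1 + v)"
      using s by (simp add: v_def field_simps power2_eq_square)
    finally have "cmod (u (Suc j)) ^ Suc k \<ge> (1 / (2 * s)) ^ Suc k * (1 + real k / 2 * v)"
      using k s v by (intro norm_power_Suc_even_ge) auto
    moreover have "(1 / (2 * s)) ^ Suc k * (1 + real k / 2 * v) \<ge> (1 / (2 * s)) ^ Suc k * (real k / 2 * v)"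
      using s by (intro mult_left_mono) auto
    ultimately have ge: "cmod (u (Suc j)) ^ Suc k \<ge> (1 / (2 * s)) ^ Suc k * (real k / 2 * v)" by linarith
    have "\<bar>a (Suc j)\<bar> \<le> cmod (1 / u (Suc j) ^ Suc k)" unfolding a_def by (rule abs_Re_le_cmod)
    also have "\<dots> = 1 / cmod (u (Suc j)) ^ Suc k" by (simp add: norm_divide norm_power del: power_Suc)
    also have "\<dots> \<le> 1 / ((1 / (2 * s)) ^ Suc k * (real k / 2 * v))"
      using k s v by (intro frac_le ge) (auto intro!: mult_pos_pos zero_less_power simp del: power_Suc)
    also have "\<dots> = (2 * s) ^ Suc k / (2 * real k * s ^ 2) * (1 / (real (Suc j) * real (Suc (Suc j))))"
    proof -
      have kv: "real k / 2 * v = (2 * real k * s ^ 2) * (real (Suc j) * real (Suc (Suc j)))"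
        by (simp add: v_def algebra_simps)
      show ?thesis unfolding kv power_one_over by (simp del: of_nat_Suc power_Suc)
    qed
    also have "1 / (real (Suc j) * real (Suc (Suc j))) = 1 / real (Suc j) - 1 / real (Suc (Suc j))"
      by (simp add: field_simps)
    finally show ?thesis .
  qed
  have "(\<lambda>j. 1 / real (Suc j) - 1 / real (Suc (Suc j))) sums (1 / real (Suc 0) - 0)"
    by (rule telescope_sums') (rule LIMSEQ_Suc[OF lim_1_over_n])
  then have tel0: "(\<lambda>j. 1 / real (Suc j) - 1 / real (Suc (Suc j))) sums 1" by simp
  have tel: "(\<lambda>j. (2 * s) ^ Suc k / (2 * real k * s ^ 2) * (1 / real (Suc j) - 1 / real (Suc (Suc j)))) sums
      ((2 * s) ^ Suc k / (2 * real k * s ^ 2))"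
    using sums_mult[OF tel0, of "(2 * s) ^ Suc k / (2 * real k * s ^ 2)"] by (simp only: mult_1_right)
  have "(\<lambda>j. a (Suc j)) sums (S - a 0)" using a by (subst sums_Suc_iff) simp
  moreover have abss: "summable (\<lambda>j. \<bar>a (Suc j)\<bar>)"
    by (rule summable_comparison_test'[OF sums_summable[OF tel]]) (use aj in simp)
  ultimately have "\<bar>S - a 0\<bar> \<le> (\<Sum>j. \<bar>a (Suc j)\<bar>)"
    using summable_rabs[OF abss] by (simp add: sums_iff)
  also have "\<dots> \<le> (2 * s) ^ Suc k / (2 * real k * s ^ 2)"
    using suminf_le[OF aj abss sums_summable[OF tel]] tel by (simp add: sums_iff)
  finally have main: "\<bar>S - (2 * s) ^ Suc k * cos (real (Suc k) * phi)\<bar> \<le> (2 * s) ^ Suc k / (2 * real k * s ^ 2)"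
    by (simp only: a0)
  define c where "c = 2 * fact k / (2 * pi) ^ Suc k"
  have c: "c > 0" by (simp add: c_def del: power_Suc)
  have C: "C = c * (2 * s) ^ Suc k"
    by (simp add: C_def c_def s_def power_divide power_mult_distrib)
  have P: "polylog k (- exp (- pi * cot phi)) = c * S"
    by (simp add: c_def S_def t_def del: power_Suc)
  have "\<bar>c * S - c * ((2 * s) ^ Suc k * cos (real (Suc k) * phi))\<bar> = c * \<bar>S - (2 * s) ^ Suc k * cos (real (Suc k) * phi)\<bar>"
    using c by (simp only: right_diff_distrib[symmetric] abs_mult abs_of_pos)
  also have "\<dots> \<le> c * ((2 * s) ^ Suc k / (2 * real k * s ^ 2))" using main c by (intro mult_left_mono) auto
  finally show ?thesis unfolding P C s_def by (simp only: times_divide_eq_right mult.assoc)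
qed

text \<open>The argument corresponds to z = i T, so one lattice point has modulus T. The others come
  on two sides with |u|^2 = T^2 + j^2, j >= 1; each side adds at most a relative 2 * (2 T^2 / k),
  the 2 bounding the sum of the inverse squares.\<close>

lemma polylog_positive_bound:
  assumes k: "even k" "k > 0" and T: "T > 0"
  shows "polylog k (exp (- 2 * pi * T)) \<le> fact k / (2 * pi * T) ^ Suc k * (1 + 8 * T ^ 2 / real k)"
proof -
  define z where "z = Complex 0 T"
  define L where "L = polylog k (exp (- 2 * pi * T))"
  define B where "B = (1 / T ^ Suc k) * (2 * T ^ 2 / real k)"
  have B: "B \<ge> 0" using T by (simp add: B_def)
  have q: "exp (2 * of_real pi * \<i> * z) = of_real (exp (- 2 * pi * T))"
  proof -
    have "2 * of_real pi * \<i> * z = of_real (- 2 * pi * T)"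
      by (simp add: z_def complex_eq_iff)
    then show ?thesis by (simp only: exp_of_real)
  qed
  have Lc: "polylog k (exp (2 * of_real pi * \<i> * z)) = of_real L"
    unfolding q L_def using T by (intro polylog_of_real) simp
  define c where "c j = 1 / (of_nat j + 1 - z) ^ Suc k - 1 / (z + of_nat j) ^ Suc k" for j
  have "Im z > 0" using T by (simp add: z_def)
  note Lipschitz_formula[OF this k, unfolded Lc, folded c_def]
  then have lim: "(\<lambda>n. norm (\<Sum>j<n. c j)) \<longlonglongrightarrow> norm ((2 * of_real pi * \<i>) ^ Suc k * of_real L / fact k)"
    unfolding sums_def by (rule tendsto_norm)
  have bd: "norm (1 / u ^ Suc k) \<le> B * (1 / real (Suc j) ^ 2)" if "cmod u ^ 2 = T ^ 2 + real (Suc j) ^ 2" for u j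
  proof -
    define v where "v = real (Suc j) ^ 2 / T ^ 2"
    have v: "v > 0" using T by (simp add: v_def)
    have "cmod u ^ 2 = T ^ 2 * (1 + v)" unfolding that using T by (simp add: v_def field_simps)
    then have "cmod u ^ Suc k \<ge> T ^ Suc k * (1 + real k / 2 * v)"
      using k T v by (intro norm_power_Suc_even_ge) auto
    moreover have "T ^ Suc k * (1 + real k / 2 * v) \<ge> T ^ Suc k * (real k / 2 * v)"
      using T by (intro mult_left_mono) auto
    ultimately have ge: "cmod u ^ Suc k \<ge> T ^ Suc k * (real k / 2 * v)" by linarith
    have "norm (1 / u ^ Suc k) = 1 / cmod u ^ Suc k" by (simp add: norm_divide norm_power del: power_Suc)
    also have "\<dots> \<le> 1 / (T ^ Suc k * (real k / 2 * v))"
      using k T v by (intro frac_le ge) (auto intro!: mult_pos_pos zero_less_power simp del: power_Suc)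
    also have "\<dots> = B * (1 / real (Suc j) ^ 2)" using T by (simp add: B_def v_def field_simps del: power_Suc of_nat_Suc)
    finally show ?thesis .
  qed
  have part: "norm (\<Sum>j<n. c j) \<le> 1 / T ^ Suc k + 4 * B" for n
  proof -
    have sq: "(\<Sum>j<n. 1 / real (Suc j) ^ 2) \<le> 2"
    proof -
      have "(\<Sum>j<n. 1 / real (Suc j) ^ 2) = (\<Sum>d=1..n. 1 / real d ^ 2)"
        by (rule sum.reindex_bij_witness[of _ "\<lambda>d. d - 1" Suc]) auto
      also have "\<dots> \<le> 2 - 1 / real n" by (rule inverse_squares_partial)
      finally show ?thesis by (smt (verit) divide_nonneg_nonneg of_nat_0_le_iff)
    qed
    have sB: "(\<Sum>j<n. B * (1 / real (Suc j) ^ 2)) \<le> 2 * B"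
      unfolding sum_distrib_left[symmetric] using mult_left_mono[OF sq B] by simp
    have "norm (\<Sum>j<n. c j) \<le> (\<Sum>j<n. norm (c j))" by (rule norm_sum)
    also have "\<dots> \<le> (\<Sum>j<n. norm (1 / (of_nat j + 1 - z) ^ Suc k) + norm (1 / (z + of_nat j) ^ Suc k))"
      unfolding c_def by (intro sum_mono norm_triangle_ineq4)
    also have "\<dots> = (\<Sum>j<n. norm (1 / (of_nat j + 1 - z) ^ Suc k)) + (\<Sum>j<n. norm (1 / (z + of_nat j) ^ Suc k))"
      by (rule sum.distrib)
    also have "(\<Sum>j<n. norm (1 / (of_nat j + 1 - z) ^ Suc k)) \<le> (\<Sum>j<n. B * (1 / real (Suc j) ^ 2))"
      by (intro sum_mono bd) (simp add: z_def cmod_def power2_eq_square algebra_simps)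
    also have "(\<Sum>j<n. norm (1 / (z + of_nat j) ^ Suc k)) \<le> (\<Sum>j<Suc n. norm (1 / (z + of_nat j) ^ Suc k))"
      by (rule sum_mono2) auto
    also have "\<dots> = norm (1 / (z + of_nat 0) ^ Suc k) + (\<Sum>j<n. norm (1 / (z + of_nat (Suc j)) ^ Suc k))"
      by (rule sum.lessThan_Suc_shift)
    also have "norm (1 / (z + of_nat 0) ^ Suc k) = 1 / T ^ Suc k"
    proof -
      have "cmod z = T" using T by (simp add: z_def cmod_def)
      then show ?thesis by (simp add: norm_divide norm_power norm_mult)
    qed
    also have "(\<Sum>j<n. norm (1 / (z + of_nat (Suc j)) ^ Suc k)) \<le> (\<Sum>j<n. B * (1 / real (Suc j) ^ 2))"
      by (intro sum_mono bd) (simp add: z_def cmod_def power2_eq_square algebra_simps)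
    finally show ?thesis using sB by linarith
  qed
  have L0: "L \<ge> 0" unfolding L_def polylog_def
    by (intro suminf_nonneg summable_polylog) (use T in auto)
  have "norm ((2 * of_real pi * \<i>) ^ Suc k * of_real L / fact k) \<le> 1 / T ^ Suc k + 4 * B"
    by (rule LIMSEQ_le_const2[OF lim]) (use part in auto)
  also have "norm ((2 * of_real pi * \<i>) ^ Suc k * of_real L / fact k :: complex) = (2 * pi) ^ Suc k * L / fact k"
    using L0 by (simp add: norm_mult norm_divide norm_power)
  also have "1 / T ^ Suc k + 4 * B = (1 / T ^ Suc k) * (1 + 8 * T ^ 2 / real k)"
    by (simp add: B_def algebra_simps del: power_Suc)
  finally have "fact k / (2 * pi) ^ Suc k * ((2 * pi) ^ Suc k * L / fact k)
      \<le> fact k / (2 * pi) ^ Suc k * ((1 / T ^ Suc k) * (1 + 8 * T ^ 2 / real k))"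
    by (rule mult_left_mono) (simp del: power_Suc)
  moreover have "fact k / (2 * pi) ^ Suc k * ((2 * pi) ^ Suc k * L / fact k) = L"
    by (simp del: power_Suc)
  ultimately show ?thesis by (simp add: L_def power_mult_distrib mult_ac)
qed

section \<open>Comparison of the twisted series with its first Lambert term\<close>

lemma power_ratio_sum_le:
  assumes "p \<ge> 6"
  shows "(\<Sum>m<n. (2 / real (m + 2)) ^ p) \<le> 7 / 5"
proof -
  \<comment> \<open>The first summand is 1. For M >= 3 one has (2/M)^p <= (2/3)^4 * 4 / M^2 <= 64/81
    * (1/(M - 1) - 1/M), which telescopes to a total of at most 1 + 32/81 < 7/5.\<close>
  have "(\<Sum>m<Suc n. (2 / real (m + 2)) ^ p) \<le> 1 + 64 / 81 * (1 / 2 - 1 / real (n + 2))" for n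
  proof (induction n)
    case (Suc n)
    define a where "a = 2 / real (n + 3)"
    have a: "0 \<le> a" "a \<le> 2 / 3" by (auto simp: a_def field_simps)
    have "a ^ p \<le> a ^ 6" using a assms by (intro power_decreasing) auto
    also have "\<dots> = a ^ 4 * a ^ 2" by (simp flip: power_add)
    also have "\<dots> \<le> (2 / 3) ^ 4 * a ^ 2" using a by (intro mult_right_mono power_mono) auto
    also have "a ^ 2 = 4 * (1 / (real (n + 3) * real (n + 3)))" by (simp add: a_def power2_eq_square)
    also have "1 / (real (n + 3) * real (n + 3)) \<le> 1 / (real (n + 2) * real (n + 3))"
      by (intro divide_left_mono mult_right_mono) auto
    also have "1 / (real (n + 2) * real (n + 3)) = 1 / real (n + 2) - 1 / real (n + 3)"
      by (simp add: field_simps)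
    finally have "a ^ p \<le> 64 / 81 * (1 / real (n + 2) - 1 / real (n + 3))" by (simp add: power_divide)
    moreover have "(\<Sum>m<Suc (Suc n). (2 / real (m + 2)) ^ p) = (\<Sum>m<Suc n. (2 / real (m + 2)) ^ p) + a ^ p"
      by (simp add: a_def add.commute)
    moreover have "Suc n + 2 = n + 3" by simp
    ultimately show ?case using Suc by (simp only:) (simp only: right_diff_distrib)
  qed simp
  moreover have "1 + 64 / 81 * (1 / 2 - 1 / real (n + 2)) \<le> 7 / 5" for n by (simp add: field_simps)
  ultimately have *: "(\<Sum>m<Suc n. (2 / real (m + 2)) ^ p) \<le> 7 / 5" for n by (meson order_trans)
  show ?thesis using * by (cases n) auto
qed

text \<open>The difference consists of the Lambert terms with m >= 2, each bounded by
  \<open>polylog_positive_bound\<close> at height T = m t. Factoring out 2^(-k) leaves powers of 2/m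
  with exponents k and k - 2 >= 6, hence k >= 8.\<close>

lemma twisted_minus_polylog_bound:
  fixes x :: complex
  assumes k: "even k" "k \<ge> 8" and t: "t > 0" and x: "cmod x = exp (- 2 * pi * t)"
  shows "cmod (twisted_series k x - polylog k x) \<le>
     fact k / (2 * pi * t) ^ Suc k * (1 / 2 ^ k) * (7 / 5) * (1 + 32 * t ^ 2 / real k)"
proof -
  define A where "A = fact k / (2 * pi * t) ^ Suc k"
  have A: "A > 0" using t by (simp add: A_def)
  have x1: "norm x < 1" using x t by simp
  define g where "g m = of_nat m * polylog k (x ^ m)" for m
  have "g sums twisted_series k x" unfolding g_def using k x1 by (intro twisted_series_Lambert) auto
  then have "(\<lambda>m. g (m + 2)) sums (twisted_series k x - (\<Sum>m<2. g m))" by (rule sums_split_initial_segment)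
  moreover have "(\<Sum>m<2. g m) = polylog k x" by (simp add: g_def numeral_2_eq_2)
  ultimately have lim: "(\<lambda>n. norm (\<Sum>m<n. g (m + 2))) \<longlonglongrightarrow> norm (twisted_series k x - polylog k x)"
    unfolding sums_def by (auto intro: tendsto_norm)
  have gm: "norm (g (m + 2)) \<le> A / 2 ^ k * ((2 / real (m + 2)) ^ k + 32 * t ^ 2 / real k * (2 / real (m + 2)) ^ (k - 2))" for m
  proof -
    define M where "M = real (m + 2)"
    have M: "M > 0" by (simp add: M_def)
    have n1: "norm (x ^ (m + 2)) = exp (- 2 * pi * (M * t))"
      unfolding norm_power x M_def exp_of_nat_mult[symmetric] by (simp add: mult_ac)
    have "norm (g (m + 2)) = M * norm (polylog k (x ^ (m + 2)))"
      unfolding g_def norm_mult norm_of_nat M_def ..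
    also have "norm (polylog k (x ^ (m + 2))) \<le> polylog k (exp (- 2 * pi * (M * t)))"
      unfolding n1[symmetric] by (rule polylog_bound) (use n1 t M in simp)
    also have "\<dots> \<le> fact k / (2 * pi * (M * t)) ^ Suc k * (1 + 8 * (M * t) ^ 2 / real k)"
      using k M t by (intro polylog_positive_bound) auto
    also have "M * \<dots> = A * (1 / M ^ k * (1 + 8 * (M * t) ^ 2 / real k))"
      using M by (simp add: A_def power_mult_distrib)
    also have "1 / M ^ k * (1 + 8 * (M * t) ^ 2 / real k) = 1 / 2 ^ k * ((2 / M) ^ k + 32 * t ^ 2 / real k * (2 / M) ^ (k - 2))"
    proof -
      have "(2 / M) ^ k = (2 / M) ^ 2 * (2 / M) ^ (k - 2)"
      proof -
        have k2: "2 + (k - 2) = k" using k by simp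
        show ?thesis using power_add[of "2 / M" 2 "k - 2"] unfolding k2 .
      qed
      then have "32 * t ^ 2 / real k * (2 / M) ^ (k - 2) = 8 * (M * t) ^ 2 / real k * (2 / M) ^ k"
        using M by (simp add: power2_eq_square)
      then show ?thesis using M by (simp add: power_divide algebra_simps)
    qed
    finally show ?thesis using M by (simp add: M_def)
  qed
  have "norm (\<Sum>m<n. g (m + 2)) \<le> A / 2 ^ k * (7 / 5 + 32 * t ^ 2 / real k * (7 / 5))" for n
  proof -
    have "norm (\<Sum>m<n. g (m + 2)) \<le> (\<Sum>m<n. norm (g (m + 2)))" by (rule norm_sum)
    also have "\<dots> \<le> (\<Sum>m<n. A / 2 ^ k * ((2 / real (m + 2)) ^ k + 32 * t ^ 2 / real k * (2 / real (m + 2)) ^ (k - 2)))"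
      by (intro sum_mono gm)
    also have "\<dots> = A / 2 ^ k * ((\<Sum>m<n. (2 / real (m + 2)) ^ k) + 32 * t ^ 2 / real k * (\<Sum>m<n. (2 / real (m + 2)) ^ (k - 2)))"
      by (simp only: sum_distrib_left[symmetric] sum.distrib)
    also have "\<dots> \<le> A / 2 ^ k * (7 / 5 + 32 * t ^ 2 / real k * (7 / 5))"
      using A k by (intro mult_left_mono add_mono power_ratio_sum_le) auto
    finally show ?thesis .
  qed
  then have "norm (twisted_series k x - polylog k x) \<le> A / 2 ^ k * (7 / 5 + 32 * t ^ 2 / real k * (7 / 5))"
    by (intro LIMSEQ_le_const2[OF lim]) auto
  also have "\<dots> = A * (1 / 2 ^ k) * (7 / 5) * (1 + 32 * t ^ 2 / real k)" by (simp add: ring_distribs)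
  finally show ?thesis unfolding A_def .
qed

text \<open>If k sin(phi)^2 >= 1, the error in \<open>polylog_negative_estimate\<close> is at most C
  / 2, and sqrt 3 / 2 > 0.866 leaves 0.866 - 0.5 = 0.366. The threshold sqrt 3 / 2 is the value of
  |cos(N pi / 6)| for k = 0, 4 mod 6.\<close>

lemma polylog_negative_sign:
  assumes k: "even k" "k > 0" and phi: "0 < phi" "phi < pi / 2"
    and s: "real k * sin phi ^ 2 \<ge> 1" and c: "\<bar>cos (real (Suc k) * phi)\<bar> \<ge> sqrt 3 / 2"
  shows "polylog k (- exp (- pi * cot phi)) * cos (real (Suc k) * phi) > 0"
    and "\<bar>polylog k (- exp (- pi * cot phi))\<bar> \<ge> 2 * fact k * (sin phi / pi) ^ Suc k * (366 / 1000)"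
proof -
  define C where "C = 2 * fact k * (sin phi / pi) ^ Suc k"
  define L where "L = polylog k (- exp (- pi * cot phi))"
  define w where "w = cos (real (Suc k) * phi)"
  have sp: "sin phi > 0" using phi by (intro sin_gt_zero) auto
  have C: "C > 0" using sp by (simp add: C_def)
  have sq: "sqrt 3 \<ge> 1732 / 1000" by (rule real_le_rsqrt) (simp add: power2_eq_square)
  have w: "\<bar>w\<bar> \<ge> 866 / 1000" using c sq by (simp add: w_def)
  have "\<bar>L - C * w\<bar> \<le> C / (2 * real k * sin phi ^ 2)"
    unfolding L_def C_def w_def using k phi by (rule polylog_negative_estimate)
  also have "\<dots> \<le> C / 2"
    using C s by (intro divide_left_mono) auto
  finally have "\<bar>L - C * w\<bar> \<le> C / 2" .
  then have e: "L - C * w \<le> C / 2" "C * w - L \<le> C / 2" by linarith+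
  have "L * w > 0 \<and> \<bar>L\<bar> \<ge> C * (366 / 1000)"
  proof (cases "w \<ge> 0")
    case True
    then have "C * w \<ge> C * (866 / 1000)" using w C by (intro mult_left_mono) auto
    then have "L \<ge> C * (366 / 1000)" using e by linarith
    then show ?thesis using C True w by (auto intro!: mult_pos_pos)
  next
    case False
    then have "C * (- w) \<ge> C * (866 / 1000)" using w C by (intro mult_left_mono) auto
    then have "- (C * w) \<ge> C * (866 / 1000)" by (simp only: mult_minus_right)
    then have "- L \<ge> C * (366 / 1000)" using e by linarith
    then show ?thesis using C False w by (auto intro!: mult_neg_neg)
  qed
  then show "L * w > 0" "\<bar>L\<bar> \<ge> C * (366 / 1000)" by auto
qed

lemma cos_ge_quadratic: "1 - x ^ 2 / 2 \<le> cos (x::real)"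
proof -
  have "sin (x / 2) ^ 2 \<le> (x / 2) ^ 2"
    using abs_sin_x_le_abs_x[of "x / 2"] by (simp only: abs_le_square_iff)
  then show ?thesis using cos_double_sin[of "x / 2"] by (simp add: power_divide)
qed

text \<open>The factor 1 + 32 t^2 / k is at most 9, because t = cot(phi) / 2 and k sin(phi)^2 >= 1.
  With cos(phi) >= 3/4 the bound becomes C times 6.3 / (3/4 * (3/2)^8) < 0.33, below the 0.366 of
  \<open>polylog_negative_sign\<close>. The limit 2 pi / 9 is the largest angle ever needed, that of
  k = 8.\<close>

lemma twisted_minus_polylog_less:
  fixes x :: complex
  assumes k: "even k" "k \<ge> 8" and phi: "0 < phi" "phi \<le> 2 * pi / 9"
    and s: "real k * sin phi ^ 2 \<ge> 1" and c: "\<bar>cos (real (Suc k) * phi)\<bar> \<ge> sqrt 3 / 2"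
    and x: "cmod x = exp (- pi * cot phi)"
  shows "cmod (twisted_series k x - polylog k x) < \<bar>polylog k (- exp (- pi * cot phi))\<bar>"
proof -
  define C where "C = 2 * fact k * (sin phi / pi) ^ Suc k"
  define t where "t = cot phi / 2"
  have phi2: "phi < pi / 2" using phi pi_gt_zero by linarith
  have sp: "sin phi > 0" "cos phi > 0" using phi phi2 by (auto intro: sin_gt_zero cos_gt_zero)
  have C: "C > 0" using sp by (simp add: C_def)
  have t: "t > 0" using sp by (simp add: t_def cot_def)
  have c34: "cos phi \<ge> 3 / 4"
  proof -
    have "pi \<le> 315 / 100" using pi_approx by simp
    then have "phi \<le> 7 / 10" using phi by linarith
    then have "phi ^ 2 \<le> (7 / 10) ^ 2" using phi by (intro power_mono) auto
    moreover have "1 - phi ^ 2 / 2 \<le> cos phi" by (rule cos_ge_quadratic)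
    ultimately show ?thesis by (simp add: power_divide)
  qed
  have nine: "1 + 32 * t ^ 2 / real k \<le> 9"
  proof -
    have "32 * t ^ 2 / real k = 8 * cos phi ^ 2 / (real k * sin phi ^ 2)"
      by (simp add: t_def cot_def power_divide)
    also have "\<dots> \<le> 8 * 1 / 1"
      using s sp by (intro frac_le mult_left_mono) (auto simp: abs_square_le_1)
    finally show ?thesis by simp
  qed
  have "cmod (twisted_series k x - polylog k x) \<le>
     fact k / (2 * pi * t) ^ Suc k * (1 / 2 ^ k) * (7 / 5) * (1 + 32 * t ^ 2 / real k)"
    using k t x by (intro twisted_minus_polylog_bound) (auto simp: t_def)
  also have "\<dots> \<le> fact k / (2 * pi * t) ^ Suc k * (1 / 2 ^ k) * (7 / 5) * 9"
    using t by (intro mult_left_mono nine) (auto simp del: power_Suc)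
  also have "fact k / (2 * pi * t) ^ Suc k = C / 2 / cos phi ^ Suc k"
    using sp by (simp add: C_def t_def cot_def power_divide power_mult_distrib)
  also have "C / 2 / cos phi ^ Suc k * (1 / 2 ^ k) * (7 / 5) * 9 = C * (63 / 10) / (cos phi * (2 * cos phi) ^ k)"
    by (simp add: power_mult_distrib mult_ac)
  also have "\<dots> \<le> C * (63 / 10) / (3 / 4 * (3 / 2) ^ 8)"
  proof (intro divide_left_mono mult_mono)
    have "(3 / 2 :: real) ^ 8 \<le> (3 / 2) ^ k" using k by (intro power_increasing) auto
    also have "\<dots> \<le> (2 * cos phi) ^ k" using c34 by (intro power_mono) auto
    finally show "(3 / 2) ^ 8 \<le> (2 * cos phi) ^ k" .
  qed (use C sp c34 in auto)
  also have "\<dots> < C * (366 / 1000)" using C by (simp add: power_divide)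
  also have "\<dots> \<le> \<bar>polylog k (- exp (- pi * cot phi))\<bar>"
    unfolding C_def using k phi phi2 s c by (intro polylog_negative_sign(2)) auto
  finally show ?thesis .
qed

section \<open>Eulerian polynomials\<close>

text \<open>The index is shifted: \<open>eulerian_poly j\<close> belongs to the exponent \<open>j + 1\<close>.\<close>

primrec eulerian_poly :: "nat \<Rightarrow> 'a::real_normed_field poly" where
  "eulerian_poly 0 = 1"
| "eulerian_poly (Suc j) = [:1, of_nat (Suc j):] * eulerian_poly j + [:0, 1, -1:] * pderiv (eulerian_poly j)"

text \<open>The rational continuation of \<open>polylog (Suc j)\<close>. Its values outside the unit
  disc are needed for the symmetry x -> 1/x and for Rolle's theorem towards minus infinity.\<close>

definition eulerian_fun :: "nat \<Rightarrow> 'a::real_normed_field \<Rightarrow> 'a" where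
  "eulerian_fun j x = x * poly (eulerian_poly j) x / (1 - x) ^ (j + 2)"

lemma coeff_eulerian_poly_Suc:
  "coeff (eulerian_poly (Suc j)) 0 = coeff (eulerian_poly j) 0"
  "coeff (eulerian_poly (Suc j)) (Suc i) =
     of_nat (i + 2) * coeff (eulerian_poly j) (Suc i) + (of_nat (Suc j) - of_nat i) * coeff (eulerian_poly j) i"
proof -
  show "coeff (eulerian_poly (Suc j)) 0 = coeff (eulerian_poly j) 0" by simp
  show "coeff (eulerian_poly (Suc j)) (Suc i) =
     of_nat (i + 2) * coeff (eulerian_poly j) (Suc i) + (of_nat (Suc j) - of_nat i) * coeff (eulerian_poly j) i"
    by (cases i) (simp_all add: coeff_pderiv algebra_simps)
qed

declare eulerian_poly.simps(2) [simp del]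

lemma coeff_eulerian_poly_aux:
  "(\<forall>i>j. coeff (eulerian_poly j :: 'a::real_normed_field poly) i = 0) \<and> coeff (eulerian_poly j :: 'a poly) j = 1"
proof (induction j)
  case (Suc j)
  have "coeff (eulerian_poly (Suc j) :: 'a poly) i = 0" if "i > Suc j" for i
    using Suc that by (cases i) (auto simp: coeff_eulerian_poly_Suc)
  then show ?case using Suc by (simp add: coeff_eulerian_poly_Suc)
qed auto

lemma degree_eulerian_poly [simp]: "degree (eulerian_poly j :: 'a::real_normed_field poly) = j"
  using coeff_eulerian_poly_aux[of j, where ?'a = 'a]
  by (intro antisym degree_le le_degree) auto

lemma lead_coeff_eulerian_poly: "coeff (eulerian_poly j) j = 1"
  using coeff_eulerian_poly_aux by blast

lemma coeff_eulerian_poly_of_real: "coeff (eulerian_poly j :: complex poly) i = of_real (coeff (eulerian_poly j) i)"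
proof (induction j arbitrary: i)
  case 0
  then show ?case by (cases i) auto
next
  case (Suc j)
  then show ?case by (cases i) (simp_all add: coeff_eulerian_poly_Suc)
qed

lemma poly_eulerian_poly_0 [simp]: "poly (eulerian_poly j) 0 = 1"
  by (induction j) (auto simp: eulerian_poly.simps(2))

text \<open>The recurrence of \<open>eulerian_poly\<close> is exactly what the quotient rule
  produces under x d/dx. This parallels \<open>polylog_deriv\<close>, so the two families agree once
  their first members do.\<close>

lemma has_field_derivative_eulerian_fun:
  fixes x :: "'a::real_normed_field"
  assumes "x \<noteq> 1"
  obtains D where "(eulerian_fun j has_field_derivative D) (at x)" "x * D = eulerian_fun (Suc j) x"
proof -
  define A where "A = poly (eulerian_poly j) x"
  define A' where "A' = poly (pderiv (eulerian_poly j)) x"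
  define u where "u = 1 - x"
  have u: "u \<noteq> 0" using assms by (simp add: u_def)
  define D where "D = ((A + x * A') * u ^ (j + 2) - (x * A) * (of_nat (j + 2) * u ^ (j + 1) * (-1))) / (u ^ (j + 2) * u ^ (j + 2))"
  have 1: "(eulerian_fun j has_field_derivative D) (at x)"
  proof -
    have "((\<lambda>x. x * poly (eulerian_poly j) x) has_field_derivative A + x * A') (at x)"
      by (auto intro!: derivative_eq_intros simp: A_def A'_def)
    moreover have "((\<lambda>x::'a. 1 - x) has_field_derivative -1) (at x)"
      by (auto intro!: derivative_eq_intros)
    from DERIV_power[OF this, of "j + 2"]
    have "((\<lambda>x. (1 - x) ^ (j + 2)) has_field_derivative of_nat (j + 2) * u ^ (j + 1) * (-1)) (at x)"
      by (simp add: u_def)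
    ultimately show ?thesis
      using DERIV_divide[of _ _ x UNIV "\<lambda>x. (1 - x) ^ (j + 2)"] u
      unfolding eulerian_fun_def[abs_def] D_def u_def[symmetric] A_def[symmetric]
      by (fastforce simp: u_def[symmetric] A_def[symmetric])
  qed
  have eq: "poly (eulerian_poly (Suc j)) x = (A + x * A') * u + of_nat (j + 2) * x * A"
    by (simp add: A_def A'_def u_def eulerian_poly.simps(2) algebra_simps)
  have "x * D = x * (u ^ (j + 1) * ((A + x * A') * u + of_nat (j + 2) * x * A)) / (u ^ (j + 1) * (u ^ (Suc j + 2)))"
    by (simp add: D_def algebra_simps)
  also have "\<dots> = eulerian_fun (Suc j) x"
    using u unfolding eulerian_fun_def eq[symmetric] u_def[symmetric] by simp
  finally show ?thesis using 1 that by blast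
qed

lemma polylog_eq_eulerian_fun:
  fixes x :: "'a::{real_normed_field,banach}"
  assumes "norm x < 1"
  shows "polylog (Suc j) x = eulerian_fun j x"
  using assms
proof (induction j arbitrary: x)
  case 0
  obtain D where D: "(polylog 0 has_field_derivative D) (at x)" "x * D = polylog (Suc 0) x"
    using polylog_deriv[OF 0] by metis
  have x1: "x \<noteq> 1" using 0 by auto
  have "((\<lambda>x. 1 / (1 - x)) has_field_derivative 1 / (1 - x) ^ 2) (at x)"
    using x1 by (auto intro!: derivative_eq_intros simp: power2_eq_square)
  moreover have "eventually (\<lambda>y. y \<in> ball 0 1) (nhds x)"
    using 0 by (intro eventually_nhds_in_open) auto
  then have "eventually (\<lambda>y. polylog 0 y = 1 / (1 - y)) (nhds x)"
    by eventually_elim (simp add: polylog_def suminf_geometric)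
  ultimately have "(polylog 0 has_field_derivative 1 / (1 - x) ^ 2) (at x)"
    by (subst DERIV_cong_ev[OF refl _ refl])
  with D(1) have "D = 1 / (1 - x) ^ 2" by (rule DERIV_unique)
  then show ?case using D(2) by (simp add: eulerian_fun_def numeral_2_eq_2)
next
  case (Suc j)
  obtain D where D: "(polylog (Suc j) has_field_derivative D) (at x)" "x * D = polylog (Suc (Suc j)) x"
    using polylog_deriv[OF Suc.prems] by metis
  have x1: "x \<noteq> 1" using Suc.prems by auto
  obtain E where E: "(eulerian_fun j has_field_derivative E) (at x)" "x * E = eulerian_fun (Suc j) x"
    using has_field_derivative_eulerian_fun[OF x1] by metis
  have "eventually (\<lambda>y. y \<in> ball 0 1) (nhds x)"
    using Suc.prems by (intro eventually_nhds_in_open) auto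
  then have "eventually (\<lambda>y. polylog (Suc j) y = eulerian_fun j y) (nhds x)"
    by eventually_elim (simp add: Suc.IH)
  then have "(polylog (Suc j) has_field_derivative E) (at x)"
    using E(1) by (subst DERIV_cong_ev[OF refl _ refl])
  with D(1) have "D = E" by (rule DERIV_unique)
  then show ?case using D(2) E(2) by simp
qed

text \<open>The base case x / (1 - x)^2 is invariant under x -> 1/x, and x d/dx changes sign under
  this substitution. Negative x stay away from both 0 and 1.\<close>

lemma eulerian_fun_inverse:
  fixes x :: real
  assumes "x < 0"
  shows "eulerian_fun j (1 / x) = (-1) ^ j * eulerian_fun j x"
  using assms
proof (induction j arbitrary: x)
  case 0
  have "1 - 1 / x = (x - 1) / x" using 0 by (simp add: field_simps)
  then show ?case using 0 by (simp add: eulerian_fun_def power2_eq_square field_simps)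
next
  case (Suc j)
  have x1: "x \<noteq> 1" "1 / x \<noteq> 1" using Suc.prems by auto
  obtain D where D: "(eulerian_fun j has_field_derivative D) (at x)" "x * D = eulerian_fun (Suc j) x"
    using has_field_derivative_eulerian_fun[OF x1(1)] by metis
  obtain E where E: "(eulerian_fun j has_field_derivative E) (at (1 / x))" "1 / x * E = eulerian_fun (Suc j) (1 / x)"
    using has_field_derivative_eulerian_fun[OF x1(2)] by metis
  have "((\<lambda>x. 1 / x) has_field_derivative - 1 / (x * x)) (at x)"
    using Suc.prems by (auto intro!: derivative_eq_intros)
  from DERIV_chain2[OF E(1) this]
  have "((\<lambda>x. eulerian_fun j (1 / x)) has_field_derivative E * (- 1 / (x * x))) (at x)" .
  moreover have "eventually (\<lambda>y. y \<in> {..<0}) (nhds x)"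
    using Suc.prems by (intro eventually_nhds_in_open) auto
  then have "eventually (\<lambda>y. eulerian_fun j (1 / y) = (-1) ^ j * eulerian_fun j y) (nhds x)"
    by eventually_elim (simp add: Suc.IH)
  ultimately have "((\<lambda>y. (-1) ^ j * eulerian_fun j y) has_field_derivative E * (- 1 / (x * x))) (at x)"
    by (subst (asm) DERIV_cong_ev[OF refl _ refl])
  moreover have "((\<lambda>y. (-1) ^ j * eulerian_fun j y) has_field_derivative (-1) ^ j * D) (at x)"
    by (rule DERIV_cmult[OF D(1)])
  ultimately have "E * (- 1 / (x * x)) = (-1) ^ j * D" by (rule DERIV_unique)
  then have "x * (E * (- 1 / (x * x))) = (-1) ^ j * (x * D)" by simp
  moreover have "x * (E * (- 1 / (x * x))) = - (1 / x * E)" using Suc.prems by simp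
  ultimately show ?case using D(2) E(2) by simp
qed

section \<open>Real-rootedness by Rolle's theorem on a half-line\<close>

lemma deriv_zero_below_zero:
  fixes f f' :: "real \<Rightarrow> real"
  assumes cont: "continuous_on {..0} f" and der: "\<And>x. x < 0 \<Longrightarrow> (f has_field_derivative f' x) (at x)"
    and lim: "(f \<longlongrightarrow> 0) at_bot" and b: "b \<le> 0" "f b = 0"
  obtains x where "x < b" "f' x = 0"
proof -
  have "\<exists>x<b. f' x = 0"
  proof (cases "f (b - 1) = 0")
    case True
    have "\<exists>z>b - 1. z < b \<and> DERIV f z :> 0"
    proof (rule Rolle)
      show "continuous_on {b - 1..b} f" by (rule continuous_on_subset[OF cont]) (use b in auto)
      show "f differentiable (at x)" if "b - 1 < x" "x < b" for x
        using der[of x] that b unfolding real_differentiable_def by force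
    qed (use True b in auto)
    then obtain z where "z < b" "DERIV f z :> 0" by blast
    then show ?thesis using der[of z] b DERIV_unique by fastforce
  next
    case False
    \<comment> \<open>The limit 0 at minus infinity replaces a second zero: far to the left |f| is
      below |f (b - 1)|, so its maximum on [d, b] is interior and is a local extremum of f.\<close>
    define g where "g x = \<bar>f x\<bar>" for x
    have g: "g (b - 1) > 0" using False by (simp add: g_def)
    have "eventually (\<lambda>x. \<bar>f x\<bar> < g (b - 1)) at_bot"
      using tendstoD[OF lim g] by (simp add: dist_real_def)
    then obtain d0 where d0: "\<And>x. x \<le> d0 \<Longrightarrow> \<bar>f x\<bar> < g (b - 1)"
      by (auto simp: eventually_at_bot_linorder)
    define d where "d = min d0 (b - 2)"
    have d: "d < b - 1" "g d < g (b - 1)" using d0[of d] by (auto simp: d_def g_def)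
    have cg: "continuous_on {d..b} g" unfolding g_def
      by (intro continuous_on_rabs continuous_on_subset[OF cont]) (use b in auto)
    obtain x where x: "x \<in> {d..b}" "\<And>y. y \<in> {d..b} \<Longrightarrow> g y \<le> g x"
      using continuous_attains_sup[OF _ _ cg] d by fastforce
    have gx: "g x \<ge> g (b - 1)" using x(2)[of "b - 1"] d by auto
    then have "x \<noteq> d" "x \<noteq> b" using d g b by (auto simp: g_def)
    then have xd: "d < x" "x < b" using x by auto
    have "f' x = 0"
    proof (cases "f x \<ge> 0")
      case True
      show ?thesis
      proof (rule DERIV_local_max[OF der])
        show "0 < min (x - d) (b - x)" using xd by simp
        show "\<forall>y. \<bar>x - y\<bar> < min (x - d) (b - x) \<longrightarrow> f y \<le> f x"
        proof safe
          fix y assume "\<bar>x - y\<bar> < min (x - d) (b - x)"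
          then have "y \<in> {d..b}" by auto
          then show "f y \<le> f x" using x(2)[of y] True by (auto simp: g_def)
        qed
      qed (use xd b in auto)
    next
      case False
      show ?thesis
      proof (rule DERIV_local_min[OF der])
        show "0 < min (x - d) (b - x)" using xd by simp
        show "\<forall>y. \<bar>x - y\<bar> < min (x - d) (b - x) \<longrightarrow> f x \<le> f y"
        proof safe
          fix y assume "\<bar>x - y\<bar> < min (x - d) (b - x)"
          then have "y \<in> {d..b}" by auto
          then show "f x \<le> f y" using x(2)[of y] False by (auto simp: g_def)
        qed
      qed (use xd b in auto)
    qed
    then show ?thesis using xd by blast
  qed
  then show ?thesis using that by blast
qed

text \<open>No zero is lost, since the interval below the smallest zero also yields one. The clause
  \<open>x < b\<close> keeps the critical points already found below the largest zero of A, hence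
  distinct from the new one above it.\<close>

lemma Rolle_count_below_zero:
  fixes f f' :: "real \<Rightarrow> real"
  assumes cont: "continuous_on {..0} f" and der: "\<And>x. x < 0 \<Longrightarrow> (f has_field_derivative f' x) (at x)"
    and lim: "(f \<longlongrightarrow> 0) at_bot"
    and S: "finite S" "S \<subseteq> {..0}" "\<And>x. x \<in> S \<Longrightarrow> f x = 0"
  shows "\<exists>T. finite T \<and> card T = card S \<and> (\<forall>x\<in>T. f' x = 0 \<and> (\<exists>b\<in>S. x < b))"
  using S
proof (induction S rule: finite_linorder_max_induct)
  case empty
  then show ?case by (intro exI[of _ "{}"]) auto
next
  case (insert b A)
  then obtain T where T: "finite T" "card T = card A" "\<forall>x\<in>T. f' x = 0 \<and> (\<exists>b\<in>A. x < b)" by auto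
  have b: "b \<le> 0" "f b = 0" using insert by auto
  have "\<exists>x<b. f' x = 0 \<and> (\<forall>a\<in>A. a < x)"
  proof (cases "A = {}")
    case True
    then show ?thesis using deriv_zero_below_zero[OF cont der lim b] by (metis empty_iff)
  next
    case False
    define a where "a = Max A"
    have a: "a \<in> A" "\<And>x. x \<in> A \<Longrightarrow> x \<le> a" using False insert by (auto simp: a_def)
    have ab: "a < b" "f a = 0" using a insert by auto
    have "\<exists>z>a. z < b \<and> DERIV f z :> 0"
    proof (rule Rolle)
      show "continuous_on {a..b} f" by (rule continuous_on_subset[OF cont]) (use b in auto)
      show "f differentiable (at x)" if "a < x" "x < b" for x
        using der[of x] that b unfolding real_differentiable_def by force
    qed (use ab b in auto)
    then obtain z where z: "a < z" "z < b" "DERIV f z :> 0" by blast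
    then have "f' z = 0" using der[of z] b DERIV_unique by fastforce
    then show ?thesis using z a by force
  qed
  then obtain x where x: "x < b" "f' x = 0" "\<forall>a\<in>A. a < x" by blast
  have "x \<notin> T" using T x by force
  then show ?case using T x insert
    by (intro exI[of _ "insert x T"]) auto
qed

lemma eulerian_fun_tendsto_0: "((eulerian_fun j :: real \<Rightarrow> real) \<longlongrightarrow> 0) at_bot"
proof -
  define p where "p = [:0, 1:] * (eulerian_poly j :: real poly)"
  define q :: "real poly" where "q = [:1, -1:] ^ (j + 2)"
  have nz: "eulerian_poly j \<noteq> (0 :: real poly)" using lead_coeff_eulerian_poly[of j, where ?'a = real] by auto
  have "degree p = j + 1" unfolding p_def by (subst degree_mult_eq) (use nz in auto)
  moreover have "degree q = j + 2" unfolding q_def by (subst degree_power_eq) auto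
  ultimately have "((\<lambda>x. poly p x / poly q x) \<longlongrightarrow> 0) at_infinity"
    by (intro poly_divide_tendsto_0_at_infinity) auto
  then have "((\<lambda>x. poly p x / poly q x) \<longlongrightarrow> 0) at_bot"
    by (rule filterlim_mono[OF _ order_refl]) (simp add: at_bot_le_at_infinity)
  moreover have "poly p x / poly q x = eulerian_fun j x" for x
  proof -
    have "poly [:1, -1:] x = 1 - x" by simp
    then have "poly q x = (1 - x) ^ (j + 2)" by (simp only: q_def poly_power)
    then show ?thesis by (simp only: eulerian_fun_def p_def) simp
  qed
  ultimately show ?thesis by simp
qed

text \<open>\<open>eulerian_fun j\<close> vanishes at 0 and at j negative points; together with the
  limit at minus infinity Rolle gives j + 1 critical points. They are negative, so the factor x in x
  d/dx adds no spurious root.\<close>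

lemma eulerian_poly_negative_roots:
  "\<exists>S. finite S \<and> card S = j \<and> (\<forall>x\<in>S. x < 0 \<and> poly (eulerian_poly j :: real poly) x = 0)"
proof (induction j)
  case 0
  then show ?case by (intro exI[of _ "{}"]) auto
next
  case (Suc j)
  then obtain S where S: "finite S" "card S = j" "\<forall>x\<in>S. x < 0 \<and> poly (eulerian_poly j :: real poly) x = 0" by blast
  define f' where "f' x = eulerian_fun (Suc j) x / x" for x :: real
  have der: "(eulerian_fun j has_field_derivative f' x) (at x)" if "x < 0" for x
    using has_field_derivative_eulerian_fun[of x j] that unfolding f'_def
    by (metis less_irrefl nonzero_mult_div_cancel_left not_one_less_zero)
  have cont: "continuous_on {..0} (eulerian_fun j :: real \<Rightarrow> real)"
    unfolding eulerian_fun_def[abs_def] by (intro continuous_intros) auto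
  have "\<exists>T. finite T \<and> card T = card (insert 0 S) \<and> (\<forall>x\<in>T. f' x = 0 \<and> (\<exists>b\<in>insert 0 S. x < b))"
    by (rule Rolle_count_below_zero[OF cont der eulerian_fun_tendsto_0])
       (use S in \<open>auto simp: eulerian_fun_def\<close>)
  moreover have "card (insert 0 S) = Suc j" using S by auto
  ultimately obtain T where T: "finite T" "card T = Suc j" "\<forall>x\<in>T. f' x = 0 \<and> (\<exists>b\<in>insert 0 S. x < b)" by auto
  have "x < 0 \<and> poly (eulerian_poly (Suc j) :: real poly) x = 0" if "x \<in> T" for x
  proof -
    have "x < 0" using T(3) S(3) that by fastforce
    then have "eulerian_fun (Suc j) x = 0" using T(3) that by (auto simp: f'_def)
    with \<open>x < 0\<close> show ?thesis by (auto simp: eulerian_fun_def)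
  qed
  then show ?case using T by blast
qed

section \<open>Zeros and the circle minimum of the polylogarithm\<close>

text \<open>j distinct roots exhaust a monic polynomial of degree j. One set of reals serves for the
  real and the complex instance of \<open>eulerian_poly\<close>.\<close>

lemma eulerian_poly_factorization:
  obtains S where "finite S" "card S = j" "S \<subseteq> {..<0::real}"
    "\<And>x. poly (eulerian_poly j) x = (\<Prod>s\<in>S. x - s)"
    "\<And>z. poly (eulerian_poly j) z = (\<Prod>s\<in>S. z - complex_of_real s)"
proof -
  obtain S where S: "finite S" "card S = j" "\<forall>x\<in>S. x < 0 \<and> poly (eulerian_poly j :: real poly) x = 0"
    using eulerian_poly_negative_roots by blast
  have root: "poly (eulerian_poly j) (complex_of_real s) = 0" if "s \<in> S" for s
  proof -
    have "poly (eulerian_poly j) (complex_of_real s) = of_real (poly (eulerian_poly j) s)"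
      by (simp add: poly_altdef coeff_eulerian_poly_of_real)
    then show ?thesis using S(3) that by simp
  qed
  define p where "p = (\<Prod>s\<in>S. [:- s, 1:])"
  define q where "q = (\<Prod>s\<in>S. [:- complex_of_real s, 1:])"
  have deg: "degree p = j" "degree q = j" unfolding p_def q_def
    by (subst degree_prod_eq_sum_degree; use S in simp)+
  have lc: "lead_coeff p = 1" "lead_coeff q = 1" unfolding p_def q_def
    by (simp_all add: lead_coeff_prod)
  have "eulerian_poly j = p"
  proof (rule poly_eqI_degree_lead_coeff[where n = j and A = S])
    show "poly (eulerian_poly j) z = poly p z" if "z \<in> S" for z
      using that S by (auto simp: p_def poly_prod)
  qed (use S deg lc in \<open>auto simp: lead_coeff_eulerian_poly\<close>)
  moreover have "eulerian_poly j = q"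
  proof (rule poly_eqI_degree_lead_coeff[where n = j and A = "complex_of_real ` S"])
    show "poly (eulerian_poly j) z = poly q z" if "z \<in> complex_of_real ` S" for z
      using that S root by (auto simp: q_def poly_prod)
  qed (use S deg lc in \<open>auto simp: lead_coeff_eulerian_poly card_image inj_on_def\<close>)
  ultimately show ?thesis using that[of S] S by (auto simp: p_def q_def poly_prod)
qed

text \<open>All zeros of the Eulerian polynomial being negative, each factor of the polylogarithm is
  extremal at \<open>- R\<close>.\<close>

lemma polylog_circle_min:
  fixes x :: complex
  assumes "k > 0" "0 < R" "R < 1" "cmod x = R"
  shows "\<bar>polylog k (- R)\<bar> \<le> cmod (polylog k x)"
proof -
  obtain j where k: "k = Suc j" using assms by (cases k) auto
  obtain S where S: "finite S" "card S = j" "S \<subseteq> {..<0::real}"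
    "\<And>x. poly (eulerian_poly j) x = (\<Prod>s\<in>S. x - s)"
    "\<And>z. poly (eulerian_poly j) z = (\<Prod>s\<in>S. z - complex_of_real s)"
    using eulerian_poly_factorization[of j] by metis
  have "\<bar>polylog k (- R)\<bar> = \<bar>eulerian_fun j (- R)\<bar>" unfolding k using assms by (subst polylog_eq_eulerian_fun) auto
  also have "\<dots> = R * (\<Prod>s\<in>S. \<bar>- R - s\<bar>) / (1 + R) ^ (j + 2)"
    using assms by (simp add: eulerian_fun_def S abs_mult abs_prod power_abs)
  also have "\<dots> \<le> R * (\<Prod>s\<in>S. cmod (x - of_real s)) / cmod (1 - x) ^ (j + 2)"
  proof (rule frac_le)
    show "R * (\<Prod>s\<in>S. \<bar>- R - s\<bar>) \<le> R * (\<Prod>s\<in>S. cmod (x - of_real s))"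
    proof (intro mult_left_mono prod_mono conjI)
      fix s assume "s \<in> S"
      then have "s < 0" using S by auto
      then have "\<bar>- R - s\<bar> = \<bar>cmod x - cmod (of_real s)\<bar>" using assms by simp
      also have "\<dots> \<le> cmod (x - of_real s)" by (rule norm_triangle_ineq3)
      finally show "\<bar>- R - s\<bar> \<le> cmod (x - of_real s)" .
    qed (use assms in auto)
    have "x \<noteq> 1" using assms by auto
    then show "0 < cmod (1 - x) ^ (j + 2)" by (intro zero_less_power) simp
    show "cmod (1 - x) ^ (j + 2) \<le> (1 + R) ^ (j + 2)"
      using norm_triangle_ineq4[of 1 x] assms by (intro power_mono) auto
    show "0 \<le> R * (\<Prod>s\<in>S. cmod (x - of_real s))" using assms by (auto intro!: mult_nonneg_nonneg prod_nonneg)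
  qed
  also have "\<dots> = cmod (eulerian_fun j x)"
    using assms by (simp add: eulerian_fun_def S norm_mult norm_divide norm_power prod_norm)
  also have "\<dots> = cmod (polylog k x)" unfolding k using assms by (subst polylog_eq_eulerian_fun) auto
  finally show ?thesis .
qed

text \<open>By \<open>eulerian_fun_inverse\<close>, x -> 1/x sends roots in (-1, 0) injectively to
  roots below -1; so at most half of the k - 1 roots lie in (-1, 0). Distinctness of the roots makes
  every zero in the disc simple, the one at 0 included.\<close>

lemma polylog_zeros:
  assumes "k > 0"
  shows "\<exists>S. finite S \<and> S \<subseteq> {-1<..<0::real} \<and> 2 * card S \<le> k - 1 \<and>
    (\<forall>x\<in>{-1<..<0}. polylog k x = 0 \<longleftrightarrow> x \<in> S) \<and>
    (\<forall>z. cmod z < 1 \<longrightarrow> (polylog k z = 0 \<longleftrightarrow> z = 0 \<or> z \<in> of_real ` S)) \<and>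
    (\<forall>z::complex. cmod z < 1 \<longrightarrow> polylog k z = 0 \<longrightarrow> zorder (polylog k) z = 1)"
proof -
  obtain j where k: "k = Suc j" using assms by (cases k) auto
  obtain T where T: "finite T" "card T = j" "T \<subseteq> {..<0::real}"
    "\<And>x. poly (eulerian_poly j) x = (\<Prod>s\<in>T. x - s)"
    "\<And>z. poly (eulerian_poly j) z = (\<Prod>s\<in>T. z - complex_of_real s)"
    using eulerian_poly_factorization[of j] by metis
  define S where "S = T \<inter> {-1<..<0}"
  have 1: "finite S" "S \<subseteq> {-1<..<0}" using T by (auto simp: S_def)
  have 2: "2 * card S \<le> k - 1"
  proof -
    have inv: "(\<lambda>x. 1 / x) ` S \<subseteq> T - S"
    proof
      fix y assume "y \<in> (\<lambda>x. 1 / x) ` S"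
      then obtain x where x: "x \<in> T" "-1 < x" "x < 0" "y = 1 / x" by (auto simp: S_def)
      have "poly (eulerian_poly j) x = 0" using T(1,4) x by auto
      then have "eulerian_fun j x = 0" by (simp add: eulerian_fun_def)
      then have "eulerian_fun j y = 0" using eulerian_fun_inverse[OF x(3), of j] x by simp
      moreover have y: "y < -1" using x by (simp add: divide_less_eq)
      ultimately have "poly (eulerian_poly j) y = 0" by (simp add: eulerian_fun_def)
      then have "y \<in> T" using T by auto
      then show "y \<in> T - S" using y by (auto simp: S_def)
    qed
    have "card S = card ((\<lambda>x. 1 / x) ` S)" using 1 by (intro card_image[symmetric]) (auto simp: inj_on_def)
    also have "\<dots> \<le> card (T - S)" using inv T by (intro card_mono) auto
    also have "\<dots> = j - card S" using T by (subst card_Diff_subset) (auto simp: S_def)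
    finally show ?thesis using k by simp
  qed
  have 3: "polylog k x = 0 \<longleftrightarrow> x \<in> S" if x: "x \<in> {-1<..<0}" for x
  proof -
    have "polylog k x = eulerian_fun j x" unfolding k using x by (intro polylog_eq_eulerian_fun) auto
    then show ?thesis using x T by (auto simp: eulerian_fun_def S_def)
  qed
  have f: "polylog k z = z * (\<Prod>s\<in>T. z - of_real s) / (1 - z) ^ (j + 2)" if "cmod z < 1" for z
    unfolding k polylog_eq_eulerian_fun[OF that] eulerian_fun_def T(5) ..
  have 4: "polylog k z = 0 \<longleftrightarrow> z = 0 \<or> z \<in> of_real ` S" if z: "cmod z < 1" for z
  proof -
    have "z \<noteq> 1" using z by auto
    then have "polylog k z = 0 \<longleftrightarrow> z = 0 \<or> z \<in> of_real ` T" using T by (auto simp: f[OF z])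
    also have "z \<in> of_real ` T \<longleftrightarrow> z \<in> of_real ` S" using z T by (force simp: S_def)
    finally show ?thesis .
  qed
  have 5: "zorder (polylog k) z = 1" if z: "cmod z < 1" "polylog k z = 0" for z
  proof (cases "z = 0")
    case True
    show ?thesis
    proof (rule simple_zeroI)
      show "(\<lambda>z. (\<Prod>s\<in>T. z - of_real s) / (1 - z) ^ (j + 2)) holomorphic_on ball 0 1"
        by (intro holomorphic_intros) auto
      show "polylog k w = (\<Prod>s\<in>T. w - of_real s) / (1 - w) ^ (j + 2) * (w - z)" if "w \<in> ball 0 1" for w
        using that by (simp add: f True)
      show "(\<Prod>s\<in>T. z - of_real s) / (1 - z) ^ (j + 2) \<noteq> 0" using True T by auto
    qed (use z in auto)
  next
    case False
    then obtain s where s: "s \<in> S" "z = of_real s" using 4 z by auto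
    have sT: "s \<in> T" using s by (simp add: S_def)
    show ?thesis
    proof (rule simple_zeroI)
      show "(\<lambda>z. z * (\<Prod>s\<in>T - {s}. z - of_real s) / (1 - z) ^ (j + 2)) holomorphic_on ball 0 1"
        by (intro holomorphic_intros) auto
      show "polylog k w = w * (\<Prod>s\<in>T - {s}. w - of_real s) / (1 - w) ^ (j + 2) * (w - z)" if "w \<in> ball 0 1" for w
        using that prod.remove[OF T(1) sT, of "\<lambda>s. w - of_real s"] by (simp add: f s)
      show "z * (\<Prod>s\<in>T - {s}. z - of_real s) / (1 - z) ^ (j + 2) \<noteq> 0" using False T s z by auto
    qed (use z in auto)
  qed
  show ?thesis by (intro exI[of _ S] conjI ballI allI impI 1 2 3 4 5)
qed

section \<open>Rouche's theorem on centred discs\<close>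

lemma Rouche_disc:
  assumes f: "f holomorphic_on ball 0 1" and h: "h holomorphic_on ball 0 1" and R: "0 < R" "R < 1"
    and less: "\<And>z. cmod z = R \<Longrightarrow> cmod (h z - f z) < cmod (f z)"
  shows "finite {z \<in> ball 0 R. h z = 0}" and "finite {z \<in> ball 0 R. f z = 0}"
    and "(\<Sum>z | z \<in> ball 0 R \<and> h z = 0. zorder h z) = (\<Sum>z | z \<in> ball 0 R \<and> f z = 0. zorder f z)"
proof -
  \<comment> \<open>\<open>Rouche_theorem\<close> needs an open set with finitely many zeros that
    contains the circle, and weighs zeros by winding number. Compactness of the disc of radius r
    gives finiteness; the weight is 1 inside the circle and 0 outside, and no zero lies on
    it.\<close>
  define r where "r = (1 + R) / 2"
  have r: "R < r" "r < 1" using R by (auto simp: r_def)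
  have fin: "finite {z \<in> cball 0 r. g z = 0}"
    if g: "g holomorphic_on ball 0 1" "\<And>z. cmod z = R \<Longrightarrow> g z \<noteq> 0" for g :: "complex \<Rightarrow> complex"
  proof (cases "\<exists>z\<in>ball 0 1. g z = 0")
    case True
    then obtain z0 where z0: "z0 \<in> ball 0 1" "g z0 = 0" by blast
    have "\<not> g constant_on ball 0 1"
    proof
      assume "g constant_on ball 0 1"
      then have "g (of_real R) = g z0" using z0 R unfolding constant_on_def by force
      then show False using g(2)[of "of_real R"] z0 R by simp
    qed
    then show ?thesis using r by (intro holomorphic_compact_finite_zeros[OF g(1)]) auto
  next
    case False
    then have "{z \<in> cball 0 r. g z = 0} = {}" using r by force
    then show ?thesis by (simp only: finite.emptyI)
  qed
  have fnz: "f z \<noteq> 0" if "cmod z = R" for z using less[OF that] by auto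
  have hnz: "h z \<noteq> 0" if "cmod z = R" for z using less[OF that] by auto
  have finf: "finite {z \<in> ball 0 r. f z = 0}" by (rule finite_subset[OF _ fin[OF f fnz]]) force
  have finh: "finite {z \<in> ball 0 r. h z = 0}" by (rule finite_subset[OF _ fin[OF h hnz]]) force
  show "finite {z \<in> ball 0 R. h z = 0}" by (rule finite_subset[OF _ finh]) (use r in auto)
  show "finite {z \<in> ball 0 R. f z = 0}" by (rule finite_subset[OF _ finf]) (use r in auto)
  have f': "f holomorphic_on ball 0 r" by (rule holomorphic_on_subset[OF f]) (use r in auto)
  have h': "h holomorphic_on ball 0 r" by (rule holomorphic_on_subset[OF h]) (use r in auto)
  define W where "W = winding_number (circlepath 0 R)"
  have W1: "W z = 1" if "cmod z < R" for z
    unfolding W_def using that by (intro winding_number_circlepath) auto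
  have W0: "W z = 0" if "cmod z > R" for z
    unfolding W_def using that R
    by (intro winding_number_zero_outside[of _ "cball 0 R"]) (auto simp: convex_cball)
  have "(\<Sum>p | p \<in> ball 0 r \<and> f p + (h p - f p) = 0. W p * of_int (zorder (\<lambda>p. f p + (h p - f p)) p)) =
        (\<Sum>p | p \<in> ball 0 r \<and> f p = 0. W p * of_int (zorder f p))"
    unfolding W_def
  proof (rule Rouche_theorem)
    show "\<forall>z\<in>path_image (circlepath 0 R). cmod (h z - f z) < cmod (f z)" using less R by auto
    show "\<forall>z. z \<notin> ball 0 r \<longrightarrow> winding_number (circlepath 0 R) z = 0"
      using W0 r by (auto simp: W_def)
  qed (use finf finh f' h' r R in \<open>auto intro!: holomorphic_intros\<close>)
  then have eq: "(\<Sum>p | p \<in> ball 0 r \<and> h p = 0. W p * of_int (zorder h p)) =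
        (\<Sum>p | p \<in> ball 0 r \<and> f p = 0. W p * of_int (zorder f p))" by simp
  have red: "(\<Sum>p | p \<in> ball 0 r \<and> g p = 0. W p * of_int (zorder g p)) = of_int (\<Sum>z | z \<in> ball 0 R \<and> g z = 0. zorder g z)"
    if g: "finite {z \<in> ball 0 r. g z = 0}" "\<And>z. cmod z = R \<Longrightarrow> g z \<noteq> 0" for g
  proof -
    have "(\<Sum>p | p \<in> ball 0 r \<and> g p = 0. W p * of_int (zorder g p)) = (\<Sum>p | p \<in> ball 0 R \<and> g p = 0. W p * of_int (zorder g p))"
    proof (rule sum.mono_neutral_right)
      show "\<forall>i\<in>{p \<in> ball 0 r. g p = 0} - {p \<in> ball 0 R. g p = 0}. W i * of_int (zorder g i) = 0"
      proof
        fix i assume i: "i \<in> {p \<in> ball 0 r. g p = 0} - {p \<in> ball 0 R. g p = 0}"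
        then have "cmod i > R" using g(2)[of i] by fastforce
        then show "W i * of_int (zorder g i) = 0" by (simp add: W0)
      qed
    qed (use g r in auto)
    also have "\<dots> = (\<Sum>p | p \<in> ball 0 R \<and> g p = 0. of_int (zorder g p))"
      by (intro sum.cong) (auto simp: W1)
    finally show ?thesis by simp
  qed
  have "complex_of_int (\<Sum>z | z \<in> ball 0 R \<and> h z = 0. zorder h z) = of_int (\<Sum>z | z \<in> ball 0 R \<and> f z = 0. zorder f z)"
    by (simp only: red[OF finh hnz, symmetric] red[OF finf fnz, symmetric] eq)
  then show "(\<Sum>z | z \<in> ball 0 R \<and> h z = 0. zorder h z) = (\<Sum>z | z \<in> ball 0 R \<and> f z = 0. zorder f z)"
    by (simp only: of_int_eq_iff)
qed

section \<open>Signs at the dominant term\<close>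

text \<open>The points are numbered downwards because heights decrease as phi grows. The strict sign
  change excludes the endpoints, so the zeros lie in disjoint open intervals.\<close>

lemma alternating_signs_zeros:
  fixes f :: "real \<Rightarrow> real"
  assumes "continuous_on {p n..p 0} f"
    and "\<And>i. i < n \<Longrightarrow> p (Suc i) < p i" and "\<And>i. i < n \<Longrightarrow> f (p i) * f (p (Suc i)) < 0"
  shows "\<exists>T. finite T \<and> card T = n \<and> T \<subseteq> {p n<..<p 0} \<and> (\<forall>x\<in>T. f x = 0)"
  using assms
proof (induction n)
  case 0
  then show ?case by (intro exI[of _ "{}"]) auto
next
  case (Suc n)
  have lt: "p (Suc n) < p n" using Suc.prems(2)[of n] by simp
  have "p j \<le> p 0" if "j \<le> n" for j
    using that
  proof (induction j)
    case (Suc j)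
    then show ?case using Suc.prems \<open>\<And>i. i < Suc n \<Longrightarrow> p (Suc i) < p i\<close>[of j] by simp
  qed simp
  then have le: "p n \<le> p 0" by simp
  have c: "continuous_on {p n..p 0} f" "continuous_on {p (Suc n)..p n} f"
    using lt le by (auto intro: continuous_on_subset[OF Suc.prems(1)])
  obtain T where T: "finite T" "card T = n" "T \<subseteq> {p n<..<p 0}" "\<forall>x\<in>T. f x = 0"
    using Suc.IH[OF c(1)] Suc.prems(2,3) by auto
  have s: "f (p n) * f (p (Suc n)) < 0" using Suc.prems(3) by simp
  have "\<exists>x\<in>{p (Suc n)..p n}. f x = 0"
  proof (cases "f (p n) > 0")
    case True
    then have "f (p (Suc n)) < 0" using s by (simp add: mult_less_0_iff)
    then show ?thesis using IVT'[of f "p (Suc n)" 0 "p n"] True lt c(2) by force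
  next
    case False
    then have "f (p (Suc n)) > 0" "f (p n) < 0" using s by (auto simp: mult_less_0_iff)
    then show ?thesis using IVT2'[of f "p n" 0 "p (Suc n)"] lt c(2) by force
  qed
  then obtain x where x: "x \<in> {p (Suc n)..p n}" "f x = 0" by blast
  have "x \<noteq> p n" "x \<noteq> p (Suc n)" using s x by auto
  then have x': "p (Suc n) < x" "x < p n" using x by auto
  then have "x \<notin> T" using T by auto
  moreover have "insert x T \<subseteq> {p (Suc n)<..<p 0}" using T x' lt le by force
  ultimately show ?case using T x by (intro exI[of _ "insert x T"]) auto
qed

text \<open>Since m^k <= m sigma_{k-1}(m) <= 2 m^k, the majorant c may be stated for the plain terms
  m^k y^m. Its sum must be below 1/2 to absorb the 2; then the n-th term, of sign (-1)^n, outweighs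
  all the others.\<close>

lemma twisted_dominant_term:
  fixes y :: real
  assumes k: "k \<ge> 3" and y: "0 < y" "y < 1" and n: "n > 0"
    and c: "summable c" "suminf c < 1 / 2"
    and le: "\<And>m. m \<noteq> n \<Longrightarrow> real m ^ k * y ^ m \<le> real n ^ k * y ^ n * c m" and c0: "c n \<ge> 0"
  shows "(-1) ^ n * twisted_series k (- y) > 0"
proof -
  define B where "B = real n ^ k * y ^ n"
  have B: "B > 0" using n y by (simp add: B_def)
  define g where "g m = real (m * sigma (k - 1) m) * (- y) ^ m" for m
  have sg: "summable g" unfolding g_def using k y by (intro summable_twisted) auto
  have tot: "suminf g = twisted_series k (- y)" by (simp only: g_def[abs_def] twisted_series_def)
  have absg: "\<bar>g m\<bar> = real (m * sigma (k - 1) m) * y ^ m" for m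
    using y by (simp add: g_def abs_mult power_abs)
  define r where "r m = (if m = n then 0 else g m)" for m
  have rs: "r sums (suminf g - g n)"
  proof -
    have "(\<lambda>m. if m \<in> {n} then 0 else g m) sums (suminf g - sum g {n} + sum (\<lambda>_. 0) {n})"
      by (rule sums_If_finite_set'[OF summable_sums[OF sg]]) (auto simp: sum_negf)
    then show ?thesis by (simp add: r_def[abs_def])
  qed
  have rb: "\<bar>r m\<bar> \<le> 2 * B * c m" for m
  proof (cases "m = n")
    case True then show ?thesis using B c0 by (simp add: r_def)
  next
    case False
    have "m * sigma (k - 1) m \<le> 2 * m ^ k"
    proof (cases "m = 0")
      case False
      then have "m * sigma (k - 1) m \<le> m * (2 * m ^ (k - 1))" using k by (intro mult_left_mono sigma_le) auto
      also have "\<dots> = 2 * m ^ k" using k by (cases k) auto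
      finally show ?thesis .
    qed simp
    then have "real (m * sigma (k - 1) m) \<le> real (2 * m ^ k)" by (simp only: of_nat_le_iff)
    then have "\<bar>r m\<bar> \<le> real (2 * m ^ k) * y ^ m"
      using False y unfolding r_def by (simp only: if_False absg) (intro mult_right_mono, auto)
    also have "\<dots> = 2 * (real m ^ k * y ^ m)" by simp
    also have "\<dots> \<le> 2 * (B * c m)" using le[OF False] unfolding B_def by simp
    finally show ?thesis by simp
  qed
  have sc: "summable (\<lambda>m. 2 * B * c m)" by (intro summable_mult c)
  have sr: "summable (\<lambda>m. \<bar>r m\<bar>)" by (rule summable_comparison_test'[OF sc]) (use rb in simp)
  have "\<bar>suminf g - g n\<bar> \<le> (\<Sum>m. \<bar>r m\<bar>)" using summable_rabs[OF sr] rs by (simp add: sums_iff)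
  also have "\<dots> \<le> (\<Sum>m. 2 * B * c m)" by (rule suminf_le[OF rb sr sc])
  also have "\<dots> = 2 * B * suminf c" by (rule suminf_mult[OF c(1)])
  also have "\<dots> < B" using c(2) B by simp
  finally have e: "\<bar>suminf g - g n\<bar> < B" .
  have gn: "(-1) ^ n * g n \<ge> B"
  proof -
    have "(-1) ^ n * g n = real (n * sigma (k - 1) n) * y ^ n"
      unfolding g_def power_minus[of y] by (simp add: mult_ac flip: power_mult_distrib)
    moreover have "n ^ k \<le> n * sigma (k - 1) n"
      using power_le_sigma[OF n, of "k - 1"] k by (cases k) auto
    then have "real (n ^ k) \<le> real (n * sigma (k - 1) n)" by (simp only: of_nat_le_iff)
    ultimately show ?thesis unfolding B_def using y by (simp only: of_nat_power) (intro mult_right_mono, auto)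
  qed
  have "\<bar>(-1) ^ n * suminf g - (-1) ^ n * g n\<bar> = \<bar>suminf g - g n\<bar>"
    by (simp add: abs_mult flip: right_diff_distrib)
  then show ?thesis using e gn unfolding tot[symmetric] by linarith
qed

section \<open>Decay of m^k y^m on both sides of its peak\<close>

lemma ln_add_one_upper:
  fixes u :: real
  assumes "u \<ge> 0"
  shows "ln (1 + u) \<le> u - u ^ 2 / (2 * (1 + u))"
proof -
  define g where "g u = u - u ^ 2 / (2 * (1 + u)) - ln (1 + u)" for u :: real
  have "g 0 \<le> g u"
  proof (rule DERIV_nonneg_imp_nondecreasing[OF assms])
    fix x :: real assume x: "0 \<le> x"
    have "(g has_field_derivative 1 - (2 * x * (2 * (1 + x)) - x ^ 2 * 2) / (2 * (1 + x)) ^ 2 - 1 / (1 + x)) (at x)"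
      unfolding g_def[abs_def] using x by (auto intro!: derivative_eq_intros simp: power2_eq_square)
    moreover have "1 - (2 * x * (2 * (1 + x)) - x ^ 2 * 2) / (2 * (1 + x)) ^ 2 - 1 / (1 + x) = x ^ 2 / (2 * (1 + x) ^ 2)"
      using x by (simp add: divide_simps) (simp add: power2_eq_square algebra_simps)
    ultimately show "\<exists>y. (g has_real_derivative y) (at x) \<and> 0 \<le> y"
      by (metis divide_nonneg_nonneg mult_nonneg_nonneg zero_le_numeral zero_le_power2)
  qed
  then show ?thesis by (simp add: g_def)
qed

lemma ln_one_minus_upper:
  fixes u :: real
  assumes "0 \<le> u" "u < 1"
  shows "ln (1 - u) \<le> - u - u ^ 2 / 2"
proof -
  define g where "g u = - u - u ^ 2 / 2 - ln (1 - u)" for u :: real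
  have "g 0 \<le> g u"
  proof (rule DERIV_nonneg_imp_nondecreasing[OF assms(1)])
    fix x :: real assume x: "0 \<le> x" "x \<le> u"
    then have "x < 1" using assms by simp
    then have "(g has_field_derivative x ^ 2 / (1 - x)) (at x)"
      unfolding g_def[abs_def] by (auto intro!: derivative_eq_intros simp: divide_simps power2_eq_square) (simp add: algebra_simps)
    then show "\<exists>y. (g has_real_derivative y) (at x) \<and> 0 \<le> y"
      using \<open>x < 1\<close> by (intro exI[of _ "x ^ 2 / (1 - x)"]) auto
  qed
  then show ?thesis by (simp add: g_def)
qed

text \<open>For y = exp(-k/n) the function m^k y^m is largest at m = n, with logarithmic curvature k
  / n^2 >= 6. The second-order terms of the two logarithm bounds give geometric decay, with ratio
  exp(-3/2) above n and exp(-3) below.\<close>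

lemma twisted_sign_at_peak:
  assumes k: "k \<ge> 3" and n: "n > 0" "6 * n ^ 2 \<le> k"
  shows "(-1) ^ n * twisted_series k (- exp (- real k / real n)) > 0"
proof -
  define y where "y = exp (- real k / real n)"
  define c :: "nat \<Rightarrow> real" where "c m = (if m = n then 0 else if m < n then exp (-3) ^ (n - m) else exp (- 3 / 2) ^ (m - n))" for m
  have k6: "6 * real n ^ 2 \<le> real k" using n(2) by (metis of_nat_le_iff of_nat_mult of_nat_numeral of_nat_power)
  have k6': "real k / real n ^ 2 \<ge> 6" using k6 n by (simp add: field_simps)
  have gen: "6 * A \<le> Y \<Longrightarrow> 3 * A \<le> Y / 2" for A Y :: real by simp
  have ym: "y ^ m = exp (- real k * (real m / real n))" for m
    unfolding y_def exp_of_nat_mult[symmetric] by (simp add: mult_ac)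
  have up: "real (n + i) ^ k * y ^ (n + i) \<le> real n ^ k * y ^ n * exp (- 3 / 2) ^ i" if i: "i > 0" for i
  proof -
    define u where "u = real i / real n"
    have u: "u > 0" using i n by (simp add: u_def)
    \<comment> \<open>With u = i/n <= i and k / n^2 >= 6 the left side is at least 3 i^2 / (1 + i),
      and 2 i >= 1 + i.\<close>
    have e: "real k * (u ^ 2 / (2 * (1 + u))) \<ge> 3 / 2 * real i"
    proof -
      have "u \<le> real i" using n by (simp add: u_def divide_le_eq) (metis Suc_leI mult_le_mono2 nat_mult_1_right of_nat_1 of_nat_le_iff of_nat_mult One_nat_def)
      then have "3 * real i ^ 2 / (1 + real i) \<le> 3 * real i ^ 2 / (1 + u)" using u by (intro divide_left_mono) auto
      also have "\<dots> \<le> (real k / real n ^ 2) * real i ^ 2 / 2 / (1 + u)"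
      proof (rule divide_right_mono)
        show "3 * real i ^ 2 \<le> real k / real n ^ 2 * real i ^ 2 / 2"
          by (rule gen[OF mult_right_mono[OF k6' zero_le_power2[of "real i"]]])
      qed (use u in simp)
      also have "\<dots> = real k * (u ^ 2 / (2 * (1 + u)))" by (simp add: u_def power_divide)
      finally have "3 * real i ^ 2 / (1 + real i) \<le> real k * (u ^ 2 / (2 * (1 + u)))" .
      moreover have "3 / 2 * real i \<le> 3 * real i ^ 2 / (1 + real i)"
      proof -
        have "real i * (1 + real i) \<le> 2 * real i ^ 2" using i by (simp add: power2_eq_square)
        then show ?thesis using i by (simp add: field_simps)
      qed
      ultimately show ?thesis by linarith
    qed
    have "real (n + i) = real n * (1 + u)" using n by (simp add: u_def distrib_left)
    then have nk: "real (n + i) ^ k = real n ^ k * (1 + u) ^ k" by (simp only: power_mult_distrib)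
    have uk: "(1 + u) ^ k = exp (real k * ln (1 + u))" using u by (simp add: exp_of_nat_mult)
    have yk: "y ^ (n + i) = y ^ n * exp (- (real k * u))" unfolding power_add ym[of i] by (simp add: u_def)
    have "exp (real k * (ln (1 + u) - u)) = exp (real k * ln (1 + u)) * exp (- (real k * u))"
      by (simp add: right_diff_distrib flip: exp_add)
    then have "real (n + i) ^ k * y ^ (n + i) = real n ^ k * y ^ n * exp (real k * (ln (1 + u) - u))"
      unfolding nk uk yk by (simp only: mult_ac)
    also have "\<dots> \<le> real n ^ k * y ^ n * exp (- (3 / 2) * real i)"
    proof -
      have "real k * (ln (1 + u) - u) \<le> real k * (- (u ^ 2 / (2 * (1 + u))))"
        using ln_add_one_upper[of u] u by (intro mult_left_mono) auto
      also have "\<dots> = - (real k * (u ^ 2 / (2 * (1 + u))))" by (rule mult_minus_right)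
      also have "\<dots> \<le> - (3 / 2 * real i)" using e by (rule le_imp_neg_le)
      finally have "real k * (ln (1 + u) - u) \<le> - (3 / 2) * real i" by (simp only: mult_minus_left)
      then show ?thesis by (intro mult_left_mono) (auto simp: y_def)
    qed
    also have "exp (- (3 / 2) * real i) = exp (- 3 / 2) ^ i"
      unfolding exp_of_nat_mult[symmetric] by (simp add: mult_ac)
    finally show ?thesis .
  qed
  have down: "real (n - i) ^ k * y ^ (n - i) \<le> real n ^ k * y ^ n * exp (- 3) ^ i" if i: "i > 0" "i \<le> n" for i
  proof (cases "i = n")
    case True
    then show ?thesis using k n by (simp add: y_def power_0_left)
  next
    case False
    define u where "u = real i / real n"
    have u: "u > 0" "u < 1" using i n False by (auto simp: u_def)
    have e: "real k * (u ^ 2 / 2) \<ge> 3 * real i"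
    proof -
      have "3 * real i \<le> 3 * real i ^ 2" using i by (simp add: power2_eq_square)
      also have "\<dots> \<le> (real k / real n ^ 2) * real i ^ 2 / 2"
        by (rule gen[OF mult_right_mono[OF k6' zero_le_power2[of "real i"]]])
      also have "\<dots> = real k * (u ^ 2 / 2)" by (simp add: u_def power_divide)
      finally show ?thesis .
    qed
    have "real (n - i) = real n * (1 - u)" using n i by (simp add: u_def of_nat_diff right_diff_distrib)
    then have nk: "real (n - i) ^ k = real n ^ k * (1 - u) ^ k" by (simp only: power_mult_distrib)
    have uk: "(1 - u) ^ k = exp (real k * ln (1 - u))" using u by (simp add: exp_of_nat_mult)
    have "y ^ (n - i) * y ^ i = y ^ n" using i by (simp flip: power_add)
    then have "y ^ (n - i) * exp (- (real k * u)) = y ^ n" unfolding ym[of i] by (simp add: u_def)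
    then have yk: "y ^ (n - i) = y ^ n * exp (real k * u)" by (simp add: exp_minus field_simps)
    have "exp (real k * (ln (1 - u) + u)) = exp (real k * ln (1 - u)) * exp (real k * u)"
      by (simp add: distrib_left flip: exp_add)
    then have "real (n - i) ^ k * y ^ (n - i) = real n ^ k * y ^ n * exp (real k * (ln (1 - u) + u))"
      unfolding nk uk yk by (simp only: mult_ac)
    also have "\<dots> \<le> real n ^ k * y ^ n * exp (- 3 * real i)"
    proof -
      have "real k * (ln (1 - u) + u) \<le> real k * (- (u ^ 2 / 2))"
        using ln_one_minus_upper[of u] u by (intro mult_left_mono) auto
      then have "real k * (ln (1 - u) + u) \<le> - 3 * real i" using e by simp
      then show ?thesis by (intro mult_left_mono) (auto simp: y_def)
    qed
    also have "exp (- 3 * real i) = exp (- 3) ^ i"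
      unfolding exp_of_nat_mult[symmetric] by (simp add: mult_ac)
    finally show ?thesis .
  qed
  define a where "a = exp (- 3 / 2 :: real)"
  have a: "0 < a" "a \<le> 1 / 4"
  proof -
    have "exp (3 / 2) = exp (3 / 4) * exp (3 / 4 :: real)" by (simp flip: exp_add)
    moreover have "1 + 3 / 4 + (3 / 4) ^ 2 / 2 \<le> exp (3 / 4 :: real)" by (rule exp_lower_Taylor_quadratic) simp
    then have "2 \<le> exp (3 / 4 :: real)" by (simp add: power2_eq_square)
    then have "2 * 2 \<le> exp (3 / 4) * exp (3 / 4 :: real)" by (intro mult_mono) auto
    ultimately have "exp (3 / 2) \<ge> (4 :: real)" by simp
    then have "inverse (exp (3 / 2)) \<le> (1 / 4 :: real)" by (simp add: field_simps)
    then show "a \<le> 1 / 4" by (simp add: a_def exp_minus)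
  qed (simp add: a_def)
  define b where "b = exp (- 3 :: real)"
  have b: "0 < b" "b \<le> 1 / 16"
  proof -
    have "b = a * a" unfolding a_def b_def by (simp flip: exp_add)
    also have "\<dots> \<le> 1 / 4 * (1 / 4)" using a by (intro mult_mono) auto
    finally show "b \<le> 1 / 16" by simp
  qed (simp add: b_def)
  have geo: "(\<lambda>i. a ^ Suc i) sums (a * (1 / (1 - a)))"
    using sums_mult[OF geometric_sums[of a], of a] a by simp
  have "(\<lambda>i. c (i + Suc n)) = (\<lambda>i. a ^ Suc i)" by (auto simp: c_def a_def fun_eq_iff)
  then have "(\<lambda>i. c (i + Suc n)) sums (a * (1 / (1 - a)))" using geo by simp
  then have cs: "c sums (a * (1 / (1 - a)) + (\<Sum>i<Suc n. c i))" by (subst (asm) sums_iff_shift)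
  have fin: "(\<Sum>i<Suc n. c i) \<le> b / (1 - b)"
  proof -
    have "(\<Sum>i<Suc n. c i) = (\<Sum>i<n. b ^ (n - i))" by (simp add: c_def b_def)
    also have "\<dots> = (\<Sum>i<n. b ^ Suc i)"
      by (rule sum.reindex_bij_witness[of _ "\<lambda>i. n - Suc i" "\<lambda>i. n - Suc i"]) (auto simp: Suc_diff_Suc)
    also have "\<dots> = b * (\<Sum>i<n. b ^ i)" by (simp add: sum_distrib_left)
    also have "\<dots> \<le> b * (1 / (1 - b))"
      using b by (intro mult_left_mono) (auto simp: sum_gp_strict divide_right_mono)
    finally show ?thesis by simp
  qed
  have "a / (1 - a) \<le> (1 / 4) / (1 - 1 / 4)" using a by (intro frac_le) auto
  moreover have "b / (1 - b) \<le> (1 / 16) / (1 - 1 / 16)" using b by (intro frac_le) auto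
  \<comment> \<open>The ratios are at most 1/4 and 1/16, so the two geometric series contribute at
    most 1/3 + 1/15 = 2/5.\<close>
  ultimately have half: "suminf c < 1 / 2" using cs fin by (simp add: sums_iff)
  have "(-1) ^ n * twisted_series k (- y) > 0"
  proof (rule twisted_dominant_term[OF k _ _ n(1) sums_summable[OF cs] half])
    fix m assume m: "m \<noteq> n"
    show "real m ^ k * y ^ m \<le> real n ^ k * y ^ n * c m"
      using up[of "m - n"] down[of "n - m"] m by (cases "m < n") (auto simp: c_def)
  qed (use n k in \<open>auto simp: y_def c_def\<close>)
  then show ?thesis by (simp add: y_def)
qed

section \<open>The lattice sum at the elliptic point\<close>

lemma summable_on_int_inverse_square: "(\<lambda>c::int. 1 / (1 + real_of_int c ^ 2)) summable_on UNIV"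
proof -
  let ?f = "\<lambda>c::int. 1 / (1 + real_of_int c ^ 2)"
  have s: "summable (\<lambda>n. 1 / (1 + real n ^ 2))"
  proof (rule summable_comparison_test'[where N = 1 and g = "\<lambda>n. 1 / real n ^ 2"])
    show "summable (\<lambda>n. 1 / real n ^ 2)"
      using inverse_power_summable[of 2, where ?'a = real] by (simp add: inverse_eq_divide)
    show "norm (1 / (1 + real n ^ 2)) \<le> 1 / real n ^ 2" if "n \<ge> 1" for n
      using that by (auto intro!: divide_left_mono mult_pos_pos add_pos_pos)
  qed
  then have n: "(\<lambda>n. 1 / (1 + real n ^ 2)) summable_on UNIV"
    by (rule summable_nonneg_imp_summable_on) simp
  have p: "?f summable_on range int"
    by (subst summable_on_reindex) (use n in \<open>auto simp: o_def\<close>)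
  have m: "?f summable_on range (\<lambda>n. - int n)"
    by (subst summable_on_reindex) (use n in \<open>auto simp: o_def inj_on_def\<close>)
  have "?f summable_on (range int \<union> (range (\<lambda>n. - int n) - range int))"
    by (intro summable_on_Un_disjoint p summable_on_subset_banach[OF m]) auto
  moreover have "range int \<union> (range (\<lambda>n. - int n) - range int) = UNIV"
  proof -
    have "c \<in> range int \<or> c \<in> range (\<lambda>n. - int n)" for c :: int
      by (cases c rule: int_cases2) auto
    then show ?thesis by auto
  qed
  ultimately show ?thesis by simp
qed

lemma summable_on_product_real:
  fixes f g :: "int \<Rightarrow> real"
  assumes "f summable_on UNIV" "g summable_on UNIV" "\<And>x. f x \<ge> 0" "\<And>x. g x \<ge> 0"
  shows "(\<lambda>(x, y). f x * g y) summable_on UNIV"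
proof -
  have "(\<lambda>p. norm ((\<lambda>(x, y). f x * g y) p)) summable_on Sigma UNIV (\<lambda>_. UNIV)"
    unfolding Infinite_Sum.abs_summable_on_Sigma_iff
  proof (intro conjI ballI)
    show "(\<lambda>y. norm ((\<lambda>(x, y). f x * g y) (x, y))) summable_on UNIV" for x
      using assms by (simp add: summable_on_cmult_right)
    show "(\<lambda>x. norm (\<Sum>\<^sub>\<infinity>y\<in>UNIV. norm ((\<lambda>(x, y). f x * g y) (x, y)))) summable_on UNIV"
    proof -
      have "norm (\<Sum>\<^sub>\<infinity>y\<in>UNIV. norm ((\<lambda>(x, y). f x * g y) (x, y))) = f x * infsum g UNIV" for x
        using assms by (simp add: infsum_cmult_right infsum_nonneg)
      then show ?thesis using assms by (simp add: summable_on_cmult_left)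
    qed
  qed
  then show ?thesis using assms by (simp add: case_prod_unfold)
qed

definition rho :: complex where "rho = Complex (1 / 2) (sqrt 3 / 2)"

lemma rho_square: "rho ^ 2 = rho - 1"
  by (simp add: rho_def complex_eq_iff power2_eq_square)

lemma rho_cube: "rho ^ 3 = -1"
proof -
  have "rho ^ 3 = rho * rho ^ 2" by (simp add: power2_eq_square power3_eq_cube)
  also have "\<dots> = rho * (rho - 1)" by (simp only: rho_square)
  also have "\<dots> = rho ^ 2 - rho" by (simp add: power2_eq_square algebra_simps)
  finally show ?thesis unfolding rho_square by simp
qed

abbreviation lattice_point :: "int \<times> int \<Rightarrow> complex" where
  "lattice_point p \<equiv> of_int (fst p) * rho + of_int (snd p)"

lemma norm_lattice_point: "cmod (lattice_point p) ^ 2 = real_of_int (fst p ^ 2 + fst p * snd p + snd p ^ 2)"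
  by (simp add: rho_def cmod_power2) (simp add: power2_eq_square algebra_simps)

text \<open>With M the squared modulus of the lattice point, |a p| <= 2 M and both 1 + c^2 and 1 +
  d^2 are at most 3 M. So the term is at most 2 / M^2 = 18 / (3 M)^2, a product majorant. The
  numerator is general in order to cover both coordinates.\<close>

lemma lattice_term_summable:
  fixes a :: "int \<times> int \<Rightarrow> int"
  assumes N: "N \<ge> 6" and a: "\<And>p. \<bar>a p\<bar> \<le> \<bar>fst p\<bar> + \<bar>snd p\<bar>"
  shows "(\<lambda>p. of_int (a p) / lattice_point p ^ N) summable_on UNIV"
proof (rule abs_summable_summable, rule Infinite_Sum.abs_summable_on_comparison_test')
  let ?f = "\<lambda>c::int. 1 / (1 + real_of_int c ^ 2)"
  have "(\<lambda>(x, y). ?f x * ?f y) summable_on UNIV"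
    by (intro summable_on_product_real summable_on_int_inverse_square) auto
  then show "(\<lambda>p. 18 * (\<lambda>(x, y). ?f x * ?f y) p) summable_on UNIV" by (rule summable_on_cmult_right)
next
  fix p :: "int \<times> int"
  obtain c d where p: "p = (c, d)" by (cases p)
  show "norm (of_int (a p) / lattice_point p ^ N) \<le> 18 * (\<lambda>(x, y). 1 / (1 + real_of_int x ^ 2) * (1 / (1 + real_of_int y ^ 2))) p"
  proof (cases "c = 0 \<and> d = 0")
    case True
    then have "a p = 0" using a[of p] p by simp
    then show ?thesis by (simp add: p)
  next
    case False
    define M where "M = c ^ 2 + c * d + d ^ 2"
    have M2: "2 * M = c ^ 2 + d ^ 2 + (c + d) ^ 2" by (simp add: M_def power2_eq_square algebra_simps)
    have cd: "c ^ 2 + d ^ 2 \<le> 2 * M" using M2 by simp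
    have "c ^ 2 + d ^ 2 > 0" using False by (simp add: sum_power2_gt_zero_iff)
    then have M: "M \<ge> 1" using cd by linarith
    have abs_le: "\<bar>x\<bar> \<le> x ^ 2" for x :: int
    proof (cases "x = 0")
      case False
      then have "\<bar>x\<bar> * 1 \<le> \<bar>x\<bar> * \<bar>x\<bar>" by (intro mult_left_mono) auto
      then show ?thesis by (simp add: power2_eq_square)
    qed simp
    have aM: "\<bar>a p\<bar> \<le> 2 * M" using a[of p] abs_le[of c] abs_le[of d] cd p by simp
    have cM: "1 + c ^ 2 \<le> 3 * M" "1 + d ^ 2 \<le> 3 * M" using cd M zero_le_power2[of c] zero_le_power2[of d] by linarith+
    define r where "r = cmod (lattice_point p)"
    have r2: "r ^ 2 = real_of_int M" unfolding r_def norm_lattice_point by (simp add: p M_def)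
    have "1 ^ 2 \<le> r ^ 2" using M r2 by simp
    then have r1: "r \<ge> 1" by (rule power2_le_imp_le) (simp add: r_def)
    have "real_of_int M ^ 3 = r ^ 6" by (simp add: r2[symmetric] flip: power_mult)
    also have "\<dots> \<le> r ^ N" using N r1 by (intro power_increasing) auto
    finally have rN: "real_of_int M ^ 3 \<le> r ^ N" .
    have "norm (of_int (a p) / lattice_point p ^ N) = real_of_int \<bar>a p\<bar> / r ^ N"
      by (simp add: norm_divide norm_power r_def)
    also have "\<dots> \<le> real_of_int (2 * M) / real_of_int M ^ 3"
      using aM rN M by (intro frac_le) (simp_all only: of_int_le_iff, auto)
    also have "\<dots> = 18 / (real_of_int (3 * M) * real_of_int (3 * M))"
      using M by (simp add: field_simps power3_eq_cube)
    also have "\<dots> \<le> 18 / (real_of_int (1 + c ^ 2) * real_of_int (1 + d ^ 2))"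
    proof (intro divide_left_mono mult_mono)
      show "real_of_int (1 + c ^ 2) \<le> real_of_int (3 * M)" "real_of_int (1 + d ^ 2) \<le> real_of_int (3 * M)"
        using cM by (simp_all only: of_int_le_iff)
      have "0 < real_of_int (1 + c ^ 2)" "0 < real_of_int (1 + d ^ 2)" by (simp_all add: add_pos_nonneg)
      then show "0 < real_of_int (3 * M) * real_of_int (3 * M) * (real_of_int (1 + c ^ 2) * real_of_int (1 + d ^ 2))"
        using M by (intro mult_pos_pos) auto
    qed (use M in \<open>auto intro: add_nonneg_nonneg\<close>)
    finally show ?thesis by (simp add: p)
  qed
qed

text \<open>The pairing of j with -j - 1 is the one in which \<open>Lipschitz_formula\<close>
  presents a lattice row.\<close>

lemma int_summable_sums:
  fixes F :: "int \<Rightarrow> complex"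
  assumes "F summable_on UNIV"
  shows "(\<lambda>j. F (int j) + F (- int j - 1)) sums infsum F UNIV"
proof -
  let ?m = "\<lambda>j::nat. - int j - 1"
  have inj: "inj int" "inj ?m" by (auto simp: inj_on_def)
  have U: "range int \<union> range ?m = UNIV"
  proof -
    have "c \<in> range int \<or> c \<in> range ?m" for c :: int
    proof (cases "c \<ge> 0")
      case True then show ?thesis by (metis nonneg_int_cases rangeI)
    next
      case False
      then have "c = ?m (nat (- c - 1))" by simp
      then show ?thesis by blast
    qed
    then show ?thesis by auto
  qed
  have s: "F summable_on range int" "F summable_on range ?m"
    by (rule summable_on_subset_banach[OF assms], simp)+
  have "infsum F (range int \<union> range ?m) = infsum F (range int) + infsum F (range ?m)"
    by (rule infsum_Un_disjoint[OF s]) auto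
  then have tot: "infsum F UNIV = infsum F (range int) + infsum F (range ?m)" by (simp only: U)
  have 1: "(\<lambda>j. F (int j)) sums infsum F (range int)"
    using has_sum_infsum[OF s(1)] inj by (subst (asm) has_sum_reindex) (auto simp: o_def intro: has_sum_imp_sums)
  have 2: "(\<lambda>j. F (?m j)) sums infsum F (range ?m)"
    using has_sum_infsum[OF s(2)] inj by (subst (asm) has_sum_reindex) (auto simp: o_def intro: has_sum_imp_sums)
  show ?thesis unfolding tot by (rule sums_add[OF 1 2])
qed

text \<open>Multiplication by \<open>rho\<close> permutes the lattice \<open>\<int> rho + \<int>\<close>; the two coordinate sums
  \<open>Sf\<close>, \<open>Sg\<close> therefore satisfy a linear system that forces them to vanish.\<close>

lemma lattice_sum_zero:
  assumes N: "N \<ge> 6" and r: "rho ^ N = -1"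
  shows "infsum (\<lambda>p. of_int (fst p) / lattice_point p ^ N) UNIV = 0"
proof -
  define f where "f p = of_int (fst p) / lattice_point p ^ N" for p
  define g where "g p = of_int (snd p) / lattice_point p ^ N" for p
  have sf: "f summable_on UNIV" unfolding f_def by (rule lattice_term_summable[OF N]) auto
  have sg: "g summable_on UNIV" unfolding g_def by (rule lattice_term_summable[OF N]) auto
  define rot :: "int \<times> int \<Rightarrow> int \<times> int" where "rot p = (fst p + snd p, - fst p)" for p
  have bij: "bij rot"
    by (rule o_bij[of "\<lambda>p. (- snd p, fst p + snd p)"]) (auto simp: rot_def fun_eq_iff)
  have rl: "lattice_point (rot p) = rho * lattice_point p" for p
  proof -
    have "rho * lattice_point p = of_int (fst p) * rho ^ 2 + of_int (snd p) * rho"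
      by (simp add: power2_eq_square algebra_simps)
    then show ?thesis unfolding rho_square by (simp add: rot_def algebra_simps)
  qed
  have fr: "f (rot p) = - (f p + g p)" and gr: "g (rot p) = f p" for p
    unfolding f_def g_def rl power_mult_distrib r by (simp_all add: rot_def add_divide_distrib)
  have "infsum f UNIV = infsum (\<lambda>p. f (rot p)) UNIV"
    by (rule infsum_reindex_bij_betw[symmetric]) (use bij in simp)
  also have "\<dots> = - (infsum f UNIV + infsum g UNIV)"
    unfolding fr infsum_uminus by (simp add: infsum_add[OF sf sg])
  finally have 1: "infsum f UNIV = - (infsum f UNIV + infsum g UNIV)" .
  have "infsum g UNIV = infsum (\<lambda>p. g (rot p)) UNIV"
    by (rule infsum_reindex_bij_betw[symmetric]) (use bij in simp)
  then have "infsum g UNIV = infsum f UNIV" unfolding gr .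
  with 1 have "3 * infsum f UNIV = 0" by (simp add: algebra_simps)
  then have "infsum f UNIV = 0" by simp
  then show ?thesis by (simp only: f_def[abs_def])
qed

text \<open>The numerator and the odd power both change sign under p -> -p, and c = 0 contributes
  nothing. So the full sum is twice the sum over c >= 1, the range of the Lambert index.\<close>

lemma lattice_half_sum_zero:
  assumes N: "N \<ge> 6" "odd N" and r: "rho ^ N = -1"
  shows "((\<lambda>p. of_int (fst p) / lattice_point p ^ N) has_sum 0) ({1..} \<times> UNIV)"
proof -
  define f where "f p = of_int (fst p) / lattice_point p ^ N" for p
  have sf: "f summable_on UNIV" unfolding f_def by (rule lattice_term_summable[OF N(1)]) auto
  let ?A = "{1..} \<times> UNIV :: (int \<times> int) set" and ?B = "{..-1} \<times> UNIV :: (int \<times> int) set"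
  have s: "f summable_on ?A" "f summable_on ?B"
    by (rule summable_on_subset_banach[OF sf], simp)+
  have "infsum f UNIV = infsum f (?A \<union> ?B)"
  proof (rule infsum_cong_neutral)
    fix p assume "p \<in> UNIV - (?A \<union> ?B)"
    then have "fst p = 0" by (cases p) force
    then show "f p = 0" by (simp add: f_def)
  qed auto
  also have "\<dots> = infsum f ?A + infsum f ?B" by (intro infsum_Un_disjoint s) auto
  also have "infsum f ?B = infsum f ?A"
  proof (rule infsum_reindex_bij_witness[of _ "\<lambda>p. (- fst p, - snd p)" "\<lambda>p. (- fst p, - snd p)"])
    fix p :: "int \<times> int"
    have "f (- fst p, - snd p) = of_int (- fst p) / (- lattice_point p) ^ N" by (simp add: f_def)
    then show "f (- fst p, - snd p) = f p"
      unfolding power_minus_odd[OF N(2)] by (simp add: f_def)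
  qed auto
  finally have "2 * infsum f ?A = 0"
    using lattice_sum_zero[OF N(1) r] by (simp add: f_def[abs_def])
  then show ?thesis using has_sum_infsum[OF s(1)] by (simp add: f_def[abs_def])
qed

text \<open>Up to a factor the sum of c / (c z + d)^N is the derivative of the Eisenstein sum of (c
  z + d)^(-k). Lipschitz' formula turns its row c = m at z = rho into -V times m L(q^m), and the
  rows add up to the twisted series.\<close>

lemma twisted_series_zero_at_rho:
  assumes k: "k \<ge> 6" "k mod 6 = 2"
  shows "twisted_series k (exp (2 * of_real pi * \<i> * rho)) = 0"
proof -
  define N where "N = Suc k"
  define q where "q = exp (2 * of_real pi * \<i> * rho)"
  define V :: complex where "V = (2 * of_real pi * \<i>) ^ N / fact k"
  have V0: "V \<noteq> 0" by (simp add: V_def)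
  have even: "even k" using k by presburger
  have N: "N \<ge> 6" "odd N" using k even by (auto simp: N_def)
  \<comment> \<open>k = 2 mod 6 says that N is an odd multiple of 3, so rho^N = -1 follows from
    rho^3 = -1.\<close>
  have "N = 3 * (2 * (k div 6) + 1)" using k unfolding N_def by presburger
  then have "rho ^ N = (rho ^ 3) ^ (2 * (k div 6) + 1)" by (simp only: power_mult)
  then have r: "rho ^ N = -1" by (simp add: rho_cube)
  have im: "Im rho > 0" by (simp add: rho_def)
  define F where "F c d = of_int c / (of_int c * rho + of_int d) ^ N" for c d :: int
  have h: "((\<lambda>(c, d). F c d) has_sum 0) ({1..} \<times> UNIV)"
    using lattice_half_sum_zero[OF N r] by (simp add: F_def case_prod_unfold)
  have sF: "(\<lambda>p. of_int (fst p) / lattice_point p ^ N) summable_on UNIV"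
    by (rule lattice_term_summable[OF N(1)]) auto
  have inner: "(F (int m) has_sum - V * (of_nat m * polylog k (q ^ m))) UNIV" if m: "m \<ge> 1" for m
  proof -
    define z where "z = of_nat m * rho"
    have z: "Im z > 0" using m im by (simp add: z_def)
    have "(\<lambda>p. of_int (fst p) / lattice_point p ^ N) summable_on (Pair (int m) ` UNIV)"
      by (rule summable_on_subset_banach[OF sF]) simp
    then have su: "F (int m) summable_on UNIV"
      by (subst (asm) summable_on_reindex) (auto simp: o_def F_def[abs_def] inj_on_def)
    have qm: "exp (2 * of_real pi * \<i> * z) = q ^ m"
      unfolding q_def z_def exp_of_nat_mult[symmetric] by (simp add: mult_ac)
    have "(\<lambda>j. - of_nat m * (1 / (of_nat j + 1 - z) ^ N - 1 / (z + of_nat j) ^ N)) sums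
       (- of_nat m * ((2 * of_real pi * \<i>) ^ N * polylog k (q ^ m) / fact k))"
      using Lipschitz_formula[OF z even] k unfolding N_def qm by (intro sums_mult) auto
    moreover have "- of_nat m * (1 / (of_nat j + 1 - z) ^ N - 1 / (z + of_nat j) ^ N) = F (int m) (int j) + F (int m) (- int j - 1)" for j
    proof -
      have "F (int m) (- int j - 1) = of_nat m / (- (of_nat j + 1 - z)) ^ N"
        by (simp add: F_def z_def algebra_simps)
      also have "\<dots> = - of_nat m / (of_nat j + 1 - z) ^ N"
        unfolding power_minus_odd[OF N(2)] by simp
      finally show ?thesis by (simp add: F_def z_def algebra_simps)
    qed
    ultimately have "(\<lambda>j. F (int m) (int j) + F (int m) (- int j - 1)) sums (- V * (of_nat m * polylog k (q ^ m)))"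
      by (simp add: V_def mult_ac)
    with int_summable_sums[OF su] have "infsum (F (int m)) UNIV = - V * (of_nat m * polylog k (q ^ m))"
      by (rule sums_unique2)
    then show ?thesis using has_sum_infsum[OF su] by simp
  qed
  have "((\<lambda>c. - V * (of_nat (nat c) * polylog k (q ^ nat c))) has_sum 0) {1..}"
  proof (rule has_sum_SigmaD[OF h])
    fix c :: int assume "c \<in> {1..}"
    then show "((\<lambda>d. case (c, d) of (c, d) \<Rightarrow> F c d) has_sum - V * (of_nat (nat c) * polylog k (q ^ nat c))) UNIV"
      using inner[of "nat c"] by simp
  qed
  moreover have "(({1..} :: int set)) = int ` {1..}"
  proof -
    have "c \<in> int ` {1..}" if "c \<ge> 1" for c :: int
      using that by (intro image_eqI[of _ _ "nat c"]) auto
    then show ?thesis by auto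
  qed
  ultimately have "((\<lambda>m. - V * (of_nat m * polylog k (q ^ m))) has_sum 0) {1..}"
    by (simp add: has_sum_reindex o_def)
  then have "((\<lambda>m. - V * (of_nat m * polylog k (q ^ m))) has_sum 0) UNIV"
    by (rule has_sum_cong_neutral[THEN iffD1, rotated -1]) auto
  then have "(\<lambda>m. - V * (of_nat m * polylog k (q ^ m))) sums 0" by (rule has_sum_imp_sums)
  moreover have "norm q < 1" unfolding q_def by (rule norm_exp_less_1[OF im])
  then have "(\<lambda>m. - V * (of_nat m * polylog k (q ^ m))) sums (- V * twisted_series k q)"
    using k by (intro sums_mult twisted_series_Lambert) auto
  ultimately have "- V * twisted_series k q = 0" by (rule sums_unique2[symmetric])
  then show ?thesis using V0 by (simp add: q_def)
qed

section \<open>Sample points on the half-line\<close>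

lemma le_tan:
  fixes x :: real
  assumes "0 \<le> x" "x < pi / 2"
  shows "x \<le> tan x"
proof -
  have "tan 0 - 0 \<le> tan x - x"
  proof (rule DERIV_nonneg_imp_nondecreasing[OF assms(1)])
    fix y assume y: "0 \<le> y" "y \<le> x"
    then have c: "cos y > 0" using assms by (intro cos_gt_zero_pi) auto
    have "((\<lambda>y. tan y - y) has_field_derivative inverse ((cos y)\<^sup>2) - 1) (at y)"
      using c by (intro DERIV_diff DERIV_tan DERIV_ident) auto
    moreover have "inverse ((cos y)\<^sup>2) - 1 \<ge> 0"
      using c by (simp add: one_le_inverse_iff abs_square_le_1)
    ultimately show "\<exists>d. ((\<lambda>y. tan y - y) has_real_derivative d) (at y) \<and> 0 \<le> d" by blast
  qed
  then show ?thesis by simp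
qed

lemma cot_strict_antimono:
  fixes x y :: real
  assumes "0 < x" "x < y" "y < pi / 2"
  shows "cot y < cot x"
proof -
  have "tan x < tan y" using assms by (intro tan_monotone) auto
  moreover have "tan x > 0" using assms by (intro tan_gt_zero) auto
  ultimately have "inverse (tan y) < inverse (tan x)" by (rule less_imp_inverse_less)
  then show ?thesis by (simp add: cot_def tan_def)
qed

lemma cot_pi_6: "cot (pi / 6) = sqrt 3"
  by (simp add: cot_def cos_30 sin_30)

lemma twisted_series_has_derivative:
  fixes x :: "'a::{real_normed_field,banach}"
  assumes "k \<ge> 3" "norm x < 1"
  shows "\<exists>D. (twisted_series k has_field_derivative D) (at x)"
  using mult_index_powser(2)[OF summable_twisted(1)[OF assms(1)] assms(2)]
  unfolding twisted_series_def[abs_def] by blast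

lemma twisted_series_holomorphic: "k \<ge> 3 \<Longrightarrow> twisted_series k holomorphic_on ball 0 1"
  unfolding holomorphic_on_open[OF open_ball] by (simp add: twisted_series_has_derivative)

lemma polylog_has_derivative:
  fixes x :: "'a::{real_normed_field,banach}"
  assumes "norm x < 1"
  shows "\<exists>D. (polylog k has_field_derivative D) (at x)"
  by (rule polylog_deriv[OF assms]) blast

lemma polylog_holomorphic: "polylog k holomorphic_on ball 0 1"
  unfolding holomorphic_on_open[OF open_ball] by (simp add: polylog_has_derivative)

lemma continuous_on_twisted_line:
  assumes "k \<ge> 3" "a > 0"
  shows "continuous_on {a..b} (\<lambda>t. twisted_series k (- exp (- 2 * pi * t) :: real))"
proof (rule continuous_at_imp_continuous_on, rule ballI)
  fix t assume "t \<in> {a..b}"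
  then have "norm (- exp (- 2 * pi * t)) < 1" using assms by simp
  then obtain D where "(twisted_series k has_field_derivative D) (at (- exp (- 2 * pi * t)))"
    using twisted_series_has_derivative[OF assms(1)] by blast
  then have c: "isCont (twisted_series k) (- exp (- 2 * pi * t))" by (rule DERIV_isCont)
  show "isCont (\<lambda>t. twisted_series k (- exp (- 2 * pi * t))) t"
    by (rule isCont_o2[where f = "\<lambda>t. - exp (- 2 * pi * t)"], intro continuous_intros, rule c)
qed

lemma continuous_on_polylog_line:
  assumes "a > 0"
  shows "continuous_on {a..b} (\<lambda>t. polylog k (- exp (- 2 * pi * t) :: real))"
proof (rule continuous_at_imp_continuous_on, rule ballI)
  fix t assume "t \<in> {a..b}"
  then have "norm (- exp (- 2 * pi * t)) < 1" using assms by simp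
  then obtain D where "(polylog k has_field_derivative D) (at (- exp (- 2 * pi * t)))"
    using polylog_has_derivative by blast
  then have c: "isCont (polylog k) (- exp (- 2 * pi * t))" by (rule DERIV_isCont)
  show "isCont (\<lambda>t. polylog k (- exp (- 2 * pi * t))) t"
    by (rule isCont_o2[where f = "\<lambda>t. - exp (- 2 * pi * t)"], intro continuous_intros, rule c)
qed

lemma exp_half_line: "Re z = 1 / 2 \<Longrightarrow> exp (2 * of_real pi * \<i> * z) = of_real (- exp (- 2 * pi * Im z))"
proof -
  assume "Re z = 1 / 2"
  then have "2 * of_real pi * \<i> * z = \<i> * of_real pi + of_real (- 2 * pi * Im z)"
    by (simp add: complex_eq_iff)
  then have "exp (2 * of_real pi * \<i> * z) = exp (\<i> * of_real pi) * of_real (exp (- 2 * pi * Im z))"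
    by (simp only: exp_add exp_of_real)
  then show ?thesis by simp
qed

lemma deriv_Eisenstein_E_zero_iff:
  assumes k: "k \<ge> 4" "even k" and z: "Re z = 1 / 2" "Im z > 0"
  shows "deriv (Eisenstein_E k) z = 0 \<longleftrightarrow> twisted_series k (- exp (- 2 * pi * Im z) :: real) = 0"
proof -
  have "bernoulli_number k \<noteq> 0" using k by (intro bernoulli_number_nonzero) auto
  then have "deriv (Eisenstein_E k) z = 0 \<longleftrightarrow> twisted_series k (exp (2 * of_real pi * \<i> * z)) = 0"
    using k z by (subst deriv_Eisenstein_E) auto
  also have "twisted_series k (exp (2 * of_real pi * \<i> * z)) = of_real (twisted_series k (- exp (- 2 * pi * Im z)))"
    unfolding exp_half_line[OF z(1)] using k z by (intro twisted_of_real) auto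
  finally show ?thesis by simp
qed

text \<open>F is closer to L than 0 is, so on the real axis it inherits the sign of L.\<close>

lemma twisted_series_sign:
  assumes k: "even k" "k \<ge> 8" and phi: "0 < phi" "phi \<le> 2 * pi / 9"
    and s: "real k * sin phi ^ 2 \<ge> 1" and c: "\<bar>cos (real (Suc k) * phi)\<bar> \<ge> sqrt 3 / 2"
  shows "twisted_series k (- exp (- pi * cot phi)) * cos (real (Suc k) * phi) > 0"
proof -
  define y where "y = exp (- pi * cot phi)"
  have phi2: "phi < pi / 2" using phi pi_gt_zero by linarith
  then have "cot phi > 0" using phi unfolding cot_def by (intro divide_pos_pos sin_gt_zero cos_gt_zero) auto
  then have y: "0 < y" "y < 1" by (auto simp: y_def)
  have "cmod (twisted_series k (of_real (- y)) - polylog k (of_real (- y))) < \<bar>polylog k (- y)\<bar>"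
    unfolding y_def by (rule twisted_minus_polylog_less[OF k phi s c]) simp
  then have "\<bar>twisted_series k (- y) - polylog k (- y)\<bar> < \<bar>polylog k (- y)\<bar>"
    using y k by (simp only: twisted_of_real polylog_of_real abs_minus_cancel abs_of_pos of_real_diff[symmetric] norm_of_real)
  moreover have "polylog k (- y) * cos (real (Suc k) * phi) > 0"
    unfolding y_def using k phi phi2 s c by (intro polylog_negative_sign(1)) auto
  ultimately show ?thesis unfolding y_def[symmetric]
    by (auto simp: zero_less_mult_iff)
qed

text \<open>The first branch is the height at which the \<open>m\<close>-th term of the $q$-series is largest, the second
  one solves \<open>(k + 1) * phi = m * pi\<close> for the dominant lattice term.\<close>

definition sample_point :: "nat \<Rightarrow> nat \<Rightarrow> real" where
  "sample_point k m = (if 6 * m ^ 2 \<le> k then real k / (2 * pi * real m) else cot (real m * pi / real (Suc k)) / 2)"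

lemma half_sqrt_3_le_1: "sqrt 3 / 2 \<le> 1"
  using real_sqrt_le_mono[of 3 4] by simp

lemma sin_square_lower:
  assumes "k \<ge> 8" "pi / 6 \<le> x" "x < pi / 2"
  shows "1 \<le> real k * sin x ^ 2"
proof -
  have "sin (pi / 6) \<le> sin x" using assms by (intro sin_monotone_2pi_le) auto
  then have "(1 / 2) ^ 2 \<le> sin x ^ 2" unfolding sin_30 by (intro power_mono) auto
  then have "8 * (1 / 2) ^ 2 \<le> real k * sin x ^ 2" using assms by (intro mult_mono) auto
  then show ?thesis by (simp add: power_divide)
qed

lemma pi_bounds: "3.14 \<le> pi" "pi \<le> 3.15"
  using pi_approx by simp_all

text \<open>The peak estimate needs 6 m^2 <= k. Otherwise 6 m^2 >= k + 1, and sin(phi) = tan(phi)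
  cos(phi) >= phi cos(pi / 6) yields k sin(phi)^2 >= pi^2 k / (8 (k + 1)), which is at least 1
  because pi^2 > 9 and k >= 8.\<close>

lemma sample_point_sign:
  assumes k: "even k" "k \<ge> 8" and m: "m \<ge> 1" "6 * m \<le> k"
  shows "(-1) ^ m * twisted_series k (- exp (- 2 * pi * sample_point k m)) > 0"
proof (cases "6 * m ^ 2 \<le> k")
  case True
  have "(-1) ^ m * twisted_series k (- exp (- real k / real m)) > 0"
    using k m True by (intro twisted_sign_at_peak) auto
  then show ?thesis using True m by (simp add: sample_point_def)
next
  case False
  define phi where "phi = real m * pi / real (Suc k)"
  have e: "- 2 * pi * sample_point k m = - pi * cot phi" using False by (simp add: sample_point_def phi_def)
  have c: "cos (real (Suc k) * phi) = (-1) ^ m" by (simp add: phi_def del: of_nat_Suc)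
  have phi: "0 < phi" "phi \<le> pi / 6"
  proof -
    show "0 < phi" using m by (simp add: phi_def)
    have "real (6 * m) \<le> real (Suc k)" using m by (simp only: of_nat_le_iff)
    then have "6 * real m * pi \<le> real (Suc k) * pi" by (intro mult_right_mono) auto
    then show "phi \<le> pi / 6" by (simp add: phi_def field_simps)
  qed
  have "real k * sin phi ^ 2 \<ge> 1"
  proof -
    have "phi \<le> tan phi" using phi by (intro le_tan) auto
    then have "phi ^ 2 \<le> tan phi ^ 2" using phi by (intro power_mono) auto
    have c2: "cos phi ^ 2 \<ge> 3 / 4"
    proof -
      have "cos (pi / 6) \<le> cos phi" using phi by (intro cos_monotone_0_pi_le) auto
      then have "cos (pi / 6) ^ 2 \<le> cos phi ^ 2" by (intro power_mono) (simp_all add: cos_30)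
      then show ?thesis by (simp add: cos_30 power_divide)
    qed
    have "sin phi ^ 2 = tan phi ^ 2 * cos phi ^ 2" using c2 by (auto simp: tan_def power_divide)
    also have "\<dots> \<ge> phi ^ 2 * (3 / 4)" using \<open>phi ^ 2 \<le> tan phi ^ 2\<close> c2 by (intro mult_mono) auto
    finally have s: "phi ^ 2 * (3 / 4) \<le> sin phi ^ 2" .
    have "real (Suc k) \<le> real (6 * m ^ 2)" using False by (simp only: of_nat_le_iff)
    then have m2: "real (Suc k) / 6 \<le> real m ^ 2" by simp
    have "phi ^ 2 = real m ^ 2 * pi ^ 2 / real (Suc k) ^ 2" by (simp add: phi_def power_divide power_mult_distrib)
    also have "\<dots> \<ge> real (Suc k) / 6 * pi ^ 2 / real (Suc k) ^ 2"
      using m2 by (intro divide_right_mono mult_right_mono) auto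
    also have "real (Suc k) / 6 * pi ^ 2 / real (Suc k) ^ 2 = pi ^ 2 / (6 * real (Suc k))"
      by (simp add: power2_eq_square)
    finally have "pi ^ 2 / (6 * real (Suc k)) \<le> phi ^ 2" .
    then have "pi ^ 2 / (6 * real (Suc k)) * (3 / 4) \<le> phi ^ 2 * (3 / 4)" by (rule mult_right_mono) simp
    also note s
    finally have "pi ^ 2 / (6 * real (Suc k)) * (3 / 4) \<le> sin phi ^ 2" .
    then have h1: "real k * (pi ^ 2 / (6 * real (Suc k)) * (3 / 4)) \<le> real k * sin phi ^ 2"
      by (intro mult_left_mono) auto
    have h2: "real k * (pi ^ 2 / (6 * real (Suc k)) * (3 / 4)) = pi ^ 2 * real k / (8 * real (Suc k))" by (simp add: field_simps)
    have h3: "1 \<le> pi ^ 2 * real k / (8 * real (Suc k))"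
    proof -
      have "(3.14) ^ 2 \<le> pi ^ 2" using pi_bounds by (intro power_mono) auto
      then have "9 * real k \<le> pi ^ 2 * real k" by (intro mult_right_mono) (auto simp: power2_eq_square)
      moreover have "8 * real (Suc k) \<le> 9 * real k" using k by simp
      ultimately have "8 * real (Suc k) \<le> pi ^ 2 * real k" by (rule order_trans[rotated])
      then show ?thesis by (simp add: le_divide_eq del: of_nat_Suc)
    qed
    show ?thesis using h1 h3 unfolding h2 by (rule order_trans[rotated])
  qed
  moreover note half_sqrt_3_le_1
  ultimately have "twisted_series k (- exp (- pi * cot phi)) * cos (real (Suc k) * phi) > 0"
    using k phi pi_gt_zero by (intro twisted_series_sign) (auto simp: c power_abs simp del: of_nat_Suc)
  then show ?thesis unfolding c e by (simp only: mult.commute)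
qed

lemma sample_point_gt:
  assumes k: "k \<ge> 8" and m: "m \<ge> 1" "6 * m \<le> k"
  shows "sample_point k m > sqrt 3 / 2"
proof (cases "6 * m ^ 2 \<le> k")
  case True
  have "sqrt 3 \<le> 18 / 10" by (rule real_le_lsqrt) (auto simp: power2_eq_square)
  then have "pi * sqrt 3 \<le> 3.15 * (18 / 10)" using pi_bounds by (intro mult_mono) auto
  then have "pi * sqrt 3 < 6" by simp
  then have "pi * sqrt 3 * real m < 6 * real m" using m by (intro mult_strict_right_mono) auto
  also have "6 * real m \<le> real k" using m by (metis of_nat_le_iff of_nat_mult of_nat_numeral)
  finally show ?thesis using True m by (simp add: sample_point_def field_simps)
next
  case False
  have "real m * pi / real (Suc k) < pi / 6"
  proof -
    have "real (6 * m) < real (Suc k)" using m by (simp only: of_nat_less_iff)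
    then have "6 * real m * pi < real (Suc k) * pi" by (intro mult_strict_right_mono) auto
    then show ?thesis by (simp add: field_simps)
  qed
  then have "cot (pi / 6) < cot (real m * pi / real (Suc k))"
    using m by (intro cot_strict_antimono) auto
  then show ?thesis using False by (simp add: sample_point_def cot_pi_6)
qed

text \<open>The delicate case is the change of branch between m and m + 1. There cot(y) <= 1/y
  bounds the lower point by (k + 1) / (2 pi (m + 1)), which is less than k / (2 pi m) since m <
  k.\<close>

lemma sample_point_decreasing:
  assumes k: "k \<ge> 8" and m: "m \<ge> 1" "6 * Suc m \<le> k"
  shows "sample_point k (Suc m) < sample_point k m"
proof -
  define x where "x = real m * pi / real (Suc k)"
  define y where "y = real (Suc m) * pi / real (Suc k)"
  have xy: "0 < x" "x < y" using m by (auto simp: x_def y_def divide_strict_right_mono)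
  have y2: "y < pi / 2"
  proof -
    have "real (2 * Suc m) < real (Suc k)" using m by (simp only: of_nat_less_iff)
    then have "2 * real (Suc m) * pi < real (Suc k) * pi" by (intro mult_strict_right_mono) auto
    then show ?thesis by (simp add: y_def field_simps)
  qed
  have mono: "6 * m ^ 2 \<le> k" if "6 * (Suc m) ^ 2 \<le> k"
  proof -
    have "m ^ 2 \<le> (Suc m) ^ 2" by (intro power_mono) auto
    then show ?thesis using that by linarith
  qed
  consider "6 * (Suc m) ^ 2 \<le> k" | "\<not> 6 * (Suc m) ^ 2 \<le> k" "6 * m ^ 2 \<le> k" | "\<not> 6 * (Suc m) ^ 2 \<le> k" "\<not> 6 * m ^ 2 \<le> k"
    by blast
  then show ?thesis
  proof cases
    case 1
    then show ?thesis using mono m k unfolding sample_point_def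
      by (auto intro!: divide_strict_left_mono mult_pos_pos simp del: power_Suc)
  next
    case 2
    have "y \<le> tan y" using xy y2 by (intro le_tan) auto
    then have "1 / tan y \<le> 1 / y"
      using xy y2 tan_gt_zero[of y] by (intro divide_left_mono) auto
    then have "cot y \<le> 1 / y" by (simp add: cot_def tan_def)
    moreover have "1 / y < real k / (pi * real m)"
    proof -
      have "1 / y = real (Suc k) / (pi * real (Suc m))" by (simp add: y_def mult.commute)
      also have "\<dots> < real k / (pi * real m)"
      proof -
        have "m < k" using m by simp
        then have "Suc k * m < k * Suc m" by simp
        then have "real (Suc k) * real m < real k * real (Suc m)" by (metis of_nat_less_iff of_nat_mult)
        then show ?thesis using m by (simp add: divide_less_eq less_divide_eq mult_ac del: of_nat_Suc)
      qed
      finally show ?thesis .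
    qed
    ultimately have "cot y < real k / (pi * real m)" by linarith
    then show ?thesis using 2 by (simp add: sample_point_def y_def del: power_Suc of_nat_Suc)
  next
    case 3
    then show ?thesis using cot_strict_antimono[OF xy y2]
      by (simp add: sample_point_def x_def y_def del: power_Suc of_nat_Suc)
  qed
qed

section \<open>Upper and lower bounds for the number of zeros\<close>

lemma polylog_sign_changes:
  assumes k: "even k" "k \<ge> 8" and phi: "pi / 6 \<le> phi0" "phi0 < pi / 2"
    and c: "\<bar>cos (real (Suc k) * phi0)\<bar> \<ge> sqrt 3 / 2" "(-1) ^ m * cos (real (Suc k) * phi0) > 0"
    and m: "phi0 < real (m + 1) * pi / real (Suc k)" "2 * m \<le> k"
  shows "\<exists>T. finite T \<and> card T = k div 2 - m \<and> T \<subseteq> {0<..<cot phi0 / 2} \<and>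
    (\<forall>t\<in>T. polylog k (- exp (- 2 * pi * t) :: real) = 0)"
proof -
  \<comment> \<open>The angles run up to (k div 2) pi / N, the largest multiple of pi / N below pi /
    2 because N = k + 1 is odd. Only L is followed this far; its estimate, unlike the comparison
    with F, holds up to pi / 2.\<close>
  define n where "n = k div 2 - m"
  define phi where "phi i = (if i = 0 then phi0 else real (m + i) * pi / real (Suc k))" for i
  define p where "p i = cot (phi i) / 2" for i
  define f where "f t = polylog k (- exp (- 2 * pi * t) :: real)" for t
  have k2: "k = 2 * (k div 2)" using k by simp
  have inc: "phi i < phi (Suc i)" for i
    using m(1) by (auto simp: phi_def intro!: divide_strict_right_mono)
  have up: "phi i < pi / 2" if "i \<le> n" for i
  proof (cases "i = 0")
    case False
    then have "2 * (m + i) < Suc k" using that m(2) k2 by (simp add: n_def)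
    then have "real (2 * (m + i)) < real (Suc k)" by (simp only: of_nat_less_iff)
    then have "2 * real (m + i) * pi < real (Suc k) * pi" by (intro mult_strict_right_mono) auto
    then show ?thesis using False by (simp add: phi_def field_simps)
  qed (use phi in \<open>simp add: phi_def\<close>)
  have low: "pi / 6 \<le> phi i" for i
  proof (induction i)
    case 0 then show ?case using phi by (simp add: phi_def)
  next
    case (Suc i) then show ?case using inc[of i] by simp
  qed
  have pos: "phi i > 0" for i using low[of i] pi_gt_zero by linarith
  have cosi: "\<bar>cos (real (Suc k) * phi i)\<bar> \<ge> sqrt 3 / 2 \<and> (-1) ^ (m + i) * cos (real (Suc k) * phi i) > 0" for i
  proof (cases "i = 0")
    case False
    then have "cos (real (Suc k) * phi i) = (-1) ^ (m + i)" by (simp add: phi_def del: of_nat_Suc of_nat_add)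
    then show ?thesis using half_sqrt_3_le_1 by (simp add: power_abs flip: power_mult_distrib)
  qed (use c in \<open>simp add: phi_def\<close>)
  have sgn: "f (p i) * cos (real (Suc k) * phi i) > 0" if "i \<le> n" for i
  proof -
    have "real k * sin (phi i) ^ 2 \<ge> 1" by (rule sin_square_lower[OF k(2) low up[OF that]])
    then have "polylog k (- exp (- pi * cot (phi i))) * cos (real (Suc k) * phi i) > 0"
      using k pos up[OF that] cosi by (intro polylog_negative_sign(1)) auto
    then show ?thesis by (simp add: f_def p_def)
  qed
  have pn: "p n > 0" unfolding p_def cot_def
    using pos[of n] up[of n] by (auto intro!: divide_pos_pos sin_gt_zero cos_gt_zero)
  have "\<exists>T. finite T \<and> card T = n \<and> T \<subseteq> {p n<..<p 0} \<and> (\<forall>x\<in>T. f x = 0)"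
  proof (rule alternating_signs_zeros)
    show "continuous_on {p n..p 0} f" unfolding f_def by (rule continuous_on_polylog_line[OF pn])
    fix i assume i: "i < n"
    show "p (Suc i) < p i" using cot_strict_antimono[OF pos inc up] i by (simp add: p_def)
    define s where "s = ((-1) ^ (m + i) :: real)"
    define a b where "a = cos (real (Suc k) * phi i)" and "b = cos (real (Suc k) * phi (Suc i))"
    have "s * a > 0" "s * b < 0" using cosi[of i] cosi[of "Suc i"] by (simp_all add: s_def a_def b_def)
    then have "a * b < 0" by (auto simp: zero_less_mult_iff mult_less_0_iff)
    moreover have "f (p i) * a > 0" "f (p (Suc i)) * b > 0" using sgn[of i] sgn[of "Suc i"] i by (simp_all add: a_def b_def)
    ultimately show "f (p i) * f (p (Suc i)) < 0" by (auto simp: zero_less_mult_iff mult_less_0_iff)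
  qed
  then obtain T where T: "finite T" "card T = n" "T \<subseteq> {p n<..<p 0}" "\<forall>x\<in>T. f x = 0" by blast
  have p0: "p 0 = cot phi0 / 2" by (simp add: p_def phi_def)
  have "T \<subseteq> {0<..<cot phi0 / 2}" using T(3) pn unfolding p0 by force
  then show ?thesis using T by (auto simp: n_def f_def intro!: exI[of _ T])
qed

text \<open>The polylogarithm has at most \<open>k div 2 - 1\<close> zeros in \<open>(-1, 0)\<close>; those found by sign changes
  outside the circle leave at most \<open>m - 1\<close> inside, and by Rouche the same bound holds for the twisted
  series.\<close>

lemma twisted_zeros_upper_bound:
  assumes k: "even k" "k \<ge> 8" and phi: "pi / 6 \<le> phi0" "phi0 \<le> 2 * pi / 9"
    and c: "\<bar>cos (real (Suc k) * phi0)\<bar> \<ge> sqrt 3 / 2" "(-1) ^ m * cos (real (Suc k) * phi0) > 0"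
    and m: "phi0 < real (m + 1) * pi / real (Suc k)" "2 * m \<le> k" "m \<ge> 1"
  shows "finite {t. t > cot phi0 / 2 \<and> twisted_series k (- exp (- 2 * pi * t) :: real) = 0}"
    and "card {t. t > cot phi0 / 2 \<and> twisted_series k (- exp (- 2 * pi * t) :: real) = 0} \<le> m - 1"
proof -
  define t0 where "t0 = cot phi0 / 2"
  define R where "R = exp (- 2 * pi * t0)"
  define Z where "Z = {t. t > t0 \<and> twisted_series k (- exp (- 2 * pi * t) :: real) = 0}"
  define e where "e t = - exp (- 2 * pi * t)" for t :: real
  have phi2: "0 < phi0" "phi0 < pi / 2" using phi pi_gt_zero by linarith+
  have t0: "t0 > 0" unfolding t0_def cot_def
    using phi2 by (auto intro!: divide_pos_pos sin_gt_zero cos_gt_zero)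
  have R: "0 < R" "R < 1" using t0 by (auto simp: R_def)
  have Rc: "R = exp (- pi * cot phi0)" by (simp add: R_def t0_def)
  have einj: "inj e" by (auto simp: inj_on_def e_def)
  have kpos: "k > 0" using k by simp
  obtain S where S: "finite S" "S \<subseteq> {-1<..<0::real}" "2 * card S \<le> k - 1"
    "\<forall>x\<in>{-1<..<0}. polylog k x = 0 \<longleftrightarrow> x \<in> S"
    "\<forall>z. cmod z < 1 \<longrightarrow> (polylog k z = 0 \<longleftrightarrow> z = 0 \<or> z \<in> complex_of_real ` S)"
    "\<forall>z::complex. cmod z < 1 \<longrightarrow> polylog k z = 0 \<longrightarrow> zorder (polylog k) z = 1"
    using polylog_zeros[OF kpos] by (elim exE conjE) (rule that)
  obtain T where T: "finite T" "card T = k div 2 - m" "T \<subseteq> {0<..<t0}"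
    "\<forall>t\<in>T. polylog k (e t) = 0"
    using polylog_sign_changes[OF k phi(1) phi2(2) c m(1,2), folded t0_def e_def] by (elim exE conjE) (rule that)
  define S' where "S' = {x \<in> S. - R < x}"
  have eT: "e ` T \<subseteq> S - S'"
  proof
    fix x assume "x \<in> e ` T"
    then obtain t where t: "t \<in> T" "x = e t" by blast
    then have "0 < t" "t < t0" using T(3) by auto
    then have "x \<in> {-1<..<0}" "x < - R" by (auto simp: t e_def R_def)
    then show "x \<in> S - S'" using S(4) T(4) t by (auto simp: S'_def)
  qed
  have cS': "card S' \<le> m - 1"
  proof -
    have "k div 2 - m = card (e ` T)" using T einj by (simp add: card_image inj_on_subset[OF einj])
    also have "\<dots> \<le> card (S - S')" using eT S by (intro card_mono) auto
    also have "\<dots> = card S - card S'" using S by (intro card_Diff_subset) (auto simp: S'_def)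
    finally have "k div 2 - m \<le> card S - card S'" .
    moreover have "card S' \<le> card S" using S by (intro card_mono) (auto simp: S'_def)
    \<comment> \<open>As k is even, 2 card S <= k - 1 improves to card S <= k / 2 - 1; removing the
      k / 2 - m zeros outside the circle leaves m - 1.\<close>
    ultimately show ?thesis using S(3) k m by presburger
  qed
  have s: "real k * sin phi0 ^ 2 \<ge> 1" by (rule sin_square_lower[OF k(2) phi(1) phi2(2)])
  have less: "cmod (twisted_series k z - polylog k z) < cmod (polylog k z)" if "cmod z = R" for z
  proof -
    have "cmod (twisted_series k z - polylog k z) < \<bar>polylog k (- R)\<bar>"
      using twisted_minus_polylog_less[OF k phi2(1) phi(2) s c(1), of z] that unfolding Rc by blast
    also have "\<dots> \<le> cmod (polylog k z)" using k R that by (intro polylog_circle_min) auto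
    finally show ?thesis .
  qed
  have holo: "polylog k holomorphic_on ball 0 1" "twisted_series k holomorphic_on ball (0::complex) 1"
    using k by (auto intro: polylog_holomorphic twisted_series_holomorphic)
  define ZF where "ZF = {z \<in> ball 0 R. twisted_series k z = (0::complex)}"
  have finF: "finite ZF" unfolding ZF_def by (rule Rouche_disc(1)[OF holo R less])
  have sums: "(\<Sum>z\<in>ZF. zorder (twisted_series k) z) = (\<Sum>z | z \<in> ball 0 R \<and> polylog k z = 0. zorder (polylog k) z)"
    unfolding ZF_def by (rule Rouche_disc(3)[OF holo R less])
  have zeros: "{z. z \<in> ball 0 R \<and> polylog k z = 0} = insert 0 (complex_of_real ` S')"
  proof -
    have "z \<in> ball 0 R \<and> polylog k z = 0 \<longleftrightarrow> z \<in> insert 0 (complex_of_real ` S')" for z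
    proof (cases "cmod z < R")
      case True
      then have "polylog k z = 0 \<longleftrightarrow> z = 0 \<or> z \<in> of_real ` S" using R S(5) by auto
      also have "z \<in> of_real ` S \<longleftrightarrow> z \<in> of_real ` S'" using True S(2) by (force simp: S'_def)
      finally show ?thesis using True by auto
    next
      case False
      have "cmod z < R" if "z \<in> insert 0 (complex_of_real ` S')" using that S(2) R by (auto simp: S'_def)
      then show ?thesis using False by auto
    qed
    then show ?thesis by blast
  qed
  have ones: "(\<Sum>z\<in>insert 0 (complex_of_real ` S'). zorder (polylog k) z) = (\<Sum>z\<in>insert 0 (complex_of_real ` S'). 1)"
  proof (rule sum.cong[OF refl])
    fix z assume z: "z \<in> insert 0 (complex_of_real ` S')"
    then have "cmod z < 1" using S(2) by (auto simp: S'_def)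
    moreover from this have "polylog k z = 0" using z S(5) by (auto simp: S'_def)
    ultimately show "zorder (polylog k) z = 1" using S(6) by blast
  qed
  have ci: "card (insert 0 (complex_of_real ` S')) = Suc (card S')"
  proof -
    have "0 \<notin> complex_of_real ` S'" using S(2) by (auto simp: S'_def)
    then show ?thesis using S(1) by (simp add: S'_def card_image inj_on_def)
  qed
  have sumF: "(\<Sum>z\<in>ZF. zorder (twisted_series k) z) = int (Suc (card S'))"
    unfolding sums zeros ones by (simp only: sum_constant ci mult_1_right of_nat_id)
  \<comment> \<open>Multiplicities of F are not known, but order at least 1 suffices for an upper
    bound. The finiteness of \<open>ZF\<close> ensures that F does not vanish identically near
    z.\<close>
  have ord: "zorder (twisted_series k) z \<ge> 1" if "z \<in> ZF" for z
  proof -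
    have op: "open (ball 0 R - (ZF - {z}))" using finF by (intro open_Diff finite_imp_closed) auto
    have zin: "z \<in> ball 0 R - (ZF - {z})" using that by (auto simp: ZF_def)
    have "eventually (\<lambda>w. w \<in> ball 0 R - (ZF - {z}) - {z}) (at z)" by (rule eventually_at_in_open[OF op zin])
    then have "eventually (\<lambda>w. twisted_series k w \<noteq> 0) (at z)"
      by eventually_elim (auto simp: ZF_def)
    then have fr: "frequently (\<lambda>w. twisted_series k w \<noteq> 0) (at z)" by (intro eventually_frequently) auto
    have "zorder (twisted_series k) z > 0 \<longleftrightarrow> twisted_series k z = 0"
      by (rule zorder_pos_iff[OF holo(2) open_ball _ fr]) (use that R in \<open>auto simp: ZF_def\<close>)
    then show ?thesis using that by (simp add: ZF_def)
  qed
  have "int (card ZF) = (\<Sum>z\<in>ZF. 1)" by simp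
  also have "\<dots> \<le> int (Suc (card S'))" unfolding sumF[symmetric] by (intro sum_mono ord)
  finally have cF: "card ZF \<le> Suc (card S')" by simp
  define E where "E t = complex_of_real (e t)" for t
  have inE: "inj E" using einj by (auto simp: inj_on_def E_def)
  have tw0: "twisted_series k (0::complex) = 0"
    using powser_zero[of "\<lambda>n. of_nat (n * sigma (k - 1) n) :: complex"] by (simp add: twisted_series_def)
  \<comment> \<open>The zero at q = 0, the cusp, belongs to F as well as to L; counting it on both
    sides cancels the \<open>Suc\<close>.\<close>
  have sub: "insert 0 (E ` Z) \<subseteq> ZF"
  proof -
    have "E t \<in> ZF" if "t \<in> Z" for t
    proof -
      have t: "t > t0" "twisted_series k (e t) = 0" using that by (auto simp: Z_def e_def)
      have "twisted_series k (E t) = of_real (twisted_series k (e t))"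
        unfolding E_def using k t t0 by (intro twisted_of_real) (auto simp: e_def)
      moreover have "cmod (E t) < R" using t by (simp add: E_def e_def R_def)
      ultimately show ?thesis using t by (simp add: ZF_def)
    qed
    moreover have "0 \<in> ZF" using R tw0 by (simp add: ZF_def)
    ultimately show ?thesis by auto
  qed
  have "finite (E ` Z)" using sub finF by (meson finite_insert finite_subset)
  then have finZ: "finite Z" by (rule finite_imageD) (use inE in \<open>auto intro: inj_on_subset\<close>)
  have "0 \<notin> E ` Z" by (auto simp: E_def e_def)
  then have "Suc (card Z) = card (insert 0 (E ` Z))" using finZ inE by (simp add: card_image inj_on_subset[OF inE])
  also have "\<dots> \<le> card ZF" by (rule card_mono[OF finF sub])
  finally have "card Z \<le> card S'" using cF by simp
  then have "card Z \<le> m - 1" using cS' by simp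
  then show "finite {t. t > cot phi0 / 2 \<and> twisted_series k (- exp (- 2 * pi * t) :: real) = 0}"
    "card {t. t > cot phi0 / 2 \<and> twisted_series k (- exp (- 2 * pi * t) :: real) = 0} \<le> m - 1"
    using finZ unfolding Z_def t0_def by simp_all
qed

text \<open>The a sample points enclose a - 1 sign changes. Between the lowest of them and t1 a
  further one is certain only if F has the opposite sign at t1, hence the conditional second
  bound.\<close>

lemma twisted_zeros_lower_bound:
  assumes k: "even k" "k \<ge> 8" and a: "6 * a \<le> k" "a \<ge> 1" and t1: "0 < t1" "t1 < sample_point k a"
    and fin: "finite {t. t > t1 \<and> twisted_series k (- exp (- 2 * pi * t) :: real) = 0}"
  shows "a - 1 \<le> card {t. t > t1 \<and> twisted_series k (- exp (- 2 * pi * t) :: real) = 0}"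
    and "(-1) ^ Suc a * twisted_series k (- exp (- 2 * pi * t1)) > 0 \<Longrightarrow>
       a \<le> card {t. t > t1 \<and> twisted_series k (- exp (- 2 * pi * t) :: real) = 0}"
proof -
  define f where "f t = twisted_series k (- exp (- 2 * pi * t) :: real)" for t
  define p where "p i = (if i < a then sample_point k (Suc i) else t1)" for i
  have sg: "(-1) ^ Suc i * f (p i) > 0" if "i < a" for i
    using sample_point_sign[OF k, of "Suc i"] a that by (simp add: p_def f_def)
  have dec: "p (Suc i) < p i" if "Suc i \<le> a" for i
  proof (cases "Suc i = a")
    case True
    then show ?thesis using t1 by (auto simp: p_def)
  next
    case False
    then show ?thesis using sample_point_decreasing[of k "Suc i"] k a that by (simp add: p_def)
  qed
  have main: "n \<le> card {t. t > t1 \<and> f t = 0}"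
    if n: "n \<le> a" and s: "\<And>i. i \<le> n \<Longrightarrow> (-1) ^ Suc i * f (p i) > 0" for n
  proof -
    have "t1 \<le> p n"
    proof (cases "n < a")
      case True
      have "t1 \<le> p (a - 1 - j)" if "j \<le> a - 1" for j
        using that
      proof (induction j)
        case 0
        then show ?case using t1 a by (simp add: p_def)
      next
        case (Suc j)
        define i where "i = a - 1 - Suc j"
        have i: "a - 1 - j = Suc i" "Suc i \<le> a" using Suc.prems by (auto simp: i_def)
        have "t1 \<le> p (Suc i)" using Suc.IH Suc.prems i(1) by simp
        also have "\<dots> < p i" by (rule dec[OF i(2)])
        finally show ?case by (simp add: i_def)
      qed
      from this[of "a - 1 - n"] True show ?thesis by simp
    qed (use n in \<open>simp add: p_def\<close>)
    have "\<exists>T. finite T \<and> card T = n \<and> T \<subseteq> {p n<..<p 0} \<and> (\<forall>x\<in>T. f x = 0)"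
    proof (rule alternating_signs_zeros)
      show "continuous_on {p n..p 0} f" unfolding f_def
        using k t1 \<open>t1 \<le> p n\<close> by (intro continuous_on_twisted_line) auto
      fix i assume i: "i < n"
      show "p (Suc i) < p i" using dec[of i] i n by simp
      define r where "r = ((-1) ^ Suc i :: real)"
      have "r * f (p i) > 0" "r * f (p (Suc i)) < 0" using s[of i] s[of "Suc i"] i by (simp_all add: r_def)
      then show "f (p i) * f (p (Suc i)) < 0" by (auto simp: zero_less_mult_iff mult_less_0_iff)
    qed
    then obtain T where T: "finite T" "card T = n" "T \<subseteq> {p n<..<p 0}" "\<forall>x\<in>T. f x = 0" by blast
    have "T \<subseteq> {t. t > t1 \<and> f t = 0}" using T \<open>t1 \<le> p n\<close> by force
    then show ?thesis using T fin card_mono unfolding f_def by metis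
  qed
  show "a - 1 \<le> card {t. t > t1 \<and> twisted_series k (- exp (- 2 * pi * t) :: real) = 0}"
    using main[of "a - 1"] sg a unfolding f_def by force
  show "a \<le> card {t. t > t1 \<and> twisted_series k (- exp (- 2 * pi * t) :: real) = 0}"
    if "(-1) ^ Suc a * twisted_series k (- exp (- 2 * pi * t1)) > 0"
  proof -
    have "(-1) ^ Suc i * f (p i) > 0" if "i \<le> a" for i
      using sg[of i] \<open>(-1) ^ Suc a * _ > 0\<close> that by (cases "i = a") (auto simp: p_def f_def)
    from main[OF order_refl this] show ?thesis unfolding f_def by simp
  qed
qed

section \<open>Counting zeros\<close>

text \<open>The weights 4 and 6 are too small for the estimates with k >= 8, but here the first term
  of the q-series dominates: m^k <= m^6 <= 64^(m-1), and x = 64 y < 1/3 gives x / (1 - x) <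
  1/2.\<close>

lemma twisted_series_small_weight_nonzero:
  assumes k: "3 \<le> k" "k \<le> 6" and t: "t \<ge> sqrt 3 / 2"
  shows "twisted_series k (- exp (- 2 * pi * t) :: real) \<noteq> 0"
proof -
  define y where "y = exp (- 2 * pi * t)"
  define x where "x = 64 * y"
  have "sqrt 3 \<ge> 1732 / 1000" by (rule real_le_rsqrt) (simp add: power2_eq_square)
  then have "314 / 100 * (1732 / 1000) \<le> pi * sqrt 3" using pi_bounds by (intro mult_mono) auto
  also have "\<dots> \<le> pi * (2 * t)" using t by (intro mult_left_mono) auto
  finally have "27 / 5 \<le> 2 * pi * t" by simp
  then have "exp (27 / 5) \<le> exp (2 * pi * t)" by simp
  \<comment> \<open>192 = 3 * 64 is what x < 1/3 requires. The quadratic Taylor bound is applied at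
    a sixteenth of the exponent, where it is sharp enough.\<close>
  moreover have "(192 :: real) < exp (27 / 5)"
  proof -
    have "1 + 27 / 80 + (27 / 80) ^ 2 / 2 \<le> exp (27 / 80 :: real)" by (rule exp_lower_Taylor_quadratic) simp
    then have "(1394 / 1000 :: real) \<le> exp (27 / 80)" by (simp add: power2_eq_square)
    then have "(1394 / 1000   :: real) ^ 16 \<le> exp (27 / 80) ^ 16" by (intro power_mono) auto
    also have "exp (27 / 80) ^ 16 = exp (27 / 5 :: real)" by (simp flip: exp_of_nat_mult)
    finally show ?thesis by (simp add: power_divide)
  qed
  ultimately have "192 < exp (2 * pi * t)" by linarith
  then have "y < 1 / 192" by (simp add: y_def exp_minus field_simps)
  then have x: "0 < x" "x < 1 / 3" by (auto simp: x_def y_def)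
  have y: "0 < y" "y < 1" using x by (auto simp: x_def)
  define c where "c m = (if m < 2 then 0 else x ^ (m - 1))" for m :: nat
  have "(\<lambda>i. x * x ^ i) sums (x * (1 / (1 - x)))" using x by (intro sums_mult geometric_sums) auto
  moreover have "(\<lambda>i. c (i + 2)) = (\<lambda>i. x * x ^ i)" by (auto simp: c_def)
  ultimately have "(\<lambda>i. c (i + 2)) sums (x * (1 / (1 - x)))" by simp
  then have cs: "c sums (x / (1 - x))" by (subst (asm) sums_iff_shift) (simp add: c_def numeral_2_eq_2)
  have "(-1) ^ 1 * twisted_series k (- y) > 0"
  proof (rule twisted_dominant_term[OF k(1) y _ sums_summable[OF cs]])
    show "suminf c < 1 / 2" using cs x by (simp add: sums_iff divide_less_eq)
    show "real m ^ k * y ^ m \<le> real 1 ^ k * y ^ 1 * c m" if m1: "m \<noteq> 1" for m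
    proof (cases "m = 0")
      case True
      then show ?thesis using k by (simp add: c_def power_0_left)
    next
      case False
      then obtain i where i: "m = Suc (Suc i)" using m1 by (cases m; cases "m - 1") auto
      have "m \<le> 2 ^ (m - 1)" unfolding i by (induction i) auto
      then have "real m \<le> 2 ^ (m - 1)" by (metis of_nat_le_iff of_nat_numeral of_nat_power)
      then have "real m ^ 6 \<le> (2 ^ (m - 1)) ^ 6" by (intro power_mono) auto
      moreover have "real m ^ k \<le> real m ^ 6" using k False by (intro power_increasing) auto
      moreover have "(2 ^ (m - 1)) ^ 6 = (64 :: real) ^ (m - 1)"
      proof -
        have "((2 :: real) ^ (m - 1)) ^ 6 = (2 ^ 6) ^ (m - 1)"
          unfolding power_mult[symmetric] by (rule arg_cong) (rule mult.commute)
        then show ?thesis by simp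
      qed
      ultimately have "real m ^ k \<le> 64 ^ (m - 1)" by linarith
      then have "real m ^ k * y ^ m \<le> 64 ^ (m - 1) * y ^ m" using y by (intro mult_right_mono) auto
      also have "\<dots> = y * x ^ (m - 1)" unfolding i x_def by (simp add: power_mult_distrib)
      finally show ?thesis using i by (simp add: c_def)
    qed
  qed (auto simp: c_def)
  then show ?thesis by (simp add: y_def)
qed

lemma signed_value:
  fixes w :: real
  assumes "x = (-1) ^ n * w" "w > 0"
  shows "\<bar>x\<bar> \<ge> w" "(-1) ^ n * x > 0"
  using assms by (cases "even n"; simp)+

text \<open>With a = k div 6 the endpoint angle N pi / 6 is a pi + pi / 6, a pi + pi / 2 or (a + 1)
  pi - pi / 6 for k = 6a, 6a + 2, 6a + 4. In the outer cases the upper bound applies at the endpoint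
  with m = a and m = a + 1; in the middle one the cosine vanishes.\<close>

lemma twisted_zero_count:
  assumes k: "even k" "k \<ge> 4"
  defines "Z \<equiv> {t. t > sqrt 3 / 2 \<and> twisted_series k (- exp (- 2 * pi * t) :: real) = 0}"
  shows "(twisted_series k (- exp (- 2 * pi * (sqrt 3 / 2)) :: real) = 0 \<longleftrightarrow> k mod 6 = 2)
    \<and> finite Z \<and> card Z = (k - 4) div 6"
proof (cases "k \<le> 6")
  case True
  then have "k = 4 \<or> k = 6" using k by presburger
  moreover have "Z = {}" using twisted_series_small_weight_nonzero[of k] True k by (auto simp: Z_def)
  ultimately show ?thesis using twisted_series_small_weight_nonzero[of k "sqrt 3 / 2"] by auto
next
  case False
  then have k8: "k \<ge> 8" using k by presburger
  define a where "a = k div 6"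
  have a1: "a \<ge> 1" "6 * a \<le> k" using k8 by (auto simp: a_def)
  note t1 = sample_point_gt[OF k8 a1]
  have s30: "cot (pi / 6) / 2 = sqrt 3 / 2" by (simp add: cot_pi_6)
  have e30: "- 2 * pi * (sqrt 3 / 2) = - pi * cot (pi / 6)" by (simp add: cot_pi_6)
  have pos: "0 < sqrt 3 / 2" by simp
  have "k mod 6 = 0 \<or> k mod 6 = 2 \<or> k mod 6 = 4" using k by presburger
  then consider "k = 6 * a" | "k = 6 * a + 2" | "k = 6 * a + 4"
    unfolding a_def by (metis add.right_neutral mult_div_mod_eq)
  then show ?thesis
  proof cases
    case 1
    have "real (Suc k) * (pi / 6) = pi / 6 + real a * pi" using 1 by (simp add: field_simps)
    then have "cos (real (Suc k) * (pi / 6)) = (-1) ^ a * (sqrt 3 / 2)"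
      by (simp only: cos_add cos_npi sin_npi cos_30) simp
    then have c: "\<bar>cos (real (Suc k) * (pi / 6))\<bar> \<ge> sqrt 3 / 2" "(-1) ^ a * cos (real (Suc k) * (pi / 6)) > 0"
      by (rule signed_value; simp)+
    have "twisted_series k (- exp (- pi * cot (pi / 6))) * cos (real (Suc k) * (pi / 6)) > 0"
      using k k8 c pi_gt_zero by (intro twisted_series_sign sin_square_lower) auto
    then have nz: "twisted_series k (- exp (- 2 * pi * (sqrt 3 / 2)) :: real) \<noteq> 0" unfolding e30 by auto
    have "pi / 6 < real (a + 1) * pi / real (Suc k)" using 1 by (simp add: field_simps)
    note ub = twisted_zeros_upper_bound[OF k(1) k8 order_refl _ c this _ a1(1), unfolded s30, folded Z_def]
    have fin: "finite Z" using ub(1) 1 by simp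
    have "card Z \<le> a - 1" using ub(2) 1 by simp
    moreover have "a - 1 \<le> card Z"
      using twisted_zeros_lower_bound(1)[OF k(1) k8 a1(2,1) pos t1] fin unfolding Z_def by simp
    moreover have "(k - 4) div 6 = a - 1" using 1 a1 by presburger
    ultimately show ?thesis using nz fin 1 by simp
  next
    case 2
    \<comment> \<open>The next angle with N phi in pi Z, where |cos(N phi)| = 1. The enlarged range
      holds at most a zeros; one of them is the elliptic point, which leaves a - 1 above it.\<close>
    define phi where "phi = real (a + 1) * pi / real (Suc k)"
    have zero: "twisted_series k (- exp (- 2 * pi * (sqrt 3 / 2)) :: real) = 0"
    proof -
      have "exp (2 * of_real pi * \<i> * rho) = of_real (- exp (- 2 * pi * (sqrt 3 / 2)))"
        using exp_half_line[of rho] by (simp add: rho_def)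
      moreover have "twisted_series k (exp (2 * of_real pi * \<i> * rho)) = 0"
      proof (rule twisted_series_zero_at_rho)
        show "k mod 6 = 2" using 2 by presburger
      qed (use k8 in simp)
      ultimately have "twisted_series k (complex_of_real (- exp (- 2 * pi * (sqrt 3 / 2)))) = 0" by simp
      then show ?thesis using k8 by (subst (asm) twisted_of_real) auto
    qed
    have lo: "pi / 6 < phi" using 2 by (simp add: phi_def field_simps)
    have hi: "phi \<le> 2 * pi / 9"
    proof -
      have "9 * (a + 1) \<le> 2 * Suc k" using 2 a1 by simp
      then have "real (9 * (a + 1)) \<le> real (2 * Suc k)" by (simp only: of_nat_le_iff)
      then have "9 * real (a + 1) * pi \<le> 2 * real (Suc k) * pi" by (intro mult_right_mono) auto
      then show ?thesis by (simp add: phi_def field_simps)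
    qed
    have "cos (real (Suc k) * phi) = (-1) ^ (a + 1)" unfolding phi_def
      by (simp del: of_nat_Suc of_nat_add power_Suc)
    then have c: "\<bar>cos (real (Suc k) * phi)\<bar> \<ge> sqrt 3 / 2" "(-1) ^ (a + 1) * cos (real (Suc k) * phi) > 0"
      using half_sqrt_3_le_1 by (simp_all add: power_abs flip: power_mult_distrib)
    define Z' where "Z' = {t. t > cot phi / 2 \<and> twisted_series k (- exp (- 2 * pi * t) :: real) = 0}"
    have lt: "phi < real (a + 1 + 1) * pi / real (Suc k)" by (simp add: phi_def divide_strict_right_mono)
    note ub = twisted_zeros_upper_bound[OF k(1) k8 less_imp_le[OF lo] hi c lt, folded Z'_def]
    have fin': "finite Z'" "card Z' \<le> a" using ub 2 a1 by simp_all
    have "cot phi < cot (pi / 6)" using lo hi pi_gt_zero by (intro cot_strict_antimono) auto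
    then have lt': "cot phi / 2 < sqrt 3 / 2" by (simp add: cot_pi_6)
    have sub: "insert (sqrt 3 / 2) Z \<subseteq> Z'" using zero lt' by (auto simp: Z_def Z'_def)
    have fin: "finite Z" using sub fin' by (meson finite_insert finite_subset)
    have "Suc (card Z) = card (insert (sqrt 3 / 2) Z)" using fin by (simp add: Z_def)
    also have "\<dots> \<le> card Z'" using sub fin' by (intro card_mono) auto
    finally have "card Z \<le> a - 1" using fin' by simp
    moreover have "a - 1 \<le> card Z"
      using twisted_zeros_lower_bound(1)[OF k(1) k8 a1(2,1) pos t1] fin unfolding Z_def by simp
    moreover have "(k - 4) div 6 = a - 1" using 2 a1 by presburger
    moreover have "k mod 6 = 2" using 2 by presburger
    ultimately show ?thesis using zero fin by simp
  next
    case 3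
    have "real (Suc k) * (pi / 6) = real (a + 1) * pi - pi / 6" using 3 by (simp add: field_simps)
    then have "cos (real (Suc k) * (pi / 6)) = (-1) ^ (a + 1) * (sqrt 3 / 2)"
      by (simp only: cos_diff cos_npi sin_npi cos_30)
    then have c: "\<bar>cos (real (Suc k) * (pi / 6))\<bar> \<ge> sqrt 3 / 2" "(-1) ^ (a + 1) * cos (real (Suc k) * (pi / 6)) > 0"
      by (rule signed_value; simp)+
    have "twisted_series k (- exp (- pi * cot (pi / 6))) * cos (real (Suc k) * (pi / 6)) > 0"
      using k k8 c pi_gt_zero by (intro twisted_series_sign sin_square_lower) auto
    then have F: "twisted_series k (- exp (- 2 * pi * (sqrt 3 / 2))) * cos (real (Suc k) * (pi / 6)) > 0" unfolding e30 .
    then have nz: "twisted_series k (- exp (- 2 * pi * (sqrt 3 / 2)) :: real) \<noteq> 0" by auto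
    \<comment> \<open>F has the sign (-1)^(a+1) at the endpoint but (-1)^a at the lowest sample
      point; this supplies the additional zero.\<close>
    have sgn: "(-1) ^ Suc a * twisted_series k (- exp (- 2 * pi * (sqrt 3 / 2)) :: real) > 0"
    proof -
      have "F * c > 0 \<Longrightarrow> s * c > 0 \<Longrightarrow> s * F > 0" for F c s :: real by (auto simp: zero_less_mult_iff)
      from this[OF F c(2)] show ?thesis by (simp only: Suc_eq_plus1)
    qed
    have "pi / 6 < real (a + 1 + 1) * pi / real (Suc k)" using 3 by (simp add: field_simps)
    note ub = twisted_zeros_upper_bound[OF k(1) k8 order_refl _ c this, unfolded s30, folded Z_def]
    have fin: "finite Z" using ub(1) 3 a1 by simp
    have "card Z \<le> a" using ub(2) 3 a1 by simp
    moreover have "a \<le> card Z"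
      using twisted_zeros_lower_bound(2)[OF k(1) k8 a1(2,1) pos t1 _ sgn] fin unfolding Z_def by simp
    moreover have "(k - 4) div 6 = a" using 3 by presburger
    ultimately show ?thesis using nz fin 3 by simp
  qed
qed

theorem theorem2:
  fixes k :: nat
  assumes "k \<ge> 4" and "even k"
  shows "(deriv (Eisenstein_E k) (Complex (1 / 2) (sqrt 3 / 2)) = 0 \<longleftrightarrow> [k = 2] (mod 6))
       \<and> finite {z. Re z = 1 / 2 \<and> Im z > sqrt 3 / 2 \<and> deriv (Eisenstein_E k) z = 0}
       \<and> int (card {z. Re z = 1 / 2 \<and> Im z > sqrt 3 / 2 \<and> deriv (Eisenstein_E k) z = 0})
           = \<lfloor>(real k - 4) / 6\<rfloor>"
proof -
  define Z where "Z = {t. t > sqrt 3 / 2 \<and> twisted_series k (- exp (- 2 * pi * t) :: real) = 0}"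
  have count: "(twisted_series k (- exp (- 2 * pi * (sqrt 3 / 2)) :: real) = 0 \<longleftrightarrow> k mod 6 = 2)"
    "finite Z" "card Z = (k - 4) div 6"
    using twisted_zero_count[OF assms(2,1)] unfolding Z_def by blast+
  have "deriv (Eisenstein_E k) (Complex (1 / 2) (sqrt 3 / 2)) = 0 \<longleftrightarrow> [k = 2] (mod 6)"
    using deriv_Eisenstein_E_zero_iff[OF assms, of "Complex (1 / 2) (sqrt 3 / 2)"] count(1)
    by (simp add: cong_def)
  moreover have eq: "{z. Re z = 1 / 2 \<and> Im z > sqrt 3 / 2 \<and> deriv (Eisenstein_E k) z = 0} = Complex (1 / 2) ` Z"
  proof -
    have half: "deriv (Eisenstein_E k) z = 0 \<longleftrightarrow> twisted_series k (- exp (- 2 * pi * Im z) :: real) = 0"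
      if "Re z = 1 / 2" "Im z > sqrt 3 / 2" for z
    proof (rule deriv_Eisenstein_E_zero_iff[OF assms that(1)])
      have "0 < sqrt 3 / 2" by simp
      then show "Im z > 0" using that(2) by linarith
    qed
    show ?thesis
    proof (intro equalityI subsetI)
      fix z assume "z \<in> {z. Re z = 1 / 2 \<and> Im z > sqrt 3 / 2 \<and> deriv (Eisenstein_E k) z = 0}"
      then show "z \<in> Complex (1 / 2) ` Z" using half[of z]
        by (intro image_eqI[of _ _ "Im z"]) (auto simp: Z_def complex_eq_iff)
    next
      fix z assume "z \<in> Complex (1 / 2) ` Z"
      then obtain t where "t \<in> Z" "z = Complex (1 / 2) t" by blast
      then show "z \<in> {z. Re z = 1 / 2 \<and> Im z > sqrt 3 / 2 \<and> deriv (Eisenstein_E k) z = 0}"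
        using half[of z] by (simp add: Z_def)
    qed
  qed
  moreover have "card (Complex (1 / 2) ` Z) = card Z" by (rule card_image) (auto simp: inj_on_def)
  moreover have "\<lfloor>(real k - 4) / 6\<rfloor> = int ((k - 4) div 6)"
  proof -
    have "(real k - 4) / 6 = real (k - 4) / real 6" using assms by (simp add: of_nat_diff)
    then show ?thesis by (simp only: floor_divide_of_nat_eq)
  qed
  ultimately show ?thesis using count by (simp add: finite_imageI)
qed

end
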